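(* Let $1<p<5$, $\lambda_1<0$, $\lambda_2<0$ and $Z>0$. Then the equilibrium solution $u(x,t)=\phi_0(x)$, with $\phi_0$ defined in the context, of the equation $$iu_t+u_{xx}+Z\delta(x)u+\lambda_1u|u|^{p-1}+\lambda_2u|u|^{2p-2}=0,\qquad t,x\in\mathbb{R},$$ is orbitally stable in $H^1(\mathbb{R})$.
   Context: Functions are complex-valued and $\delta$ is the Dirac distribution at the origin. The operator $-\partial_{xx}-Z\delta(x)$ is the self-adjoint operator $A_Z$ on $L^2(\mathbb{R})$ with $A_Zf=-f''$ for $x\ne0$ and domain $D(A_Z)=\{f\in H^1(\mathbb{R})\cap H^2(\mathbb{R}\setminus\{0\}): f'(0+)-f'(0-)=-Zf(0)\}$; it extends to a bounded operator $H^1(\mathbb{R})\to H^{-1}(\mathbb{R})$ by $\langle A_Zu,v\rangle=\mathrm{Re}\int_{\mathbb{R}}u'\overline{v'}\,dx-Z\,\mathrm{Re}(u(0)\overline{v(0)})$. The equation means $iu_t-A_Zu+\lambda_1u|u|^{p-1}+\lambda_2u|u|^{2p-2}=0$ in $H^{-1}(\mathbb{R})$, with solutions $u\in C(\mathbb{R};H^1(\mathbb{R}))\cap C^1(\mathbb{R};H^{-1}(\mathbb{R}))$; for these parameters the Cauchy problem is globally well-posed in $H^1(\mathbb{R})$. Profile: let $l_0=\frac{\sqrt{|\lambda_2|}(p+1)}{\sqrt{p}(p-1)\lambda_1}<0$ and let $R_2:(-l_0,\infty)\to(0,\infty)$ be the (decreasing) diffeomorphism $R_2(d)=\frac{d}{(p-1)(d^2-l_0^2)}$.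 Then $$\phi_0(x)=\left[\frac{-2p(p+1)\lambda_1}{p(p-1)^2\lambda_1^2\left(|x|+R_2^{-1}\left(\frac{Z}{4}\right)\right)^2+(p+1)^2\lambda_2}\right]^{\frac{1}{p-1}}.$$ Orbital stability: $\phi_0$ is orbitally stable in $H^1(\mathbb{R})$ if for every $\epsilon>0$ there is $\eta>0$ such that whenever $u_0\in H^1(\mathbb{R})$ and $\|u_0-\phi_0\|_{H^1}<\eta$, the solution $u(t)$ with $u(0)=u_0$ satisfies $\inf_{\theta\in\mathbb{R}}\|u(t)-e^{i\theta}\phi_0\|_{H^1}<\epsilon$ for all $t\in\mathbb{R}$. *)

theory Defs
  imports "HOL-Analysis.Analysis"
begin

text \<open>Functions are Borel representatives of their classes.\<close>

definition L2 :: "(real \<Rightarrow> complex) set" where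
  "L2 = {f. f \<in> borel_measurable lborel \<and> integrable lborel (\<lambda>x. (cmod (f x))\<^sup>2)}"

text \<open>
  Weak derivatives on the line, tested against compactly supported $C^1$ functions; a set of reals
  has compact closure iff it is bounded. Real-valued tests suffice for complex-valued functions.
\<close>

definition weak_deriv :: "(real \<Rightarrow> complex) \<Rightarrow> (real \<Rightarrow> complex) \<Rightarrow> bool" where
  "weak_deriv f g \<longleftrightarrow>
    (\<forall>\<phi> \<phi>'. (\<forall>x::real. (\<phi> has_real_derivative \<phi>' x) (at x)) \<and> continuous_on UNIV \<phi>' \<and>
            bounded {x. \<phi> x \<noteq> 0} \<longrightarrow>
       (\<integral>x. \<phi>' x *\<^sub>R f x \<partial>lborel) = - (\<integral>x. \<phi> x *\<^sub>R g x \<partial>lborel))"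

lemma L2_mult_integrable:
  assumes "f \<in> L2" "g \<in> L2"
  shows "integrable lborel (\<lambda>x. f x * g x)"
proof (rule Bochner_Integration.integrable_bound)
  show "integrable lborel (\<lambda>x. (cmod (f x))\<^sup>2 + (cmod (g x))\<^sup>2)"
    using assms by (simp add: L2_def)
  show "(\<lambda>x. f x * g x) \<in> borel_measurable lborel"
    using assms by (auto simp: L2_def)
  have "cmod a * cmod b \<le> (cmod a)\<^sup>2 + (cmod b)\<^sup>2" for a b
    using sum_squares_bound[of "cmod a" "cmod b"] mult_nonneg_nonneg[OF norm_ge_zero[of a] norm_ge_zero[of b]] by linarith
  then show "AE x in lborel. norm (f x * g x) \<le> norm ((cmod (f x))\<^sup>2 + (cmod (g x))\<^sup>2)"
    by (auto simp: norm_mult)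
qed

lemma L2_cnj: "f \<in> L2 \<Longrightarrow> (\<lambda>x. cnj (f x)) \<in> L2"
  using borel_measurable_continuous_onI[OF continuous_on_cnj[OF continuous_on_id]]
  by (auto simp: L2_def intro: measurable_compose)

lemma L2_0: "(\<lambda>x. 0) \<in> L2"
  by (auto simp: L2_def)

lemma L2_mult_left: "f \<in> L2 \<Longrightarrow> (\<lambda>x. c * f x) \<in> L2"
  by (auto simp: L2_def norm_mult power_mult_distrib)

lemma L2_add:
  assumes "f \<in> L2" "g \<in> L2"
  shows "(\<lambda>x. f x + g x) \<in> L2"
proof -
  have "integrable lborel (\<lambda>x. (cmod (f x + g x))\<^sup>2)"
  proof (rule Bochner_Integration.integrable_bound)
    show "integrable lborel (\<lambda>x. 2 * (cmod (f x))\<^sup>2 + 2 * (cmod (g x))\<^sup>2)"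
      using assms by (simp add: L2_def)
    show "(\<lambda>x. (cmod (f x + g x))\<^sup>2) \<in> borel_measurable lborel"
      using assms by (auto simp: L2_def)
    have "(cmod (a + b))\<^sup>2 \<le> 2 * (cmod a)\<^sup>2 + 2 * (cmod b)\<^sup>2" for a b
    proof -
      have "(cmod (a + b))\<^sup>2 \<le> (cmod a + cmod b)\<^sup>2"
        by (intro power_mono norm_triangle_ineq) auto
      then show ?thesis
        using sum_squares_bound[of "cmod a" "cmod b"] by (simp add: power2_sum)
    qed
    then show "AE x in lborel. norm ((cmod (f x + g x))\<^sup>2) \<le> norm (2 * (cmod (f x))\<^sup>2 + 2 * (cmod (g x))\<^sup>2)"
      by auto
  qed
  then show ?thesis
    using assms by (auto simp: L2_def)
qed

lemma L2_compact_support: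
  fixes \<phi> :: "real \<Rightarrow> real"
  assumes "continuous_on UNIV \<phi>" "bounded S" "\<And>x. x \<notin> S \<Longrightarrow> \<phi> x = 0"
  shows "(\<lambda>x. complex_of_real (\<phi> x)) \<in> L2"
proof -
  obtain R where R: "S \<subseteq> cball 0 R"
    using assms(2) unfolding bounded_iff subset_iff mem_cball_0 by metis
  have "integrable lborel (\<lambda>x. indicator (cball 0 R) x *\<^sub>R (\<phi> x)\<^sup>2)"
    by (intro borel_integrable_compact continuous_intros continuous_on_subset[OF assms(1)]) auto
  also have "(\<lambda>x. indicator (cball 0 R) x *\<^sub>R (\<phi> x)\<^sup>2) = (\<lambda>x. (\<phi> x)\<^sup>2)"
    using R assms(3) by (fastforce simp: indicator_def fun_eq_iff)
  finally have "integrable lborel (\<lambda>x. (\<phi> x)\<^sup>2)" .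
  moreover have "\<phi> \<in> borel_measurable borel"
    using assms(1) by (rule borel_measurable_continuous_onI)
  ultimately show ?thesis
    by (auto simp: L2_def)
qed

lemma deriv_zero_outside:
  fixes \<phi> :: "real \<Rightarrow> real"
  assumes "\<forall>x. (\<phi> has_real_derivative \<phi>' x) (at x)" "x \<notin> closure {x. \<phi> x \<noteq> 0}"
  shows "\<phi>' x = 0"
proof -
  have "open (- closure {x. \<phi> x \<noteq> 0})" by auto
  moreover have "x \<in> - closure {x. \<phi> x \<noteq> 0}" using assms by auto
  ultimately have "eventually (\<lambda>y. y \<in> - closure {x. \<phi> x \<noteq> 0}) (nhds x)"
    by (rule eventually_nhds_in_open)
  then have "eventually (\<lambda>y. \<phi> y = 0) (nhds x)"
    by (rule eventually_mono) (use closure_subset[of "{x. \<phi> x \<noteq> 0}"] in auto)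
  then have "(\<phi> has_real_derivative 0) (at x)"
    by (subst DERIV_cong_ev[of x x _ "\<lambda>_. 0" 0 0]) auto
  then show ?thesis
    using assms(1) DERIV_unique by blast
qed

lemma test_integrable:
  fixes \<phi> :: "real \<Rightarrow> real"
  assumes "\<forall>x::real. (\<phi> has_real_derivative \<phi>' x) (at x)" "continuous_on UNIV \<phi>'"
    "bounded {x. \<phi> x \<noteq> 0}" "f \<in> L2"
  shows "integrable lborel (\<lambda>x. \<phi> x *\<^sub>R f x)" "integrable lborel (\<lambda>x. \<phi>' x *\<^sub>R f x)"
proof -
  have "continuous_on UNIV \<phi>"
    using assms(1) DERIV_isCont continuous_at_imp_continuous_on by blast
  then have "(\<lambda>x. complex_of_real (\<phi> x)) \<in> L2"
    by (rule L2_compact_support[OF _ assms(3)]) auto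
  then show "integrable lborel (\<lambda>x. \<phi> x *\<^sub>R f x)"
    unfolding scaleR_conv_of_real using assms(4) by (rule L2_mult_integrable)
  have "(\<lambda>x. complex_of_real (\<phi>' x)) \<in> L2"
    using deriv_zero_outside[OF assms(1)] assms(3)
    by (intro L2_compact_support[OF assms(2), of "closure {x. \<phi> x \<noteq> 0}"]) auto
  then show "integrable lborel (\<lambda>x. \<phi>' x *\<^sub>R f x)"
    unfolding scaleR_conv_of_real using assms(4) by (rule L2_mult_integrable)
qed

lemma weak_deriv_0: "weak_deriv (\<lambda>x. 0) (\<lambda>x. 0)"
  by (auto simp: weak_deriv_def)

lemma weak_deriv_mult_left: "weak_deriv f g \<Longrightarrow> weak_deriv (\<lambda>x. c * f x) (\<lambda>x. c * g x)"
  by (auto simp: weak_deriv_def simp flip: mult_scaleR_right)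

lemma weak_deriv_add:
  assumes "weak_deriv f f'" "weak_deriv g g'" "f \<in> L2" "f' \<in> L2" "g \<in> L2" "g' \<in> L2"
  shows "weak_deriv (\<lambda>x. f x + g x) (\<lambda>x. f' x + g' x)"
  unfolding weak_deriv_def
proof (intro allI impI)
  fix \<phi> \<phi>' :: "real \<Rightarrow> real"
  assume *: "(\<forall>x. (\<phi> has_real_derivative \<phi>' x) (at x)) \<and> continuous_on UNIV \<phi>' \<and> bounded {x. \<phi> x \<noteq> 0}"
  then have i: "integrable lborel (\<lambda>x. \<phi> x *\<^sub>R h x)" "integrable lborel (\<lambda>x. \<phi>' x *\<^sub>R h x)" if "h \<in> L2" for h
    using test_integrable[of \<phi> \<phi>'] that by blast+
  have "(\<integral>x. \<phi>' x *\<^sub>R f x \<partial>lborel) = - (\<integral>x. \<phi> x *\<^sub>R f' x \<partial>lborel)"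
    "(\<integral>x. \<phi>' x *\<^sub>R g x \<partial>lborel) = - (\<integral>x. \<phi> x *\<^sub>R g' x \<partial>lborel)"
    using * assms(1,2) unfolding weak_deriv_def by blast+
  then show "(\<integral>x. \<phi>' x *\<^sub>R (f x + g x) \<partial>lborel) = - (\<integral>x. \<phi> x *\<^sub>R (f' x + g' x) \<partial>lborel)"
    using i assms by (simp add: scaleR_add_right)
qed

lemma DERIV_pos_sq:
  "((\<lambda>x::real. (max 0 x)\<^sup>2) has_real_derivative 2 * max 0 x) (at x)"
proof -
  consider "x > 0" | "x < 0" | "x = 0" by linarith
  then show ?thesis
  proof cases
    case 1
    have "eventually (\<lambda>y. y \<in> {0<..}) (nhds x)"
      using 1 by (intro eventually_nhds_in_open) auto
    then have ev: "eventually (\<lambda>y. (max 0 y)\<^sup>2 = y\<^sup>2) (nhds x)"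
      by (rule eventually_mono) simp
    have "((\<lambda>y. y\<^sup>2) has_real_derivative 2 * max 0 x) (at x)"
      using 1 DERIV_pow[of 2 x] by simp
    then show ?thesis
      unfolding DERIV_cong_ev[OF refl ev refl] .
  next
    case 2
    have "eventually (\<lambda>y. y \<in> {..<0}) (nhds x)"
      using 2 by (intro eventually_nhds_in_open) auto
    then have ev: "eventually (\<lambda>y. (max 0 y)\<^sup>2 = 0) (nhds x)"
      by (rule eventually_mono) simp
    have "((\<lambda>y. 0) has_real_derivative 2 * max 0 x) (at x)"
      using 2 by simp
    then show ?thesis
      unfolding DERIV_cong_ev[OF refl ev refl] .
  next
    case 3
    have "((\<lambda>h::real. ((max 0 (0+h))\<^sup>2 - (max 0 0)\<^sup>2) / h) \<longlongrightarrow> 0) (at 0)"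
    proof (rule Lim_null_comparison)
      have "norm (((max 0 (0+h))\<^sup>2 - (max 0 0)\<^sup>2) / h) \<le> \<bar>h\<bar>" for h :: real
        by (cases "h > 0") (simp_all add: power2_eq_square max_def)
      then show "eventually (\<lambda>h::real. norm (((max 0 (0+h))\<^sup>2 - (max 0 0)\<^sup>2) / h) \<le> \<bar>h\<bar>) (at 0)"
        by (intro always_eventually allI)
      show "((\<lambda>h::real. \<bar>h\<bar>) \<longlongrightarrow> 0) (at 0)"
        using tendsto_rabs[OF tendsto_ident_at, of "0::real" UNIV] by simp
    qed
    then show ?thesis
      using 3 by (simp add: DERIV_def)
  qed
qed

lemma indicator_integrable:
  assumes "h \<in> L2"
  shows "integrable lborel (\<lambda>x. indicat_real {a<..<b} x *\<^sub>R h x)"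
proof -
  have "(\<lambda>x. (cmod (complex_of_real (indicator {a<..<b} x)))\<^sup>2) = (indicator {a<..<b} :: real \<Rightarrow> real)"
    by (auto simp: indicator_def)
  moreover have "integrable lborel (indicator {a<..<b} :: real \<Rightarrow> real)"
    by (cases "a \<le> b") auto
  ultimately have "(\<lambda>x. complex_of_real (indicator {a<..<b} x)) \<in> L2"
    unfolding L2_def by simp
  then show ?thesis
    unfolding scaleR_conv_of_real using assms by (rule L2_mult_integrable)
qed

lemma test_zero_interval:
  assumes h: "h \<in> L2"
    and zero: "\<And>\<phi> \<phi>'. (\<forall>x::real. (\<phi> has_real_derivative \<phi>' x) (at x)) \<Longrightarrow> continuous_on UNIV \<phi>' \<Longrightarrow>
            bounded {x. \<phi> x \<noteq> 0} \<Longrightarrow> (\<integral>x. \<phi> x *\<^sub>R h x \<partial>lborel) = 0"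
  shows "(\<integral>x. indicator {a<..<b} x *\<^sub>R h x \<partial>lborel) = 0"
proof -
  define m where "m x = (max 0 (x-a))\<^sup>2 * (max 0 (b-x))\<^sup>2" for x
  define m' where "m' x = (max 0 (x-a))\<^sup>2 * (- (2 * max 0 (b-x))) + 2 * max 0 (x-a) * (max 0 (b-x))\<^sup>2" for x
  define \<phi> where "\<phi> n x = m x / (m x + 1 / Suc n)" for n :: nat and x
  define \<phi>' where "\<phi>' n x = (m' x * (m x + 1 / Suc n) - m x * m' x) / (m x + 1 / Suc n)\<^sup>2" for n :: nat and x
  have m0: "m x \<ge> 0" for x by (simp add: m_def)
  then have mp: "m x + 1 / Suc n > 0" for x and n :: nat
    by (intro add_nonneg_pos) auto
  have mn: "m x + 1 / Suc n \<noteq> 0" for x and n :: nat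
    using mp[of x n] by linarith
  have m_zero: "m x = 0" if "x \<notin> {a<..<b}" for x
    using that by (auto simp: m_def max_def)
  have m_pos: "m x > 0" if "x \<in> {a<..<b}" for x
    using that by (auto simp: m_def max_def)
  have d1: "((\<lambda>x. (max 0 (x-a))\<^sup>2) has_real_derivative 2 * max 0 (x-a)) (at x)" for x
  proof -
    have "((\<lambda>x. x - a) has_real_derivative 1) (at x)"
      by (auto intro!: derivative_eq_intros)
    from DERIV_chain2[where g="\<lambda>x. x - a", OF DERIV_pos_sq this] show ?thesis by simp
  qed
  have d2: "((\<lambda>x. (max 0 (b-x))\<^sup>2) has_real_derivative - (2 * max 0 (b-x))) (at x)" for x
  proof -
    have "((\<lambda>x. b - x) has_real_derivative -1) (at x)"
      by (auto intro!: derivative_eq_intros)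
    from DERIV_chain2[where g="\<lambda>x. b - x", OF DERIV_pos_sq this] show ?thesis by simp
  qed
  have dm: "(m has_real_derivative m' x) (at x)" for x
    unfolding m_def m'_def using DERIV_mult'[OF d1 d2] .
  have d\<phi>: "(\<phi> n has_real_derivative \<phi>' n x) (at x)" for n x
  proof -
    have "((\<lambda>x. m x + 1 / Suc n) has_real_derivative m' x) (at x)"
      using DERIV_add[OF dm DERIV_const] by simp
    from DERIV_divide[OF dm this mn] show ?thesis
      unfolding \<phi>_def \<phi>'_def by (simp add: power2_eq_square)
  qed
  have cm: "continuous_on UNIV m" "continuous_on UNIV m'"
    unfolding m_def m'_def by (intro continuous_intros)+
  have c: "continuous_on UNIV (\<phi>' n)" for n
    unfolding \<phi>'_def by (intro continuous_intros cm) (use mn in auto)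
  have cc: "continuous_on UNIV (\<phi> n)" for n
    unfolding \<phi>_def by (intro continuous_intros cm) (use mn in auto)
  have "{x. \<phi> n x \<noteq> 0} \<subseteq> {a<..<b}" for n
    using m_zero unfolding \<phi>_def by (metis (mono_tags, lifting) div_0 mem_Collect_eq subsetI)
  then have bd: "bounded {x. \<phi> n x \<noteq> 0}" for n
    by (rule bounded_subset[OF bounded_box[of a b, simplified box_real]])
  have z: "(\<integral>x. \<phi> n x *\<^sub>R h x \<partial>lborel) = 0" for n
    using zero[OF _ c bd] d\<phi> by blast
  have hm[measurable]: "h \<in> borel_measurable lborel" using h by (simp add: L2_def)
  have w: "integrable lborel (\<lambda>x. indicat_real {a<..<b} x *\<^sub>R h x)"
    by (rule indicator_integrable[OF h])
  have "(\<lambda>n. (\<integral>x. \<phi> n x *\<^sub>R h x \<partial>lborel)) \<longlonglongrightarrow> (\<integral>x. indicator {a<..<b} x *\<^sub>R h x \<partial>lborel)"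
  proof (rule integral_dominated_convergence[OF _ _ integrable_norm[OF w]])
    show "(\<lambda>x. indicat_real {a<..<b} x *\<^sub>R h x) \<in> borel_measurable lborel" by measurable
    show "(\<lambda>x. \<phi> n x *\<^sub>R h x) \<in> borel_measurable lborel" for n
      using borel_measurable_continuous_onI[OF cc[of n]] hm by measurable
    have "(\<lambda>n. \<phi> n x) \<longlonglongrightarrow> indicat_real {a<..<b} x" for x
    proof (cases "x \<in> {a<..<b}")
      case True
      have "(\<lambda>n. m x / (m x + 1 / Suc n)) \<longlonglongrightarrow> m x / (m x + 0)"
        using m_pos[OF True] LIMSEQ_Suc[OF lim_1_over_n[where 'a=real]]
        by (intro tendsto_divide tendsto_add tendsto_const) auto
      then show ?thesis using True m_pos[OF True] unfolding \<phi>_def by (simp del: of_nat_Suc)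
    qed (simp add: \<phi>_def m_zero)
    then show "AE x in lborel. (\<lambda>n. \<phi> n x *\<^sub>R h x) \<longlonglongrightarrow> indicat_real {a<..<b} x *\<^sub>R h x"
      by (intro always_eventually allI tendsto_scaleR tendsto_const)
    have "\<bar>\<phi> n x\<bar> \<le> 1" for n x
      unfolding \<phi>_def using m0[of x] mp[of x n] by (subst abs_of_nonneg) (simp_all del: of_nat_Suc)
    then have "\<bar>\<phi> n x\<bar> \<le> indicat_real {a<..<b} x" for n x
      by (cases "x \<in> {a<..<b}") (simp_all add: \<phi>_def m_zero)
    then show "AE x in lborel. norm (\<phi> n x *\<^sub>R h x) \<le> norm (indicat_real {a<..<b} x *\<^sub>R h x)" for n
      by (intro always_eventually allI) (simp add: mult_right_mono)
  qed
  then show ?thesis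
    unfolding z by (simp add: LIMSEQ_const_iff)
qed

lemma test_zero_AE:
  assumes h: "h \<in> L2"
    and zero: "\<And>\<phi> \<phi>'. (\<forall>x::real. (\<phi> has_real_derivative \<phi>' x) (at x)) \<Longrightarrow> continuous_on UNIV \<phi>' \<Longrightarrow>
            bounded {x. \<phi> x \<noteq> 0} \<Longrightarrow> (\<integral>x. \<phi> x *\<^sub>R h x \<partial>lborel) = 0"
  shows "AE x in lborel. h x = 0"
proof -
  have hm[measurable]: "h \<in> borel_measurable borel" using h by (simp add: L2_def)
  have "AE x in lborel. indicator {-real N<..<real N} x *\<^sub>R h x = 0" for N :: nat
  proof (rule sigma_finite_measure.density_zero[OF sigma_finite_lborel])
    let ?f = "\<lambda>x. indicat_real {-real N<..<real N} x *\<^sub>R h x"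
    show int: "integrable lborel ?f"
      by (rule indicator_integrable[OF h])
    have si: "set_integrable lborel A ?f" if "A \<in> sets borel" for A
      unfolding set_integrable_def by (rule integrable_mult_indicator[OF _ int]) (use that in simp)
    fix A :: "real set" assume "A \<in> sets lborel"
    then have A: "A \<in> sigma_sets UNIV (range greaterThan)"
      by (simp add: borel_Ioi)
    have IS: "Int_stable (range (greaterThan :: real \<Rightarrow> real set))"
    proof (rule Int_stableI)
      fix a b :: "real set" assume "a \<in> range greaterThan" "b \<in> range greaterThan"
      then obtain x y where "a = {x<..}" "b = {y<..}" by auto
      then have "a \<inter> b = {max x y<..}" by auto
      then show "a \<inter> b \<in> range greaterThan" by auto
    qed
    show "set_lebesgue_integral lborel A ?f = 0"
    proof (rule sigma_sets_induct_disjoint[OF IS _ A])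
      show "range greaterThan \<subseteq> Pow (UNIV::real set)" by auto
    next
      fix A assume "A \<in> range (greaterThan :: real \<Rightarrow> real set)"
      then obtain a where A: "A = {a<..}" by auto
      have "set_lebesgue_integral lborel A ?f = (\<integral>x. indicator {max a (-real N)<..<real N} x *\<^sub>R h x \<partial>lborel)"
        unfolding set_lebesgue_integral_def A
        by (intro Bochner_Integration.integral_cong) (auto simp: indicator_def)
      then show "set_lebesgue_integral lborel A ?f = 0"
        using test_zero_interval[OF assms] by simp
    next
      show "set_lebesgue_integral lborel {} ?f = 0" by (simp add: set_lebesgue_integral_def)
    next
      fix A assume A: "A \<in> sigma_sets UNIV (range (greaterThan :: real \<Rightarrow> real set))"
        and 0: "set_lebesgue_integral lborel A ?f = 0"
      then have [measurable]: "A \<in> sets borel" by (simp add: borel_Ioi)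
      have "set_lebesgue_integral lborel (A \<union> (UNIV - A)) ?f = set_lebesgue_integral lborel A ?f + set_lebesgue_integral lborel (UNIV - A) ?f"
        by (intro set_integral_Un si) auto
      moreover have "set_lebesgue_integral lborel (A \<union> (UNIV - A)) ?f = 0"
        using test_zero_interval[OF assms] by (simp add: set_lebesgue_integral_def)
      ultimately show "set_lebesgue_integral lborel (UNIV - A) ?f = 0" using 0 by simp
    next
      fix A :: "nat \<Rightarrow> real set" assume d: "disjoint_family A" and A: "range A \<subseteq> sigma_sets UNIV (range greaterThan)"
        and 0: "\<And>i. set_lebesgue_integral lborel (A i) ?f = 0"
      have [measurable]: "A i \<in> sets borel" for i using A by (auto simp: borel_Ioi)
      have "set_lebesgue_integral lborel (\<Union>i. A i) ?f = (\<Sum>i. set_lebesgue_integral lborel (A i) ?f)"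
        using d by (intro lebesgue_integral_countable_add si) (auto simp: disjoint_family_on_def)
      then show "set_lebesgue_integral lborel (\<Union>i. A i) ?f = 0" using 0 by simp
    qed
  qed
  then have "AE x in lborel. \<forall>N::nat. indicator {-real N<..<real N} x *\<^sub>R h x = 0"
    unfolding AE_all_countable by blast
  then show ?thesis
  proof (rule eventually_mono)
    fix x assume *: "\<forall>N::nat. indicat_real {-real N<..<real N} x *\<^sub>R h x = 0"
    obtain N :: nat where "\<bar>x\<bar> < real N" using reals_Archimedean2 by blast
    then have "x \<in> {-real N<..<real N}" by auto
    then show "h x = 0" using *[rule_format, of N] by simp
  qed
qed

lemma weak_deriv_unique:
  assumes "weak_deriv f g" "weak_deriv f g'" "g \<in> L2" "g' \<in> L2"
  shows "AE x in lborel. g x = g' x"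
proof -
  have n: "(\<lambda>x. - g' x) \<in> L2" using L2_mult_left[OF assms(4), of "-1"] by simp
  have "AE x in lborel. g x + - g' x = 0"
  proof (rule test_zero_AE)
    show "(\<lambda>x. g x + - g' x) \<in> L2" by (rule L2_add[OF assms(3) n])
    fix \<phi> \<phi>' :: "real \<Rightarrow> real"
    assume *: "\<forall>x. (\<phi> has_real_derivative \<phi>' x) (at x)" "continuous_on UNIV \<phi>'" "bounded {x. \<phi> x \<noteq> 0}"
    have "(\<integral>x. \<phi>' x *\<^sub>R f x \<partial>lborel) = - (\<integral>x. \<phi> x *\<^sub>R g x \<partial>lborel)"
      using assms(1)[unfolded weak_deriv_def, rule_format, of \<phi> \<phi>'] * by blast
    moreover have "(\<integral>x. \<phi>' x *\<^sub>R f x \<partial>lborel) = - (\<integral>x. \<phi> x *\<^sub>R g' x \<partial>lborel)"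
      using assms(2)[unfolded weak_deriv_def, rule_format, of \<phi> \<phi>'] * by blast
    ultimately have "(\<integral>x. \<phi> x *\<^sub>R g x \<partial>lborel) = (\<integral>x. \<phi> x *\<^sub>R g' x \<partial>lborel)"
      by simp
    then show "(\<integral>x. \<phi> x *\<^sub>R (g x + - g' x) \<partial>lborel) = 0"
      using test_integrable(1)[OF * assms(3)] test_integrable(1)[OF * assms(4)]
      by (simp add: scaleR_diff_right)
  qed
  then show ?thesis by (rule eventually_mono) simp
qed


lemma continuous_AE_0:
  fixes f :: "real \<Rightarrow> complex"
  assumes "continuous_on UNIV f" "AE x in lborel. f x = 0"
  shows "f x = 0"
proof -
  have op: "open {x. f x \<noteq> 0}"
    using assms(1) by (intro open_Collect_neq) auto
  have "{x \<in> space lborel. \<not> f x = 0} \<in> null_sets lborel"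
    using assms(2) op by (subst (asm) AE_iff_null) auto
  then have "negligible {x. f x \<noteq> 0}"
    by (simp add: negligible_iff_null_sets null_sets_completionI)
  then have "{x. f x \<noteq> 0} = {}"
    using op open_not_negligible by blast
  then show ?thesis by auto
qed

text \<open>
  The elements of $H^1(\mathbb{R})$ are represented by their (unique) continuous representatives,
  so that point values such as $u(0)$ make sense.
\<close>

typedef h1 = "{f :: real \<Rightarrow> complex. continuous_on UNIV f \<and> f \<in> L2 \<and> (\<exists>g\<in>L2. weak_deriv f g)}"
  morphisms h1_fun Abs_h1
  by (rule exI[of _ "\<lambda>_. 0"]) (use L2_0 weak_deriv_0 in auto)

setup_lifting type_definition_h1

text \<open>The weak derivative is only determined up to null sets; any representative may be chosen.\<close>

definition h1_deriv :: "h1 \<Rightarrow> real \<Rightarrow> complex" where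
  "h1_deriv u = (SOME g. g \<in> L2 \<and> weak_deriv (h1_fun u) g)"

lift_definition cscale :: "complex \<Rightarrow> h1 \<Rightarrow> h1" is "\<lambda>c f x. c * f x"
  by (auto intro!: continuous_intros L2_mult_left weak_deriv_mult_left)

lemma h1_fun_L2: "h1_fun u \<in> L2" and h1_fun_cont: "continuous_on UNIV (h1_fun u)"
  using h1_fun[of u] by auto

lemma h1_deriv: "h1_deriv u \<in> L2" "weak_deriv (h1_fun u) (h1_deriv u)"
proof -
  have "\<exists>g. g \<in> L2 \<and> weak_deriv (h1_fun u) g"
    using h1_fun[of u] by auto
  from someI_ex[OF this] show "h1_deriv u \<in> L2" "weak_deriv (h1_fun u) (h1_deriv u)"
    unfolding h1_deriv_def by auto
qed

lemma h1_deriv_eq_AE: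
  "weak_deriv (h1_fun u) g \<Longrightarrow> g \<in> L2 \<Longrightarrow> AE x in lborel. h1_deriv u x = g x"
  using weak_deriv_unique h1_deriv by blast

instantiation h1 :: real_vector
begin

lift_definition zero_h1 :: h1 is "\<lambda>x. 0"
  using L2_0 weak_deriv_0 by auto

lift_definition plus_h1 :: "h1 \<Rightarrow> h1 \<Rightarrow> h1" is "\<lambda>f g x. f x + g x"
  by (auto intro!: continuous_intros L2_add) (metis L2_add weak_deriv_add)

definition scaleR_h1 :: "real \<Rightarrow> h1 \<Rightarrow> h1" where
  "scaleR_h1 r u = cscale (complex_of_real r) u"

definition uminus_h1 :: "h1 \<Rightarrow> h1" where
  "uminus_h1 u = cscale (- 1) u"

definition minus_h1 :: "h1 \<Rightarrow> h1 \<Rightarrow> h1" where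
  "minus_h1 u v = u + - v"

lemma h1_eqI: "(\<And>x. h1_fun u x = h1_fun v x) \<Longrightarrow> u = v"
  by (metis ext h1_fun_inject)

lemma h1_fun_simps:
  "h1_fun 0 x = 0" "h1_fun (u + v) x = h1_fun u x + h1_fun v x"
  "h1_fun (cscale c u) x = c * h1_fun u x" "h1_fun (r *\<^sub>R u) x = r *\<^sub>R h1_fun u x"
  "h1_fun (- u) x = - h1_fun u x" "h1_fun (u - v) x = h1_fun u x - h1_fun v x"
  by (simp_all add: zero_h1.rep_eq plus_h1.rep_eq cscale.rep_eq scaleR_h1_def uminus_h1_def
      minus_h1_def scaleR_conv_of_real)

instance
proof
  fix u v w :: h1 and a b :: real
  show "u + v + w = u + (v + w)" "u + v = v + u" "0 + u = u" "- u + u = 0" "u - v = u + - v"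
    "a *\<^sub>R (u + v) = a *\<^sub>R u + a *\<^sub>R v" "(a + b) *\<^sub>R u = a *\<^sub>R u + b *\<^sub>R u"
    "a *\<^sub>R b *\<^sub>R u = (a * b) *\<^sub>R u" "1 *\<^sub>R u = u"
    by (rule h1_eqI; simp add: h1_fun_simps algebra_simps)+
qed

end

lemma h1_deriv_add_AE: "AE x in lborel. h1_deriv (u + v) x = h1_deriv u x + h1_deriv v x"
  by (rule h1_deriv_eq_AE)
    (auto simp: plus_h1.rep_eq intro: weak_deriv_add L2_add h1_deriv h1_fun_L2)

lemma h1_deriv_cscale_AE: "AE x in lborel. h1_deriv (cscale c u) x = c * h1_deriv u x"
  by (rule h1_deriv_eq_AE)
    (auto simp: cscale.rep_eq intro: weak_deriv_mult_left L2_mult_left h1_deriv h1_fun_L2)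

lemma L2_cnj_integrable: "f \<in> L2 \<Longrightarrow> g \<in> L2 \<Longrightarrow> integrable lborel (\<lambda>x. f x * cnj (g x))"
  by (rule L2_mult_integrable[OF _ L2_cnj])

lemma L2_measurable: "f \<in> L2 \<Longrightarrow> f \<in> borel_measurable borel"
  by (simp add: L2_def)

lemma L2_sq_eq: "f \<in> L2 \<Longrightarrow> Re (\<integral>x. f x * cnj (f x) \<partial>lborel) = (\<integral>x. (cmod (f x))\<^sup>2 \<partial>lborel)"
  unfolding complex_norm_square[symmetric] of_real_power[symmetric] integral_complex_of_real by simp

instantiation h1 :: real_inner
begin

definition inner_h1 :: "h1 \<Rightarrow> h1 \<Rightarrow> real" where
  "inner_h1 u v = Re (\<integral>x. h1_fun u x * cnj (h1_fun v x) \<partial>lborel)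
                + Re (\<integral>x. h1_deriv u x * cnj (h1_deriv v x) \<partial>lborel)"

definition norm_h1 :: "h1 \<Rightarrow> real" where
  "norm_h1 u = sqrt ((\<integral>x. (cmod (h1_fun u x))\<^sup>2 \<partial>lborel) + (\<integral>x. (cmod (h1_deriv u x))\<^sup>2 \<partial>lborel))"

definition sgn_h1 :: "h1 \<Rightarrow> h1" where
  "sgn_h1 u = inverse (norm u) *\<^sub>R u"

definition dist_h1 :: "h1 \<Rightarrow> h1 \<Rightarrow> real" where
  "dist_h1 u v = norm (u - v)"

definition uniformity_h1 :: "(h1 \<times> h1) filter" where
  "uniformity_h1 = (INF e\<in>{0 <..}. principal {(x, y). dist x y < e})"

definition open_h1 :: "h1 set \<Rightarrow> bool" where
  "open_h1 S = (\<forall>x\<in>S. \<forall>\<^sub>F (x', y) in uniformity. x' = x \<longrightarrow> y \<in> S)"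

instance
proof
  fix u v w :: h1 and a b :: real
  show "dist u v = norm (u - v)" "sgn u = u /\<^sub>R norm u"
    "uniformity = (INF e\<in>{0 <..}. principal {(x, y :: h1). dist x y < e})"
    by (simp_all add: dist_h1_def sgn_h1_def uniformity_h1_def)
  show "open S = (\<forall>x\<in>S. \<forall>\<^sub>F (x', y) in uniformity. x' = x \<longrightarrow> y \<in> S)" for S :: "h1 set"
    by (simp add: open_h1_def)
  note [measurable] = L2_measurable[OF h1_deriv(1)] L2_measurable[OF h1_fun_L2]
  have sym: "Re (\<integral>x. f x * cnj (g x) \<partial>lborel) = Re (\<integral>x. g x * cnj (f x) \<partial>lborel)" for f g :: "real \<Rightarrow> complex"
  proof -
    have "(\<integral>x. f x * cnj (g x) \<partial>lborel) = (\<integral>x. cnj (g x * cnj (f x)) \<partial>lborel)"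
      by (simp add: mult.commute)
    also have "\<dots> = cnj (\<integral>x. g x * cnj (f x) \<partial>lborel)"
      by (rule Bochner_Integration.integral_cnj)
    finally show ?thesis by simp
  qed
  show "u \<bullet> v = v \<bullet> u"
    unfolding inner_h1_def using sym[of "h1_fun u" "h1_fun v"] sym[of "h1_deriv u" "h1_deriv v"]
    by (simp only:)
  have cm: "(\<lambda>x. cnj (f x)) \<in> borel_measurable borel" if "f \<in> L2" for f
    using L2_measurable[OF L2_cnj[OF that]] .
  note [measurable] = cm[OF h1_deriv(1)] cm[OF h1_fun_L2]
  have "(\<integral>x. h1_deriv (u + v) x * cnj (h1_deriv w x) \<partial>lborel)
      = (\<integral>x. h1_deriv u x * cnj (h1_deriv w x) + h1_deriv v x * cnj (h1_deriv w x) \<partial>lborel)"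
    by (rule integral_cong_AE) (use h1_deriv_add_AE[of u v] in \<open>auto simp: algebra_simps elim: eventually_mono\<close>)
  then show "(u + v) \<bullet> w = u \<bullet> w + v \<bullet> w"
    unfolding inner_h1_def
    by (simp add: h1_fun_simps distrib_right L2_cnj_integrable h1_deriv h1_fun_L2)
  have "(\<integral>x. h1_deriv (a *\<^sub>R u) x * cnj (h1_deriv v x) \<partial>lborel)
      = (\<integral>x. complex_of_real a * (h1_deriv u x * cnj (h1_deriv v x)) \<partial>lborel)"
    by (rule integral_cong_AE)
      (use h1_deriv_cscale_AE[of a u] in \<open>auto simp: scaleR_h1_def elim: eventually_mono\<close>)
  then show "(a *\<^sub>R u) \<bullet> v = a * (u \<bullet> v)"
    unfolding inner_h1_def
    by (simp add: h1_fun_simps scaleR_conv_of_real mult.assoc distrib_left)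
  have n: "u \<bullet> u = (\<integral>x. (cmod (h1_fun u x))\<^sup>2 \<partial>lborel) + (\<integral>x. (cmod (h1_deriv u x))\<^sup>2 \<partial>lborel)"
    by (simp add: inner_h1_def L2_sq_eq h1_deriv h1_fun_L2)
  have i: "(\<integral>x. (cmod (f x))\<^sup>2 \<partial>lborel) \<ge> 0" for f :: "real \<Rightarrow> complex"
    by (rule Bochner_Integration.integral_nonneg) simp
  show "0 \<le> u \<bullet> u" unfolding n by (intro add_nonneg_nonneg i)
  show "norm u = sqrt (u \<bullet> u)" unfolding n norm_h1_def ..
  show "u \<bullet> u = 0 \<longleftrightarrow> u = 0"
  proof
    assume "u \<bullet> u = 0"
    then have "(\<integral>x. (cmod (h1_fun u x))\<^sup>2 \<partial>lborel) = 0"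
      unfolding n using i[of "h1_fun u"] i[of "h1_deriv u"] by linarith
    then have "AE x in lborel. (cmod (h1_fun u x))\<^sup>2 = 0"
      using h1_fun_L2[of u] by (subst (asm) integral_nonneg_eq_0_iff_AE) (auto simp: L2_def)
    then have "AE x in lborel. h1_fun u x = 0" by simp
    from continuous_AE_0[OF h1_fun_cont this] show "u = 0"
      by (intro h1_eqI) (simp add: h1_fun_simps)
  next
    assume "u = 0"
    then have 0: "weak_deriv (h1_fun u) (\<lambda>x. 0)"
      by (simp add: zero_h1.rep_eq weak_deriv_0)
    have "(\<integral>x. (cmod (h1_deriv u x))\<^sup>2 \<partial>lborel) = 0"
      by (rule integral_eq_zero_AE) (use h1_deriv_eq_AE[OF 0 L2_0] in \<open>auto elim: eventually_mono\<close>)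
    then show "u \<bullet> u = 0"
      unfolding n using \<open>u = 0\<close> by (simp add: h1_fun_simps)
  qed
qed

end



text \<open>
  $H^{-1}(\mathbb{R})$ is the space of bounded real-linear functionals on $H^1(\mathbb{R})$, and
  $H^1(\mathbb{R})$ is embedded in it through the pairing
  $\langle u, v\rangle = \mathrm{Re}\int u\,\overline{v}\,dx$.
\<close>

type_synonym h1_minus = "h1 \<Rightarrow>\<^sub>L real"

lift_definition h1_embed :: "h1 \<Rightarrow> h1_minus" is
  "\<lambda>u v. Re (\<integral>x. h1_fun u x * cnj (h1_fun v x) \<partial>lborel)"
proof -
  fix u :: h1
  define T where "T v = Re (\<integral>x. h1_fun u x * cnj (h1_fun v x) \<partial>lborel)" for v
  define A where "A = (\<integral>x. (cmod (h1_fun u x))\<^sup>2 \<partial>lborel)"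
  have add: "T (v + w) = T v + T w" for v w
    by (simp add: T_def h1_fun_simps distrib_left L2_cnj_integrable h1_fun_L2)
  have scale: "T (a *\<^sub>R v) = a * T v" for a v
    by (simp add: T_def h1_fun_simps scaleR_conv_of_real mult.left_commute)
  have sq: "integrable lborel (\<lambda>x. (cmod (h1_fun v x))\<^sup>2)" for v
    using h1_fun_L2[of v] by (simp add: L2_def)
  have le: "\<bar>T v\<bar> \<le> A + (norm v)\<^sup>2" for v
  proof -
    have "\<bar>T v\<bar> \<le> cmod (\<integral>x. h1_fun u x * cnj (h1_fun v x) \<partial>lborel)"
      unfolding T_def by (rule abs_Re_le_cmod)
    also have "\<dots> \<le> (\<integral>x. (cmod (h1_fun u x))\<^sup>2 + (cmod (h1_fun v x))\<^sup>2 \<partial>lborel)"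
    proof (rule Bochner_Integration.integral_norm_bound_integral)
      show "integrable lborel (\<lambda>x. h1_fun u x * cnj (h1_fun v x))"
        by (intro L2_cnj_integrable h1_fun_L2)
      show "integrable lborel (\<lambda>x. (cmod (h1_fun u x))\<^sup>2 + (cmod (h1_fun v x))\<^sup>2)"
        by (intro Bochner_Integration.integrable_add sq)
      fix x
      show "cmod (h1_fun u x * cnj (h1_fun v x)) \<le> (cmod (h1_fun u x))\<^sup>2 + (cmod (h1_fun v x))\<^sup>2"
        using sum_squares_bound[of "cmod (h1_fun u x)" "cmod (h1_fun v x)"]
          mult_nonneg_nonneg[OF norm_ge_zero[of "h1_fun u x"] norm_ge_zero[of "h1_fun v x"]]
        unfolding norm_mult complex_mod_cnj by linarith
    qed
    also have "\<dots> = A + (\<integral>x. (cmod (h1_fun v x))\<^sup>2 \<partial>lborel)"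
      unfolding A_def by (intro Bochner_Integration.integral_add sq)
    also have "\<dots> \<le> A + (norm v)\<^sup>2"
      by (simp add: norm_h1_def)
    finally show ?thesis .
  qed
  have "bounded_linear T"
  proof (rule bounded_linear_intro[where K = "A + 1"])
    fix v :: h1
    show "norm (T v) \<le> norm v * (A + 1)"
    proof (cases "v = 0")
      case True
      then show ?thesis using scale[of 0 v] by simp
    next
      case False
      define w where "w = v /\<^sub>R norm v"
      have "norm w = 1" "v = norm v *\<^sub>R w" using False by (simp_all add: w_def)
      then show ?thesis
        using le[of w] scale[of "norm v" w] by (metis abs_mult abs_norm_cancel mult_left_mono norm_ge_zero one_power2 real_norm_def)
    qed
  qed (simp_all add: add scale)
  then show "bounded_linear (\<lambda>v. Re (\<integral>x. h1_fun u x * cnj (h1_fun v x) \<partial>lborel))"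
    unfolding T_def .
qed

text \<open>
  The extension $H^1 \to H^{-1}$ of the self-adjoint operator $A_Z = -\partial_{xx} - Z\delta$;
  the jump condition $f'(0+) - f'(0-) = -Z f(0)$ of its domain is encoded in the point term.
\<close>

definition delta_form :: "real \<Rightarrow> h1 \<Rightarrow> h1 \<Rightarrow> real" where
  "delta_form Z u v = Re (\<integral>x. h1_deriv u x * cnj (h1_deriv v x) \<partial>lborel)
                    - Z * Re (h1_fun u 0 * cnj (h1_fun v 0))"

definition nonlinearity :: "real \<Rightarrow> real \<Rightarrow> real \<Rightarrow> complex \<Rightarrow> complex" where
  "nonlinearity p lam1 lam2 z =
     complex_of_real lam1 * z * complex_of_real (cmod z powr (p - 1)) +
     complex_of_real lam2 * z * complex_of_real (cmod z powr (2 * p - 2))"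

text \<open>
  A solution is $u \in C(\mathbb{R}; H^1) \cap C^1(\mathbb{R}; H^{-1})$ for which
  $i u_t - A_Z u + \lambda_1 u|u|^{p-1} + \lambda_2 u|u|^{2p-2}$ is the zero functional.
  Multiplication by $i$ on $H^{-1}$ is $\langle i w, v\rangle = \langle w, -i v\rangle$, in
  agreement with the pairing of functions.
\<close>

definition nls_solution :: "real \<Rightarrow> real \<Rightarrow> real \<Rightarrow> real \<Rightarrow> (real \<Rightarrow> h1) \<Rightarrow> bool" where
  "nls_solution p lam1 lam2 Z u \<longleftrightarrow>
     continuous_on UNIV u \<and>
     (\<exists>u_t :: real \<Rightarrow> h1_minus.
        continuous_on UNIV u_t \<and>
        (\<forall>t. ((\<lambda>s. h1_embed (u s)) has_vector_derivative u_t t) (at t)) \<and>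
        (\<forall>t v. blinfun_apply (u_t t) (cscale (- \<i>) v) - delta_form Z (u t) v
           + Re (\<integral>x. nonlinearity p lam1 lam2 (h1_fun (u t) x) * cnj (h1_fun v x) \<partial>lborel) = 0))"

text \<open>
  The Cauchy problem is globally well-posed in $H^1(\mathbb{R})$, so quantifying over all solutions
  with initial value \<open>u0\<close> refers to the solution.
\<close>

definition orbitally_stable :: "real \<Rightarrow> real \<Rightarrow> real \<Rightarrow> real \<Rightarrow> h1 \<Rightarrow> bool" where
  "orbitally_stable p lam1 lam2 Z \<phi> \<longleftrightarrow>
     (\<forall>\<epsilon>>0. \<exists>\<eta>>0. \<forall>u0. norm (u0 - \<phi>) < \<eta> \<longrightarrow>
        (\<forall>u. nls_solution p lam1 lam2 Z u \<and> u 0 = u0 \<longrightarrow>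
           (\<forall>t. (INF \<theta>::real. norm (u t - cscale (cis \<theta>) \<phi>)) < \<epsilon>)))"

definition l0 :: "real \<Rightarrow> real \<Rightarrow> real \<Rightarrow> real" where
  "l0 p lam1 lam2 = sqrt \<bar>lam2\<bar> * (p + 1) / (sqrt p * (p - 1) * lam1)"

definition R2 :: "real \<Rightarrow> real \<Rightarrow> real \<Rightarrow> real \<Rightarrow> real" where
  "R2 p lam1 lam2 d = d / ((p - 1) * (d\<^sup>2 - (l0 p lam1 lam2)\<^sup>2))"

definition R2_inv :: "real \<Rightarrow> real \<Rightarrow> real \<Rightarrow> real \<Rightarrow> real" where
  "R2_inv p lam1 lam2 = inv_into {- l0 p lam1 lam2 <..} (R2 p lam1 lam2)"

definition phi0 :: "real \<Rightarrow> real \<Rightarrow> real \<Rightarrow> real \<Rightarrow> real \<Rightarrow> real" where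
  "phi0 p lam1 lam2 Z x =
     (- 2 * p * (p + 1) * lam1 /
       (p * (p - 1)\<^sup>2 * lam1\<^sup>2 * (\<bar>x\<bar> + R2_inv p lam1 lam2 (Z / 4))\<^sup>2 + (p + 1)\<^sup>2 * lam2))
     powr (1 / (p - 1))"

end

theory Submission
  imports Defs
begin

text \<open>
  With both nonlinear terms defocusing, \<open>\<phi>\<close> minimizes the energy without any constraint. Indeed
  \<open>\<phi> > 0\<close> solves \<open>- \<phi>'' - Z \<delta> \<phi> + W(\<phi>) \<phi> = 0\<close> with \<open>W(s) = - \<lambda>\<^sub>1 s\<^bsup>p-1\<^esup> - \<lambda>\<^sub>2 s\<^bsup>2p-2\<^esup>\<close>, so the ground
  state representation gives
  \<open>\<integral>\<bar>u'\<bar>\<^sup>2 - Z \<bar>u(0)\<bar>\<^sup>2 + \<integral>W(\<phi>) \<bar>u\<bar>\<^sup>2 = \<integral>\<phi>\<^sup>2 \<bar>(u/\<phi>)'\<bar>\<^sup>2\<close>, and twice the energy gap of \<open>u\<close> over \<open>\<phi>\<close> is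
  this integral plus \<open>2 \<integral>H(\<phi>, \<bar>u\<bar>)\<close>, where \<open>H \<ge> 0\<close> vanishes only for \<open>\<bar>u\<bar> = \<phi>\<close>. If the gap is small,
  then \<open>u/\<phi>\<close> is nearly constant on each bounded interval, and the constant has modulus close to \<open>1\<close>.
  If moreover the mass of \<open>u\<close> hardly exceeds that of \<open>\<phi>\<close>, no mass can sit near infinity, so \<open>u\<close> is
  close to the orbit of \<open>\<phi>\<close> in \<open>L\<^sup>2\<close> and then in \<open>H\<^sup>1\<close>. Stability follows because mass and energy are
  conserved.
\<close>

subsection \<open>Absolutely continuous functions on an interval\<close>

text \<open>The profile has frequency zero, so it decays only like a power of \<open>x\<close> and
  the quadratic form has no mass term that would control \<open>u\<close> far out. The energy gap
  therefore gives local information only, and the L2 norm at infinity has to come from the second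
  conserved quantity. The restriction \<open>p < 5\<close> enters through the decay of the profile:
  its square behaves like the power \<open>- 4 / (p - 1)\<close> of \<open>x\<close> and must be
  integrable.

  Two facts shape the preparations. The derivative of an H1 function is only an L2 class, so
  products such as \<open>u / phi\<close> or \<open>k * |u|^2\<close> are differentiated in
  integrated form on bounded intervals, and the results are carried to the line by a limit. The
  profile has a kink at the origin, so its logarithmic derivative jumps there. Identities are proved
  on the two half lines and added, and the jump produces the point term of the operator.\<close>

definition ac_on :: "real \<Rightarrow> real \<Rightarrow> (real \<Rightarrow> complex) \<Rightarrow> (real \<Rightarrow> complex) \<Rightarrow> bool" where
  "ac_on a b f g \<longleftrightarrow> g absolutely_integrable_on {a..b} \<and>
     (\<forall>x y. a \<le> x \<and> x \<le> y \<and> y \<le> b \<longrightarrow> (g has_integral (f y - f x)) {x..y})"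

lemma ac_onD:
  assumes "ac_on a b f g"
  shows "g absolutely_integrable_on {a..b}"
    "\<And>x y. a \<le> x \<Longrightarrow> x \<le> y \<Longrightarrow> y \<le> b \<Longrightarrow> (g has_integral (f y - f x)) {x..y}"
  using assms unfolding ac_on_def by auto

lemma ac_on_continuous:
  assumes "ac_on a b f g"
  shows "continuous_on {a..b} f"
proof (cases "a \<le> b")
  case True
  have "g integrable_on {a..b}"
    using ac_onD(2)[OF assms, of a b] True by auto
  then have "continuous_on {a..b} (\<lambda>x. f a + integral {a..x} g)"
    by (intro continuous_intros indefinite_integral_continuous_1)
  moreover have "f a + integral {a..x} g = f x" if "x \<in> {a..b}" for x
    using ac_onD(2)[OF assms, of a x] that by (simp add: integral_unique)
  ultimately show ?thesis
    by (metis (mono_tags, lifting) continuous_on_cong)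
qed auto

lemma ac_on_C1:
  assumes "\<And>x. x \<in> {a..b} \<Longrightarrow> (f has_vector_derivative g x) (at x within {a..b})"
    and "continuous_on {a..b} g"
  shows "ac_on a b f g"
  unfolding ac_on_def
proof (intro conjI allI impI)
  show "g absolutely_integrable_on {a..b}"
    using assms(2) by (rule absolutely_integrable_continuous_real)
  fix x y assume "a \<le> x \<and> x \<le> y \<and> y \<le> b"
  then show "(g has_integral (f y - f x)) {x..y}"
    by (intro fundamental_theorem_of_calculus)
      (auto intro: has_vector_derivative_within_subset[OF assms(1)])
qed

lemma ac_on_cnj:
  assumes "ac_on a b f g"
  shows "ac_on a b (\<lambda>x. cnj (f x)) (\<lambda>x. cnj (g x))"
proof -
  have "(\<lambda>x. cnj (g x)) absolutely_integrable_on {a..b}"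
    using absolutely_integrable_linear[OF ac_onD(1)[OF assms] bounded_linear_cnj]
    by (simp add: o_def)
  then show ?thesis
    using has_integral_cnj[of g] ac_onD(2)[OF assms] unfolding ac_on_def
    by (auto simp flip: complex_cnj_diff simp: o_def)
qed

lemma ac_on_combine:
  assumes "ac_on a c f g" "ac_on c b f g" "a \<le> c" "c \<le> b"
  shows "ac_on a b f g"
  unfolding ac_on_def
proof (intro conjI allI impI)
  have "g absolutely_integrable_on ({a..c} \<union> {c..b})"
    using ac_onD(1)[OF assms(1)] ac_onD(1)[OF assms(2)] by (rule absolutely_integrable_Un) 
  then show "g absolutely_integrable_on {a..b}"
    using assms by (simp add: ivl_disj_un_two_touch)
  fix x y assume xy: "a \<le> x \<and> x \<le> y \<and> y \<le> b"
  consider "y \<le> c" | "c \<le> x" | "x \<le> c" "c \<le> y" by linarith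
  then show "(g has_integral (f y - f x)) {x..y}"
  proof cases
    case 3
    have "(g has_integral ((f c - f x) + (f y - f c))) {x..y}"
      using 3 xy by (intro has_integral_combine[OF 3] ac_onD(2)[OF assms(1)] ac_onD(2)[OF assms(2)]) auto
    then show ?thesis by simp
  qed (use xy ac_onD(2)[OF assms(1)] ac_onD(2)[OF assms(2)] in auto)
qed

lemma absolutely_integrable_continuous_mult:
  fixes f g :: "real \<Rightarrow> complex"
  assumes "continuous_on {a..b} f" "g absolutely_integrable_on {a..b}"
  shows "(\<lambda>x. f x * g x) absolutely_integrable_on {a..b}"
  using assms
  by (intro absolutely_integrable_bounded_measurable_product[where h="(*)"]
      continuous_imp_measurable_on_sets_lebesgue)
    (auto intro: compact_imp_bounded compact_continuous_image bilinear_times)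

text \<open>
  Both sides are additive over intervals, and on a short interval they differ by at most
  $\varepsilon$ times the variation.
\<close>

lemma ac_on_mult:
  assumes 1: "ac_on a b f1 g1" and 2: "ac_on a b f2 g2"
  shows "ac_on a b (\<lambda>x. f1 x * f2 x) (\<lambda>x. f1 x * g2 x + f2 x * g1 x)"
proof -
  define G where "G x = f1 x * g2 x + f2 x * g1 x" for x
  define m where "m x = norm (g1 x) + norm (g2 x)" for x
  note c = ac_on_continuous[OF 1] ac_on_continuous[OF 2]
  note ai = ac_onD(1)[OF 1] ac_onD(1)[OF 2]
  have Ga: "G absolutely_integrable_on {a..b}"
    unfolding G_def by (intro set_integral_add absolutely_integrable_continuous_mult c ai)
  have ma: "m integrable_on {a..b}"
    unfolding m_def by (intro integrable_add) (use ai in \<open>auto simp: absolutely_integrable_on_def\<close>)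
  have main: "(G has_integral (f1 y * f2 y - f1 x * f2 x)) {x..y}" if xy: "a \<le> x" "x \<le> y" "y \<le> b" for x y
  proof -
    define D where "D u v = f1 v * f2 v - f1 u * f2 u - integral {u..v} G" for u v
    have Gi: "G integrable_on {u..v}" if "a \<le> u" "v \<le> b" for u v
      using Ga that by (auto simp: absolutely_integrable_on_def intro: integrable_on_subinterval)
    have mi: "m integrable_on {u..v}" if "a \<le> u" "v \<le> b" for u v
      using ma that by (auto intro: integrable_on_subinterval)
    have small: "norm (D x y) \<le> e * integral {x..y} m" if "e > 0" for e
    proof -
      have uc: "uniformly_continuous_on {a..b} f1" "uniformly_continuous_on {a..b} f2"
        by (auto intro!: compact_uniformly_continuous c)
      obtain d1 where d1: "d1 > 0" "\<And>u v. u \<in> {a..b} \<Longrightarrow> v \<in> {a..b} \<Longrightarrow> dist v u < d1 \<Longrightarrow> dist (f1 v) (f1 u) < e"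
        using uc(1) \<open>e > 0\<close> unfolding uniformly_continuous_on_def by metis
      obtain d2 where d2: "d2 > 0" "\<And>u v. u \<in> {a..b} \<Longrightarrow> v \<in> {a..b} \<Longrightarrow> dist v u < d2 \<Longrightarrow> dist (f2 v) (f2 u) < e"
        using uc(2) \<open>e > 0\<close> unfolding uniformly_continuous_on_def by metis
      have "x \<le> y \<longrightarrow> a \<le> x \<longrightarrow> y \<le> b \<longrightarrow> norm (D x y) \<le> e * integral {x..y} m"
        using xy(2)
      proof (rule Bolzano[where P="\<lambda>u v. u \<le> v \<longrightarrow> a \<le> u \<longrightarrow> v \<le> b \<longrightarrow> norm (D u v) \<le> e * integral {u..v} m"])
        fix u v w
        assume uv: "u \<le> v \<longrightarrow> a \<le> u \<longrightarrow> v \<le> b \<longrightarrow> norm (D u v) \<le> e * integral {u..v} m"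
          and vw: "v \<le> w \<longrightarrow> a \<le> v \<longrightarrow> w \<le> b \<longrightarrow> norm (D v w) \<le> e * integral {v..w} m"
          and le: "u \<le> v" "v \<le> w"
        show "u \<le> w \<longrightarrow> a \<le> u \<longrightarrow> w \<le> b \<longrightarrow> norm (D u w) \<le> e * integral {u..w} m"
        proof (intro impI)
          assume "a \<le> u" "w \<le> b"
          then have "D u w = D u v + D v w"
            "integral {u..w} m = integral {u..v} m + integral {v..w} m"
            unfolding D_def using le Henstock_Kurzweil_Integration.integral_combine[OF le Gi]
              Henstock_Kurzweil_Integration.integral_combine[OF le mi] by (auto simp: algebra_simps)
          then show "norm (D u w) \<le> e * integral {u..w} m"
            using uv vw le \<open>a \<le> u\<close> \<open>w \<le> b\<close> norm_triangle_ineq[of "D u v" "D v w"]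
            by (simp add: distrib_left)
        qed
      next
        fix z :: real
        show "\<exists>d>0. \<forall>u v. u \<le> z \<and> z \<le> v \<and> v - u < d \<longrightarrow>
            (u \<le> v \<longrightarrow> a \<le> u \<longrightarrow> v \<le> b \<longrightarrow> norm (D u v) \<le> e * integral {u..v} m)"
        proof (intro exI[of _ "min d1 d2"] conjI allI impI)
          show "0 < min d1 d2" using d1 d2 by simp
          fix u v assume uv: "u \<le> z \<and> z \<le> v \<and> v - u < min d1 d2" "u \<le> v" "a \<le> u" "v \<le> b"
          \<comment> \<open>Freezing \<open>f1\<close> at the right end and \<open>f2\<close> at the
            left end makes the integral equal to the increment of the product exactly, so
            \<open>D u v\<close> only measures the error of freezing.\<close>
          have "((\<lambda>s. f1 v * g2 s + f2 u * g1 s) has_integral (f1 v * (f2 v - f2 u) + f2 u * (f1 v - f1 u))) {u..v}"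
            using uv by (intro has_integral_add has_integral_mult_right ac_onD(2)[OF 1] ac_onD(2)[OF 2]) auto
          then have "((\<lambda>s. f1 v * g2 s + f2 u * g1 s - G s) has_integral D u v) {u..v}"
            using has_integral_diff[OF _ integrable_integral[OF Gi[of u v]]] uv
            unfolding D_def by (fastforce simp: algebra_simps)
          then have eq: "D u v = integral {u..v} (\<lambda>s. f1 v * g2 s + f2 u * g1 s - G s)"
            "(\<lambda>s. f1 v * g2 s + f2 u * g1 s - G s) integrable_on {u..v}"
            by (auto simp: integral_unique)
          have "norm (D u v) \<le> integral {u..v} (\<lambda>s. e * m s)"
            unfolding eq(1)
          proof (rule integral_norm_bound_integral[OF eq(2)])
            show "(\<lambda>s. e * m s) integrable_on {u..v}"
              using integrable_cmul[OF mi[of u v], of e] uv by simp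
            fix s assume s: "s \<in> {u..v}"
            have b: "norm (f1 v - f1 s) \<le> e" "norm (f2 u - f2 s) \<le> e"
              using d1(2)[of s v] d2(2)[of s u] s uv by (auto simp: dist_norm)
            have "f1 v * g2 s + f2 u * g1 s - G s = (f1 v - f1 s) * g2 s + (f2 u - f2 s) * g1 s"
              by (simp add: G_def algebra_simps)
            also have "norm \<dots> \<le> norm (f1 v - f1 s) * norm (g2 s) + norm (f2 u - f2 s) * norm (g1 s)"
              by (metis norm_mult norm_triangle_ineq)
            also have "\<dots> \<le> e * norm (g2 s) + e * norm (g1 s)"
              by (intro add_mono mult_right_mono b) auto
            finally show "norm (f1 v * g2 s + f2 u * g1 s - G s) \<le> e * m s"
              by (simp add: m_def algebra_simps)
          qed
          then show "norm (D u v) \<le> e * integral {u..v} m" by simp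
        qed
      qed
      then show ?thesis using xy by blast
    qed
    have "norm (D x y) \<le> 0"
    proof (rule field_le_epsilon)
      fix e :: real assume "e > 0"
      have "integral {x..y} m \<ge> 0"
        by (rule integral_nonneg) (use mi xy in \<open>auto simp: m_def\<close>)
      then have "e / (integral {x..y} m + 1) * integral {x..y} m \<le> e"
        using \<open>e > 0\<close> by (simp add: field_simps)
      with small[of "e / (integral {x..y} m + 1)"] \<open>e > 0\<close> \<open>integral {x..y} m \<ge> 0\<close>
      show "norm (D x y) \<le> 0 + e" by (smt (verit, best) divide_pos_pos)
    qed
    then have "integral {x..y} G = f1 y * f2 y - f1 x * f2 x"
      by (simp add: D_def)
    then show ?thesis
      using integrable_integral[OF Gi[of x y]] xy by simp
  qed
  show ?thesis
    using Ga main unfolding ac_on_def G_def by blast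
qed

section \<open>Integrals over the line and over bounded intervals\<close>

lemma L2_set_integrable:
  assumes "f \<in> L2"
  shows "set_integrable lborel {a..b} f"
proof -
  have "(\<lambda>x. complex_of_real (indicator {a..b} x)) \<in> L2"
  proof (cases "a \<le> b")
    case True
    have "integrable lborel (indicator {a..b} :: real \<Rightarrow> real)" using True by simp
    moreover have "(\<lambda>x. (cmod (complex_of_real (indicator {a..b} x)))\<^sup>2) = (indicator {a..b} :: real \<Rightarrow> real)"
      by (auto simp: indicator_def)
    ultimately show ?thesis by (simp add: L2_def)
  qed (simp add: L2_0)
  from L2_mult_integrable[OF this assms] show ?thesis
    by (simp add: set_integrable_def scaleR_conv_of_real)
qed

lemma L2_absolutely_integrable:
  assumes "f \<in> L2"
  shows "f absolutely_integrable_on {a..b}"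
proof -
  have "complex_set_integrable lborel {a..b} (\<lambda>x. of_real (norm (f x)))"
    by (rule L2_set_integrable) (use assms in \<open>auto simp: L2_def\<close>)
  then have "set_integrable lborel {a..b} (\<lambda>x. norm (f x))"
    using set_integrable_norm[OF L2_set_integrable[OF assms]] by simp
  from set_borel_integral_eq_integral(1)[OF this] set_borel_integral_eq_integral(1)[OF L2_set_integrable[OF assms]]
  show ?thesis by (simp add: absolutely_integrable_on_def)
qed

lemma integral_expanding_intervals:
  fixes F :: "real \<Rightarrow> 'a :: {banach, second_countable_topology}"
  assumes F: "integrable lborel F"
  shows "(\<lambda>n. \<integral>x. indicator {- real n..real n} x *\<^sub>R F x \<partial>lborel) \<longlonglongrightarrow> (\<integral>x. F x \<partial>lborel)"
proof (rule integral_dominated_convergence[where w="\<lambda>x. norm (F x)"])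
  show "AE x in lborel. (\<lambda>n. indicator {- real n..real n} x *\<^sub>R F x) \<longlonglongrightarrow> F x"
  proof (rule AE_I2, rule tendsto_eventually)
    fix x :: real
    obtain N :: nat where "\<bar>x\<bar> \<le> real N" using real_arch_simple by blast
    then have "indicator {- real n..real n} x *\<^sub>R F x = F x" if "n \<ge> N" for n
      using that by (auto simp: indicator_def abs_le_iff)
    then show "\<forall>\<^sub>F n in sequentially. indicator {- real n..real n} x *\<^sub>R F x = F x"
      using eventually_sequentially by blast
  qed
qed (use F in \<open>auto simp: indicator_def\<close>)

text \<open>Once integrability on the line is known, an integral may be computed from
  antiderivatives on symmetric intervals; boundary terms then only need a limit.\<close>

lemma integral_eq_limit:
  fixes F :: "real \<Rightarrow> 'a :: euclidean_space"
  assumes F: "integrable lborel F"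
    and ev: "\<forall>\<^sub>F n in sequentially. (F has_integral c n) {- real n..real n}"
    and lim: "c \<longlonglongrightarrow> l"
  shows "(\<integral>x. F x \<partial>lborel) = l"
proof (rule LIMSEQ_unique[OF _ lim])
  have "\<forall>\<^sub>F n in sequentially. (\<integral>x. indicator {- real n..real n} x *\<^sub>R F x \<partial>lborel) = c n"
    using ev
  proof (rule eventually_mono)
    fix n assume n: "(F has_integral c n) {- real n..real n}"
    have "set_integrable lborel {- real n..real n} F"
      unfolding set_integrable_def using F by (intro integrable_mult_indicator) auto
    from set_borel_integral_eq_integral(2)[OF this] n
    show "(\<integral>x. indicator {- real n..real n} x *\<^sub>R F x \<partial>lborel) = c n"
      by (simp add: set_lebesgue_integral_def integral_unique)
  qed
  with integral_expanding_intervals[OF F] show "c \<longlonglongrightarrow> (\<integral>x. F x \<partial>lborel)"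
    by (rule Lim_transform_eventually)
qed

lemma integral_subinterval_le:
  fixes F :: "real \<Rightarrow> real"
  assumes F: "integrable lborel F" and nonneg: "\<And>x. F x \<ge> 0"
  shows "F integrable_on {x..y}" "integral {x..y} F \<le> (\<integral>x. F x \<partial>lborel)"
proof -
  have UNIV: "F integrable_on UNIV" "integral UNIV F = (\<integral>x. F x \<partial>lborel)"
    using has_integral_integral_lborel[OF F] by (auto simp: integral_unique)
  show "F integrable_on {x..y}"
    using UNIV(1) by (rule integrable_on_subinterval) simp
  then have "integral {x..y} F \<le> integral UNIV F"
    using UNIV(1) nonneg by (intro integral_subset_le) auto
  then show "integral {x..y} F \<le> (\<integral>x. F x \<partial>lborel)" using UNIV(2) by simp
qed

text \<open>
  The functions \<open>step (n (x - a)) - step (n (x - b))\<close> are the \<open>C\<^sup>1\<close> tests that approximate the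
  indicator function of \<open>(a, b]\<close>.
\<close>

definition step :: "real \<Rightarrow> real" where
  "step t = 2 * ((max 0 t)\<^sup>2 - 2 * (max 0 (t - 1/2))\<^sup>2 + (max 0 (t - 1))\<^sup>2)"

text \<open>A tent on \<open>[0, 1]\<close> with peak 2 and integral 1. Writing it in truncated
  powers lets \<open>DERIV_pos_sq\<close> differentiate its primitive \<open>step\<close>
  everywhere, with no separate treatment of the knots.\<close>

definition hat :: "real \<Rightarrow> real" where
  "hat t = 4 * (max 0 t - 2 * max 0 (t - 1/2) + max 0 (t - 1))"

lemma step_deriv: "(step has_real_derivative hat t) (at t)"
proof -
  have d: "((\<lambda>x. (max 0 (x-a))\<^sup>2) has_real_derivative 2 * max 0 (t-a)) (at t)" for a
  proof -
    have "((\<lambda>x. x - a) has_real_derivative 1) (at t)"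
      by (auto intro!: derivative_eq_intros)
    from DERIV_chain2[where g="\<lambda>x. x - a", OF DERIV_pos_sq this] show ?thesis by simp
  qed
  show ?thesis
    using DERIV_cmult[OF DERIV_add[OF DERIV_diff[OF d[of 0] DERIV_cmult[OF d[of "1/2"], of 2]] d[of 1]], of 2]
    by (simp add: step_def[abs_def] hat_def algebra_simps)
qed

lemma hat_continuous: "continuous_on A hat"
  unfolding hat_def[abs_def] by (intro continuous_intros)

lemma step_le_0: "t \<le> 0 \<Longrightarrow> step t = 0"
  by (simp add: step_def)

lemma step_ge_1: "t \<ge> 1 \<Longrightarrow> step t = 1"
  by (simp add: step_def power2_eq_square algebra_simps)

lemma hat_nonneg: "hat t \<ge> 0"
  by (simp add: hat_def max_def)

lemma hat_outside: "t \<notin> {0..1} \<Longrightarrow> hat t = 0"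
  by (auto simp: hat_def max_def)

lemma step_mono: "s \<le> t \<Longrightarrow> step s \<le> step t"
  using DERIV_nonneg_imp_nondecreasing[of s t step] step_deriv hat_nonneg by blast

lemma step_bounds: "0 \<le> step t" "step t \<le> 1"
  using step_mono[of "min t 0" t] step_mono[of t "max t 1"] step_le_0[of "min t 0"] step_ge_1[of "max t 1"]
  by simp_all

lemma hat_integral: "integrable lborel hat" "(\<integral>x. hat x \<partial>lborel) = 1"
proof -
  have "integrable lborel (\<lambda>x. indicator {0..1::real} x *\<^sub>R hat x)"
    by (intro borel_integrable_compact hat_continuous) auto
  also have "(\<lambda>x. indicator {0..1::real} x *\<^sub>R hat x) = hat"
    using hat_outside by (auto simp: indicator_def fun_eq_iff)
  finally show i: "integrable lborel hat" .
  have "(hat has_integral (step 1 - step 0)) {0..1}"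
    by (intro fundamental_theorem_of_calculus)
      (auto intro: has_field_derivative_at_within step_deriv simp flip: has_real_derivative_iff_has_vector_derivative)
  then have "(hat has_integral 1) UNIV"
    using hat_outside by (intro has_integral_on_superset[of hat 1 "{0..1}" UNIV]) (auto simp: step_le_0 step_ge_1)
  then show "(\<integral>x. hat x \<partial>lborel) = 1"
    using has_integral_integral_lborel[OF i] has_integral_unique by blast
qed

lemma hat_concentrates:
  fixes f :: "real \<Rightarrow> complex"
  assumes f: "continuous_on UNIV f"
  shows "(\<lambda>n. \<integral>x. (real (Suc n) * hat (real (Suc n) * (x - a))) *\<^sub>R f x \<partial>lborel) \<longlonglongrightarrow> f a"
proof -
  have [measurable]: "f \<in> borel_measurable borel" "hat \<in> borel_measurable borel"
    using f hat_continuous by (auto intro: borel_measurable_continuous_onI)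
  have eq: "(\<integral>x. (real (Suc n) * hat (real (Suc n) * (x - a))) *\<^sub>R f x \<partial>lborel)
      = (\<integral>x. hat x *\<^sub>R f (a + x / real (Suc n)) \<partial>lborel)" for n
    by (subst lborel_integral_real_affine[of "1 / real (Suc n)" _ a])
      (simp_all del: of_nat_Suc flip: integral_scaleR_right)
  \<comment> \<open>The rescaled tents all live to the right of \<open>a\<close>, within distance 1,
    so a bound on this compact interval dominates.\<close>
  have "bounded (f ` {a..a+1})"
    by (intro compact_imp_bounded compact_continuous_image continuous_on_subset[OF f]) auto
  then obtain M where M: "\<And>y. y \<in> {a..a+1} \<Longrightarrow> norm (f y) \<le> M"
    unfolding bounded_iff by blast
  have "(\<lambda>n. \<integral>x. hat x *\<^sub>R f (a + x / real (Suc n)) \<partial>lborel) \<longlonglongrightarrow> (\<integral>x. hat x *\<^sub>R f a \<partial>lborel)"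
  proof (rule integral_dominated_convergence[where w="\<lambda>x. hat x * M"])
    show "integrable lborel (\<lambda>x. hat x * M)"
      by (intro integrable_mult_left hat_integral)
    show "AE x in lborel. (\<lambda>n. hat x *\<^sub>R f (a + x / real (Suc n))) \<longlonglongrightarrow> hat x *\<^sub>R f a"
    proof (intro always_eventually allI tendsto_scaleR tendsto_const)
      fix x
      have "(\<lambda>n. a + x * (1 / real (Suc n))) \<longlonglongrightarrow> a + x * 0"
        using LIMSEQ_Suc[OF lim_1_over_n[where 'a=real]] by (intro tendsto_intros) auto
      moreover have "isCont f a" using f by (simp add: continuous_on_eq_continuous_at)
      ultimately show "(\<lambda>n. f (a + x / real (Suc n))) \<longlonglongrightarrow> f a"
        using isCont_tendsto_compose[of a f] by simp
    qed
    show "AE x in lborel. norm (hat x *\<^sub>R f (a + x / real (Suc n))) \<le> hat x * M" for n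
    proof (intro always_eventually allI)
      fix x
      show "norm (hat x *\<^sub>R f (a + x / real (Suc n))) \<le> hat x * M"
      proof (cases "x \<in> {0..1}")
        case True
        have "x / real (Suc n) \<le> 1 / 1" using True by (intro frac_le) auto
        moreover have "0 \<le> x / real (Suc n)" using True by simp
        ultimately have "norm (f (a + x / real (Suc n))) \<le> M"
          by (intro M) simp
        then show ?thesis using hat_nonneg[of x] by (simp add: mult_left_mono)
      qed (simp add: hat_outside)
    qed
  qed measurable
  then show ?thesis
    unfolding eq using hat_integral by simp
qed

text \<open>The derivative of a smoothed indicator is an approximate point mass at \<open>a\<close>
  minus one at \<open>b\<close>. In the limit the defining identity of the weak derivative becomes
  the fundamental theorem.\<close>

lemma weak_deriv_ftc:
  assumes w: "weak_deriv f g" and f: "continuous_on UNIV f" and g: "g \<in> L2" and f2: "f \<in> L2" and ab: "a \<le> b"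
  shows "(g has_integral (f b - f a)) {a..b}"
proof -
  have [measurable]: "g \<in> borel_measurable borel" "step \<in> borel_measurable borel"
    using L2_measurable[OF g] DERIV_isCont[OF step_deriv]
    by (auto intro!: borel_measurable_continuous_onI continuous_at_imp_continuous_on)
  define k where "k n = real (Suc n)" for n
  have k: "k n \<ge> 1" for n by (simp add: k_def)
  define \<phi> where "\<phi> n x = step (k n * (x - a)) - step (k n * (x - b))" for n x
  define h where "h c n x = k n * hat (k n * (x - c))" for c n x
  have d: "((\<lambda>x. step (k n * (x - c))) has_real_derivative h c n x) (at x)" for c n x
  proof -
    have "((\<lambda>x. k n * (x - c)) has_real_derivative k n) (at x)"
      by (auto intro!: derivative_eq_intros)
    from DERIV_chain2[OF step_deriv this] show ?thesis by (simp add: h_def mult.commute)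
  qed
  have d\<phi>: "(\<phi> n has_real_derivative h a n x - h b n x) (at x)" for n x
    unfolding \<phi>_def[abs_def] by (intro DERIV_diff d)
  have ch: "continuous_on UNIV (h c n)" for c n
    unfolding h_def[abs_def]
    by (intro continuous_intros continuous_on_compose2[OF hat_continuous[of UNIV]]) auto
  have zero: "\<phi> n x = 0" if "x \<notin> {a..b+1}" for n x
  proof (cases "x < a")
    case True
    then have "k n * (x - a) \<le> 0" "k n * (x - b) \<le> 0"
      using ab k[of n] by (auto simp: mult_le_0_iff)
    then show ?thesis by (simp add: \<phi>_def step_le_0)
  next
    case False
    then have "1 * 1 \<le> k n * (x - a)" "1 * 1 \<le> k n * (x - b)"
      using ab k[of n] that by (intro mult_mono; simp)+
    then show ?thesis by (simp add: \<phi>_def step_ge_1)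
  qed
  have bd: "bounded {x. \<phi> n x \<noteq> 0}" for n
    by (rule bounded_subset[of "{a..b+1}"], simp) (use zero[of _ n] in blast)
  have hi: "integrable lborel (\<lambda>x. h c n x *\<^sub>R f x)" for c n
  proof -
    have "h c n x = 0" if "x \<notin> {c..c+1}" for x
    proof -
      have "k n * (x - c) \<notin> {0..1}"
      proof (cases "x < c")
        case False
        then have "1 * 1 < k n * (x - c)" using that k[of n]
          by (intro mult_le_less_imp_less) auto
        then show ?thesis by simp
      qed (use k[of n] in \<open>auto simp: zero_le_mult_iff\<close>)
      then show ?thesis using hat_outside by (auto simp: h_def)
    qed
    then have "(\<lambda>x. complex_of_real (h c n x)) \<in> L2"
      by (intro L2_compact_support[OF ch, of "{c..c+1}"]) auto
    from L2_mult_integrable[OF this f2] show ?thesis by (simp add: scaleR_conv_of_real)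
  qed
  have eq: "(\<integral>x. \<phi> n x *\<^sub>R g x \<partial>lborel) = (\<integral>x. h b n x *\<^sub>R f x \<partial>lborel) - (\<integral>x. h a n x *\<^sub>R f x \<partial>lborel)" for n
  proof -
    have "continuous_on UNIV (\<lambda>x. h a n x - h b n x)" by (intro continuous_intros ch)
    then have "(\<integral>x. (h a n x - h b n x) *\<^sub>R f x \<partial>lborel) = - (\<integral>x. \<phi> n x *\<^sub>R g x \<partial>lborel)"
      by (intro w[unfolded weak_deriv_def, rule_format] conjI allI d\<phi> bd)
    then show ?thesis using hi by (simp add: scaleR_diff_left minus_equation_iff[of "\<integral>x. \<phi> n x *\<^sub>R g x \<partial>lborel"] eq_commute)
  qed
  have "(\<lambda>n. \<integral>x. \<phi> n x *\<^sub>R g x \<partial>lborel) \<longlonglongrightarrow> f b - f a"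
    unfolding eq h_def k_def by (intro tendsto_diff hat_concentrates f)
  moreover have "(\<lambda>n. \<integral>x. \<phi> n x *\<^sub>R g x \<partial>lborel) \<longlonglongrightarrow> (\<integral>x. indicator {a<..b} x *\<^sub>R g x \<partial>lborel)"
  proof (rule integral_dominated_convergence[where w="\<lambda>x. indicator {a..b+1} x * norm (g x)"])
    show "integrable lborel (\<lambda>x. indicator {a..b+1} x * norm (g x))"
      using set_integrable_norm[OF L2_set_integrable[OF g]] by (simp add: set_integrable_def)
    have le: "\<bar>\<phi> n x\<bar> \<le> 1" for n x
      using step_bounds[of "k n * (x - a)"] step_bounds[of "k n * (x - b)"] by (simp add: \<phi>_def abs_le_iff)
    show "AE x in lborel. norm (\<phi> n x *\<^sub>R g x) \<le> indicator {a..b+1} x * norm (g x)" for n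
    proof (intro always_eventually allI)
      fix x show "norm (\<phi> n x *\<^sub>R g x) \<le> indicator {a..b+1} x * norm (g x)"
        using le[of n x] zero[of x n] mult_right_mono[OF le norm_ge_zero]
        by (cases "x \<in> {a..b+1}") auto
    qed
    show "AE x in lborel. (\<lambda>n. \<phi> n x *\<^sub>R g x) \<longlonglongrightarrow> indicator {a<..b} x *\<^sub>R g x"
    proof (intro always_eventually allI tendsto_scaleR tendsto_const)
      fix x
      \<comment> \<open>The inequality is strict because \<open>step 0 = 0\<close>; hence the
        half-open interval, whose missing endpoint is a null set.\<close>
      have st: "(\<lambda>n. step (k n * (x - c))) \<longlonglongrightarrow> (if x > c then 1 else 0)" for c
      proof (cases "x > c")
        case True
        obtain N where N: "1 / (x - c) \<le> real N" using real_arch_simple by blast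
        have "step (k n * (x - c)) = 1" if "n \<ge> N" for n
        proof (rule step_ge_1)
          have "1 / (x - c) \<le> k n" using N that by (simp add: k_def)
          then show "1 \<le> k n * (x - c)" using True by (simp add: field_simps)
        qed
        then show ?thesis using True
          by (intro tendsto_eventually) (auto simp: eventually_sequentially)
      next
        case False
        then have "step (k n * (x - c)) = 0" for n
          using k[of n] by (intro step_le_0) (auto simp: mult_le_0_iff)
        then show ?thesis using False by simp
      qed
      have "(\<lambda>n. \<phi> n x) \<longlonglongrightarrow> (if x > a then 1 else 0) - (if x > b then 1 else 0)"
        unfolding \<phi>_def by (intro tendsto_diff st)
      also have "(if x > a then 1 else 0) - (if x > b then 1 else (0::real)) = indicator {a<..b} x"
        using ab by (auto simp: indicator_def)
      finally show "(\<lambda>n. \<phi> n x) \<longlonglongrightarrow> indicator {a<..b} x" .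
    qed
  qed (unfold \<phi>_def, measurable)
  ultimately have "(\<integral>x. indicator {a<..b} x *\<^sub>R g x \<partial>lborel) = f b - f a"
    using LIMSEQ_unique by blast
  moreover have "(\<integral>x. indicator {a<..b} x *\<^sub>R g x \<partial>lborel) = (\<integral>x. indicator {a..b} x *\<^sub>R g x \<partial>lborel)"
    by (rule integral_cong_AE) (auto intro!: eventually_mono[OF AE_lborel_singleton[of a]] simp: indicator_def)
  ultimately show ?thesis
    using set_borel_integral_eq_integral[OF L2_set_integrable[OF g], of a b]
    by (metis integrable_integral set_lebesgue_integral_def)
qed

lemma h1_ac: "ac_on a b (h1_fun u) (h1_deriv u)"
  unfolding ac_on_def
  using L2_absolutely_integrable[OF h1_deriv(1)]
    weak_deriv_ftc[OF h1_deriv(2) h1_fun_cont h1_deriv(1) h1_fun_L2] by blast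

subsection \<open>Integral inequalities in the Sobolev space\<close>

lemma h1_fun_measurable [measurable]: "h1_fun u \<in> borel_measurable borel"
  using L2_measurable[OF h1_fun_L2] .

lemma L2_sq_integrable: "f \<in> L2 \<Longrightarrow> integrable lborel (\<lambda>x. (cmod (f x))\<^sup>2)"
  by (simp add: L2_def)

lemma L2_diff: "f \<in> L2 \<Longrightarrow> g \<in> L2 \<Longrightarrow> (\<lambda>x. f x - g x) \<in> L2"
  using L2_add[of f "\<lambda>x. - 1 * g x"] L2_mult_left[of g "-1"] by simp

lemma L2_dominated:
  assumes "f \<in> L2" "h \<in> borel_measurable borel" "\<And>x. cmod (h x) \<le> B * cmod (f x)"
  shows "h \<in> L2"
proof -
  have "integrable lborel (\<lambda>x. (cmod (h x))\<^sup>2)"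
  proof (rule Bochner_Integration.integrable_bound)
    show "integrable lborel (\<lambda>x. B\<^sup>2 * (cmod (f x))\<^sup>2)"
      using L2_sq_integrable[OF assms(1)] by simp
    have "(cmod (h x))\<^sup>2 \<le> (B * cmod (f x))\<^sup>2" for x by (intro power_mono assms) simp
    then show "AE x in lborel. norm ((cmod (h x))\<^sup>2) \<le> norm (B\<^sup>2 * (cmod (f x))\<^sup>2)"
      by (auto simp: power_mult_distrib)
  qed (use assms in measurable)
  then show ?thesis using assms(2) by (auto simp: L2_def)
qed

lemma L2_bounded_mult:
  assumes "f \<in> L2" "h \<in> borel_measurable borel" "\<And>x. cmod (h x) \<le> B"
  shows "(\<lambda>x. h x * f x) \<in> L2"
  using assms L2_measurable[OF assms(1)]
  by (intro L2_dominated[OF assms(1), of _ B]) (auto simp: norm_mult intro: mult_right_mono)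

lemma L2_norm_mult_integrable:
  assumes "f \<in> L2" "g \<in> L2"
  shows "integrable lborel (\<lambda>x. cmod (f x) * cmod (g x))"
  using integrable_norm[OF L2_mult_integrable[OF assms]] by (simp add: norm_mult)

lemma L2_Cauchy_Schwarz:
  assumes "f \<in> L2" "g \<in> L2"
  shows "(\<integral>x. cmod (f x) * cmod (g x) \<partial>lborel)
    \<le> sqrt (\<integral>x. (cmod (f x))\<^sup>2 \<partial>lborel) * sqrt (\<integral>x. (cmod (g x))\<^sup>2 \<partial>lborel)"
proof -
  define A B C where "A = (\<integral>x. (cmod (f x))\<^sup>2 \<partial>lborel)" and "B = (\<integral>x. (cmod (g x))\<^sup>2 \<partial>lborel)"
    and "C = (\<integral>x. cmod (f x) * cmod (g x) \<partial>lborel)"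
  note i = L2_sq_integrable[OF assms(1)] L2_sq_integrable[OF assms(2)] L2_norm_mult_integrable[OF assms]
  have nn: "A \<ge> 0" "B \<ge> 0" "C \<ge> 0" unfolding A_def B_def C_def by (intro Bochner_Integration.integral_nonneg; simp)+
  have q: "0 \<le> A * s\<^sup>2 - 2 * s * t * C + B * t\<^sup>2" for s t
  proof -
    have "0 \<le> (\<integral>x. (s * cmod (f x) - t * cmod (g x))\<^sup>2 \<partial>lborel)"
      by (intro Bochner_Integration.integral_nonneg) simp
    also have "(\<lambda>x. (s * cmod (f x) - t * cmod (g x))\<^sup>2)
      = (\<lambda>x. s\<^sup>2 * (cmod (f x))\<^sup>2 - (2 * s * t) * (cmod (f x) * cmod (g x)) + t\<^sup>2 * (cmod (g x))\<^sup>2)"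
      by (simp add: power2_eq_square algebra_simps fun_eq_iff)
    also have "(\<integral>x. s\<^sup>2 * (cmod (f x))\<^sup>2 - (2 * s * t) * (cmod (f x) * cmod (g x)) + t\<^sup>2 * (cmod (g x))\<^sup>2 \<partial>lborel)
      = s\<^sup>2 * A - (2 * s * t) * C + t\<^sup>2 * B"
      unfolding A_def B_def C_def using i by simp
    finally show ?thesis by (simp add: algebra_simps)
  qed
  have "C\<^sup>2 \<le> A * B"
  proof (cases "B = 0")
    case True
    have "C = 0"
    proof (rule ccontr)
      assume "C \<noteq> 0"
      \<comment> \<open>With \<open>B = 0\<close> this choice makes the quadratic form equal to
        -1.\<close>
      then show False using q[of 1 "(A + 1) / (2 * C)"] True nn by simp
    qed
    then show ?thesis using nn by simp
  next
    case False
    then have "B > 0" using nn by simp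
    have "0 \<le> B * (A * B - C\<^sup>2)" using q[of B C] by (simp add: power2_eq_square algebra_simps)
    then show ?thesis using \<open>B > 0\<close> by (simp add: zero_le_mult_iff)
  qed
  then have "C \<le> sqrt (A * B)" by (rule real_le_rsqrt)
  then show ?thesis unfolding A_def B_def C_def by (simp add: real_sqrt_mult)
qed

section \<open>Mass, the pairing and pointwise bounds\<close>

definition mass :: "h1 \<Rightarrow> real" where
  "mass u = (\<integral>x. (cmod (h1_fun u x))\<^sup>2 \<partial>lborel)"

lemma mass_nonneg: "mass u \<ge> 0"
  unfolding mass_def by (rule Bochner_Integration.integral_nonneg) simp

lemma h1_norm_sq: "(norm u)\<^sup>2 = mass u + (\<integral>x. (cmod (h1_deriv u x))\<^sup>2 \<partial>lborel)"
  unfolding norm_h1_def mass_def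
  by (intro real_sqrt_pow2 add_nonneg_nonneg Bochner_Integration.integral_nonneg) auto

lemma mass_le_norm: "mass u \<le> (norm u)\<^sup>2"
  by (simp add: h1_norm_sq)

lemma mass_embed: "h1_embed u u = mass u"
  by (simp add: h1_embed.rep_eq mass_def L2_sq_eq h1_fun_L2)

lemma embed_sym: "h1_embed u v = h1_embed v u"
proof -
  have "(\<integral>x. h1_fun u x * cnj (h1_fun v x) \<partial>lborel) = (\<integral>x. cnj (h1_fun v x * cnj (h1_fun u x)) \<partial>lborel)"
    by (simp add: mult.commute)
  also have "\<dots> = cnj (\<integral>x. h1_fun v x * cnj (h1_fun u x) \<partial>lborel)"
    by (rule Bochner_Integration.integral_cnj)
  finally show ?thesis by (simp add: h1_embed.rep_eq)
qed

lemma embed_cscale: "h1_embed (cscale c u) v = h1_embed u (cscale (cnj c) v)"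
  by (simp add: h1_embed.rep_eq h1_fun_simps mult_ac)

lemma embed_add: "h1_embed (u + v) w = h1_embed u w + h1_embed v w"
  by (metis embed_sym blinfun.add_right)

lemma embed_diff: "h1_embed (u - v) w = h1_embed u w - h1_embed v w"
  by (metis embed_sym blinfun.diff_right)

text \<open>The integrated derivative of \<open>k * |u|^2\<close>. It serves twice: with
  \<open>k = 1\<close> for the bound on the supremum, and with the logarithmic derivative of the
  profile for the ground state representation.\<close>

lemma h1_weighted_ftc:
  fixes k k' :: "real \<Rightarrow> real"
  assumes k: "\<And>x. x \<in> {a..b} \<Longrightarrow> (k has_real_derivative k' x) (at x within {a..b})"
    and k': "continuous_on {a..b} k'" and ab: "a \<le> b"
  shows "((\<lambda>x. 2 * k x * Re (h1_deriv u x * cnj (h1_fun u x)) + k' x * (cmod (h1_fun u x))\<^sup>2) has_integral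
      k b * (cmod (h1_fun u b))\<^sup>2 - k a * (cmod (h1_fun u a))\<^sup>2) {a..b}"
proof -
  have "ac_on a b (\<lambda>x. complex_of_real (k x)) (\<lambda>x. complex_of_real (k' x))"
    by (intro ac_on_C1 has_vector_derivative_of_real continuous_intros k')
      (use k in \<open>simp add: has_real_derivative_iff_has_vector_derivative\<close>)
  from ac_onD(2)[OF ac_on_mult[OF this ac_on_mult[OF h1_ac ac_on_cnj[OF h1_ac]]], of a b u u]
  have "((\<lambda>x. of_real (k x) * (h1_fun u x * cnj (h1_deriv u x) + cnj (h1_fun u x) * h1_deriv u x)
     + h1_fun u x * cnj (h1_fun u x) * of_real (k' x)) has_integral
     of_real (k b) * (h1_fun u b * cnj (h1_fun u b)) - of_real (k a) * (h1_fun u a * cnj (h1_fun u a))) {a..b}"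
    using ab by simp
  from has_integral_linear[OF this bounded_linear_Re]
  have "((\<lambda>x. Re (of_real (k x) * (h1_fun u x * cnj (h1_deriv u x) + cnj (h1_fun u x) * h1_deriv u x)
     + h1_fun u x * cnj (h1_fun u x) * of_real (k' x))) has_integral
     Re (of_real (k b) * (h1_fun u b * cnj (h1_fun u b)) - of_real (k a) * (h1_fun u a * cnj (h1_fun u a)))) {a..b}"
    by (simp add: o_def)
  moreover have "Re (of_real r * (z * cnj w + cnj z * w) + z * cnj z * of_real r')
     = 2 * r * Re (w * cnj z) + r' * (cmod z)\<^sup>2" for r r' z w
    by (simp add: cmod_power2) (simp add: power2_eq_square algebra_simps)
  moreover have "Re (of_real r * (z * cnj z) - of_real s * (w * cnj w)) = r * (cmod z)\<^sup>2 - s * (cmod w)\<^sup>2" for r s z w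
    by (simp add: cmod_power2) (simp add: power2_eq_square)
  ultimately show ?thesis by simp
qed

text \<open>Somewhere in \<open>[x, x + 1]\<close> the square of the modulus is at most its mean
  over this interval, hence at most the mass. From there back to \<open>x\<close> it can grow by at
  most the integral of \<open>|u|^2 + |u'|^2\<close>.\<close>

lemma h1_sup_bound: "(cmod (h1_fun u x))\<^sup>2 \<le> 2 * (norm u)\<^sup>2"
proof -
  let ?m = "\<lambda>x. (cmod (h1_fun u x))\<^sup>2" and ?d = "\<lambda>x. (cmod (h1_deriv u x))\<^sup>2"
  note i = L2_sq_integrable[OF h1_fun_L2[of u]] L2_sq_integrable[OF h1_deriv(1)[of u]]
  have "\<exists>y\<ge>x. ?m y \<le> mass u"
  proof (rule ccontr)
    assume "\<not> (\<exists>y\<ge>x. ?m y \<le> mass u)"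
    then have gt: "?m y > mass u" if "y \<in> {x..x+1}" for y using that by force
    have c: "continuous_on {x..x+1} ?m"
      by (intro continuous_intros continuous_on_subset[OF h1_fun_cont]) auto
    obtain z where z: "z \<in> {x..x+1}" "\<And>y. y \<in> {x..x+1} \<Longrightarrow> ?m z \<le> ?m y"
      using continuous_attains_inf[of "{x..x+1}" ?m] c by auto
    have "?m z = integral {x..x+1} (\<lambda>_. ?m z)" by simp
    also have "\<dots> \<le> integral {x..x+1} ?m"
      using z(2) c by (intro integral_le) (auto intro: integrable_continuous_interval)
    also have "\<dots> \<le> mass u" unfolding mass_def by (intro integral_subinterval_le i) simp
    finally show False using gt[OF z(1)] by simp
  qed
  then obtain y where y: "x \<le> y" "?m y \<le> mass u" by blast
  have h: "((\<lambda>x. 2 * Re (h1_deriv u x * cnj (h1_fun u x))) has_integral ?m y - ?m x) {x..y}"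
    using h1_weighted_ftc[of x y "\<lambda>_. 1" "\<lambda>_. 0" u] y by simp
  have si: "integrable lborel (\<lambda>x. ?m x + ?d x)" using i by simp
  have "((\<lambda>x. - (2 * Re (h1_deriv u x * cnj (h1_fun u x)))) has_integral - (?m y - ?m x)) {x..y}"
    using h by (rule has_integral_neg)
  then have "- (?m y - ?m x) \<le> integral {x..y} (\<lambda>x. ?m x + ?d x)"
  proof (rule has_integral_le)
    show "((\<lambda>x. ?m x + ?d x) has_integral integral {x..y} (\<lambda>x. ?m x + ?d x)) {x..y}"
      by (intro integrable_integral integral_subinterval_le si) simp
    fix s
    have "- 2 * Re (w * cnj z) \<le> (cmod z)\<^sup>2 + (cmod w)\<^sup>2" for z w
      using zero_le_power2[of "Re z + Re w"] zero_le_power2[of "Im z + Im w"]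
      by (simp add: cmod_power2 power2_sum) (simp add: algebra_simps)
    then show "- (2 * Re (h1_deriv u s * cnj (h1_fun u s))) \<le> ?m s + ?d s" by simp
  qed
  also have "\<dots> \<le> (\<integral>x. ?m x + ?d x \<partial>lborel)" by (intro integral_subinterval_le si) simp
  also have "\<dots> = (norm u)\<^sup>2" using i by (simp add: h1_norm_sq mass_def)
  finally show ?thesis using y mass_le_norm[of u] by linarith
qed

lemma h1_sup_le: "norm u \<le> B \<Longrightarrow> cmod (h1_fun u x) \<le> 2 * B"
proof -
  assume "norm u \<le> B"
  have "(cmod (h1_fun u x))\<^sup>2 \<le> (2 * norm u)\<^sup>2"
    using h1_sup_bound[of u x] zero_le_power2[of "norm u"] unfolding four_x_squared[symmetric] by linarith
  then have "cmod (h1_fun u x) \<le> 2 * norm u" by (rule power2_le_imp_le) simp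
  with \<open>norm u \<le> B\<close> show ?thesis by simp
qed

lemma h1_deriv_diff_AE: "AE x in lborel. h1_deriv (u - v) x = h1_deriv u x - h1_deriv v x"
proof -
  have "AE x in lborel. h1_deriv (u + cscale (-1) v) x = h1_deriv u x + h1_deriv (cscale (-1) v) x"
    "AE x in lborel. h1_deriv (cscale (-1) v) x = -1 * h1_deriv v x"
    by (rule h1_deriv_add_AE h1_deriv_cscale_AE)+
  then have "AE x in lborel. h1_deriv (u + cscale (-1) v) x = h1_deriv u x - h1_deriv v x"
    by eventually_elim simp
  then show ?thesis by (simp add: minus_h1_def uminus_h1_def)
qed

subsection \<open>The nonlinearity and its potential\<close>

text \<open>This is Young's inequality for \<open>s powr (q - 1)\<close> and \<open>t\<close> with
  exponents \<open>q / (q - 1)\<close> and \<open>q\<close>; the endpoint 0 needs no separate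
  calculus.\<close>

lemma powr_tangent:
  fixes q s t :: real
  assumes q: "1 < q" and "0 \<le> s" "0 \<le> t"
  shows "q * s powr (q - 1) * (t - s) \<le> t powr q - s powr q"
proof -
  have "s powr (q - 1) * t \<le> (s powr (q - 1)) powr (q / (q - 1)) / (q / (q - 1)) + t powr q / q"
    using assms by (intro Youngs_inequality) (auto simp: field_simps)
  also have "(s powr (q - 1)) powr (q / (q - 1)) = s powr q"
    using q by (simp add: powr_powr)
  finally have "q * (s powr (q - 1) * t) \<le> (q - 1) * s powr q + t powr q"
    using q by (simp add: field_simps)
  moreover have "s powr (q - 1) * s = s powr q"
    using assms by (cases "s = 0") (simp_all add: powr_mult_base mult.commute)
  ultimately show ?thesis
    by (simp add: algebra_simps)
qed

text \<open>For \<open>q > 2\<close> the power is convex as a function of \<open>t^2\<close> as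
  well. The tangent in that variable is the one that matches the quadratic term
  \<open>weight (phi x) * |u|^2\<close> of the ground state form.\<close>

lemma powr_sq_tangent:
  fixes q s t :: real
  assumes q: "2 < q" and "0 \<le> s" "0 \<le> t"
  shows "q / 2 * s powr (q - 2) * (t\<^sup>2 - s\<^sup>2) \<le> t powr q - s powr q"
proof -
  have sq: "(r\<^sup>2) powr m = r powr (2 * m)" if "0 \<le> r" for r m :: real
    using that powr_powr[of r 2 m] by simp
  show ?thesis
    using powr_tangent[of "q / 2" "s\<^sup>2" "t\<^sup>2"] assms by (simp add: sq algebra_simps)
qed

text \<open>Strictness comes from using the tangent inequality in \<open>t\<^sup>2\<close> twice, through the midpoint.\<close>

lemma powr_sq_strict_tangent:
  fixes q e :: real
  assumes q: "2 < q" and e: "0 < e" "e < 1"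
  shows "\<exists>c>0. \<forall>s t. 0 < s \<longrightarrow> 0 \<le> t \<longrightarrow> e * s \<le> \<bar>t - s\<bar> \<longrightarrow>
    c * s powr q \<le> (t powr q - s powr q) - q / 2 * s powr (q - 2) * (t\<^sup>2 - s\<^sup>2)"
proof -
  define m where "m = q / 2"
  have m: "m > 1" using q by (simp add: m_def)
  \<comment> \<open>By homogeneity it suffices to take \<open>s = 1\<close>. With the midpoint
    \<sigma> of 1 and \<open>w^2\<close>, the two tangent inequalities leave
    \<open>m * (\<sigma> - 1) * (\<sigma> powr (m - 1) - 1)\<close>, whose last two factors have the
    same sign, and a distance \<open>e\<close> of \<open>w\<close> from 1 moves \<sigma> by at least
    \<open>e / 2\<close>.\<close>
  define c where "c = m * (e / 2 * min ((1 + e / 2) powr (m - 1) - 1) (1 - (1 - e / 2) powr (m - 1)))"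
  have "(1 + e / 2) powr (m - 1) > 1" using e m by (intro gr_one_powr) auto
  moreover have "(1 - e / 2) powr (m - 1) < 1"
    using e m powr_less_mono2[of "m - 1" "1 - e / 2" 1] by simp
  ultimately have c: "c > 0" using m e by (simp add: c_def)
  have unit: "c \<le> (w powr q - 1) - m * (w\<^sup>2 - 1)" if w: "0 \<le> w" "e \<le> \<bar>w - 1\<bar>" for w
  proof -
    define \<sigma> where "\<sigma> = (1 + w\<^sup>2) / 2"
    have s0: "\<sigma> \<ge> 0" by (simp add: \<sigma>_def)
    have wq: "(w\<^sup>2) powr m = w powr q"
      using w powr_powr[of w 2 m] by (simp add: m_def)
    have "m * (\<sigma> - 1) \<le> \<sigma> powr m - 1"
      using powr_tangent[of m 1 \<sigma>] m s0 by simp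
    moreover have "m * \<sigma> powr (m - 1) * (w\<^sup>2 - \<sigma>) \<le> w powr q - \<sigma> powr m"
      using powr_tangent[of m \<sigma> "w\<^sup>2"] m s0 wq by simp
    moreover have "w\<^sup>2 - \<sigma> = \<sigma> - 1" "w\<^sup>2 - 1 = 2 * (\<sigma> - 1)" by (simp_all add: \<sigma>_def field_simps)
    ultimately have "m * (\<sigma> - 1) + m * \<sigma> powr (m - 1) * (\<sigma> - 1) \<le> w powr q - 1"
      "m * (w\<^sup>2 - 1) = 2 * (m * (\<sigma> - 1))" by simp_all
    then have "m * ((\<sigma> - 1) * (\<sigma> powr (m - 1) - 1)) \<le> (w powr q - 1) - m * (w\<^sup>2 - 1)"
      by (simp only:) (simp add: algebra_simps)
    moreover have "c \<le> m * ((\<sigma> - 1) * (\<sigma> powr (m - 1) - 1))"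
    proof -
      have "\<bar>w - 1\<bar> * 1 \<le> \<bar>w - 1\<bar> * (w + 1)" using w by (intro mult_left_mono) auto
      also have "\<dots> = \<bar>(w - 1) * (w + 1)\<bar>" using w by (simp add: abs_mult)
      also have "(w - 1) * (w + 1) = w\<^sup>2 - 1" by (simp add: power2_eq_square algebra_simps)
      finally have "e \<le> \<bar>w\<^sup>2 - 1\<bar>" using w by simp
      then consider "\<sigma> \<ge> 1 + e / 2" | "\<sigma> \<le> 1 - e / 2"
        unfolding \<sigma>_def by (auto simp: abs_if split: if_splits)
      then have "e / 2 * min ((1 + e / 2) powr (m - 1) - 1) (1 - (1 - e / 2) powr (m - 1))
          \<le> (\<sigma> - 1) * (\<sigma> powr (m - 1) - 1)"
      proof cases
        case 1
        have "(1 + e / 2) powr (m - 1) \<le> \<sigma> powr (m - 1)" using 1 e m by (intro powr_mono2) auto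
        then show ?thesis
          using 1 e \<open>(1 + e / 2) powr (m - 1) > 1\<close> \<open>(1 - e / 2) powr (m - 1) < 1\<close> by (intro mult_mono) auto
      next
        case 2
        have "\<sigma> powr (m - 1) \<le> (1 - e / 2) powr (m - 1)" using 2 e m s0 by (intro powr_mono2) auto
        then have "e / 2 * min ((1 + e / 2) powr (m - 1) - 1) (1 - (1 - e / 2) powr (m - 1))
            \<le> (1 - \<sigma>) * (1 - \<sigma> powr (m - 1))"
          using 2 e \<open>(1 + e / 2) powr (m - 1) > 1\<close> \<open>(1 - e / 2) powr (m - 1) < 1\<close> by (intro mult_mono) auto
        then show ?thesis by (simp add: algebra_simps)
      qed
      then show ?thesis unfolding c_def using m by (intro mult_left_mono) auto
    qed
    ultimately show ?thesis by linarith
  qed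
  show ?thesis
  proof (intro exI[of _ c] conjI allI impI c)
    fix s t :: real assume s: "0 < s" and t: "0 \<le> t" and d: "e * s \<le> \<bar>t - s\<bar>"
    have "e \<le> \<bar>t / s - 1\<bar>"
    proof -
      have "t / s - 1 = (t - s) / s" using s by (simp add: diff_divide_distrib)
      then have "\<bar>t / s - 1\<bar> = \<bar>t - s\<bar> / s" using s by (simp add: abs_divide)
      then show ?thesis using d s by (simp add: le_divide_eq)
    qed
    then have "c \<le> ((t / s) powr q - 1) - m * ((t / s)\<^sup>2 - 1)" using s t by (intro unit) auto
    then have "c * s powr q \<le> (((t / s) powr q - 1) - m * ((t / s)\<^sup>2 - 1)) * s powr q"
      by (rule mult_right_mono) simp
    also have "\<dots> = (t / s) powr q * s powr q - s powr q - m * (((t / s)\<^sup>2 - 1) * s powr q)"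
      by (simp add: algebra_simps)
    also have "(t / s) powr q * s powr q = t powr q"
      using s t powr_mult[of "t / s" s q] by simp
    also have "((t / s)\<^sup>2 - 1) * s powr q = s powr (q - 2) * (t\<^sup>2 - s\<^sup>2)"
      using s powr_add[of s "q - 2" 2] by (simp add: field_simps)
    finally show "c * s powr q \<le> (t powr q - s powr q) - q / 2 * s powr (q - 2) * (t\<^sup>2 - s\<^sup>2)"
      by (simp add: m_def mult.assoc)
  qed
qed

section \<open>Power nonlinearities on the complex plane\<close>

definition pow_nl :: "real \<Rightarrow> complex \<Rightarrow> complex" where
  "pow_nl r z = complex_of_real (cmod z powr r) * z"

text \<open>\<open>pow_nl r\<close> is the real gradient of the convex function
  \<open>|z|^(r + 2) / (r + 2)\<close>. Replacing the real part of \<open>x * cnj y\<close> by the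
  product of moduli reduces the tangent inequality to real numbers.\<close>

lemma pow_nl_tangent:
  assumes r: "0 < r"
  shows "Re (pow_nl r x * cnj (y - x)) \<le> (cmod y powr (r + 2) - cmod x powr (r + 2)) / (r + 2)"
proof -
  have "Re (x * cnj (y - x)) = Re (x * cnj y) - cmod x * cmod x"
    by (simp add: cmod_power2 right_diff_distrib flip: power2_eq_square)
  also have "Re (x * cnj y) \<le> cmod x * cmod y"
    using complex_Re_le_cmod[of "x * cnj y"] by (simp add: norm_mult)
  finally have "Re (x * cnj (y - x)) \<le> cmod x * (cmod y - cmod x)"
    by (simp add: algebra_simps)
  then have "cmod x powr r * Re (x * cnj (y - x)) \<le> cmod x powr r * (cmod x * (cmod y - cmod x))"
    by (rule mult_left_mono) simp
  also have "\<dots> = cmod x powr (r + 1) * (cmod y - cmod x)"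
    using powr_mult_base[of "cmod x" r] by (simp add: add.commute mult_ac)
  also have "\<dots> \<le> (cmod y powr (r + 2) - cmod x powr (r + 2)) / (r + 2)"
    using powr_tangent[of "r + 2" "cmod x" "cmod y"] r by (simp add: field_simps)
  finally show ?thesis by (simp add: pow_nl_def mult.assoc)
qed

text \<open>For \<open>r < 1\<close> the factor \<open>|z|^r\<close> is not Lipschitz near 0. The
  difference is therefore split so that the increment of this factor is multiplied by the smaller of
  the two moduli, and Young's inequality bounds the product.\<close>

lemma pow_nl_lipschitz:
  assumes r: "0 < r" and "cmod x \<le> K" "cmod y \<le> K"
  shows "cmod (pow_nl r x - pow_nl r y) \<le> (r + 1) * K powr r * cmod (x - y)"
proof -
  have *: "cmod (pow_nl r x - pow_nl r y) \<le> (r + 1) * K powr r * cmod (x - y)"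
    if le: "cmod x \<le> cmod y" and "cmod y \<le> K" for x y
  proof -
    let ?s = "cmod x" and ?t = "cmod y"
    have base: "?s powr r * ?s = ?s powr (r + 1)"
      using powr_mult_base[of "?s" r] by (simp add: add.commute mult.commute)
    have young: "(r + 1) * (?t powr r * ?s) \<le> r * ?t powr (r + 1) + ?s powr (r + 1)"
      using powr_tangent[of "r + 1" "?t" "?s"] powr_mult_base[of "?t" r] r by (simp add: algebra_simps)
    have tan: "?t powr (r + 1) - ?s powr (r + 1) \<le> (r + 1) * (?t powr r * (?t - ?s))"
      using powr_tangent[of "r + 1" "?t" "?s"] r by (simp add: algebra_simps)
    have "(r + 1) * (?s * (?t powr r - ?s powr r)) \<le> r * (?t powr (r + 1) - ?s powr (r + 1))"
      using young base by (simp add: algebra_simps)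
    also have "\<dots> \<le> r * ((r + 1) * (?t powr r * (?t - ?s)))"
      using tan r by (intro mult_left_mono) auto
    finally have "(r + 1) * (?s * (?t powr r - ?s powr r)) \<le> (r + 1) * (r * ?t powr r * (?t - ?s))"
      by (simp add: mult_ac)
    then have 1: "?s * (?t powr r - ?s powr r) \<le> r * ?t powr r * (?t - ?s)"
      using r by simp
    have "?t - ?s \<le> cmod (x - y)" by (metis norm_minus_commute norm_triangle_ineq2)
    then have 2: "r * ?t powr r * (?t - ?s) \<le> r * ?t powr r * cmod (x - y)"
      using r by (intro mult_left_mono) auto
    have mono: "?s powr r \<le> ?t powr r" using le r by (intro powr_mono2) auto
    have "pow_nl r x - pow_nl r y = of_real (?t powr r) * (x - y) - of_real (?t powr r - ?s powr r) * x"
      by (simp add: pow_nl_def algebra_simps)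
    also have "cmod \<dots> \<le> ?t powr r * cmod (x - y) + ?s * (?t powr r - ?s powr r)"
      using mono norm_triangle_ineq4[of "of_real (?t powr r) * (x - y)" "of_real (?t powr r - ?s powr r) * x"]
      by (simp add: norm_mult mult.commute del: of_real_diff)
    also have "\<dots> \<le> (r + 1) * ?t powr r * cmod (x - y)"
      using 1 2 by (simp add: algebra_simps)
    also have "\<dots> \<le> (r + 1) * K powr r * cmod (x - y)"
      using r that by (intro mult_right_mono mult_left_mono powr_mono2) auto
    finally show ?thesis .
  qed
  show ?thesis
  proof (cases "cmod x \<le> cmod y")
    case False
    then show ?thesis using *[of y x] assms by (simp add: norm_minus_commute)
  qed (use * assms in simp)
qed

locale double_power =
  fixes p lam1 lam2 :: real
  assumes p: "1 < p" and lam1: "lam1 < 0" and lam2: "lam2 < 0"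
begin

abbreviation N :: "complex \<Rightarrow> complex" where
  "N \<equiv> nonlinearity p lam1 lam2"

definition weight :: "real \<Rightarrow> real" where
  "weight s = - lam1 * s powr (p - 1) - lam2 * s powr (2 * p - 2)"

text \<open>As a function on the plane its real gradient is \<open>- N\<close>; as a function of
  \<open>s^2\<close> its derivative is \<open>weight s / 2\<close>. The first fact is used for the
  dynamics, the second for minimality.\<close>

definition potential :: "real \<Rightarrow> real" where
  "potential s = - lam1 / (p + 1) * s powr (p + 1) - lam2 / (2 * p) * s powr (2 * p)"

text \<open>A Lipschitz constant of \<open>N\<close> on the disc of radius \<open>K\<close>; the
  factors \<open>p\<close> and \<open>2 * p - 1\<close> are \<open>r + 1\<close> for the two
  powers.\<close>

definition lip :: "real \<Rightarrow> real" where
  "lip K = - lam1 * (p * K powr (p - 1)) - lam2 * ((2 * p - 1) * K powr (2 * p - 2))"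

lemma lin_mono: "a \<le> b \<Longrightarrow> c \<le> d \<Longrightarrow> - lam1 * a - lam2 * c \<le> - lam1 * b - lam2 * d"
  using mult_left_mono_neg[of a b lam1] mult_left_mono_neg[of c d lam2] lam1 lam2 by linarith

lemma N_pow_nl: "N z = complex_of_real lam1 * pow_nl (p - 1) z + complex_of_real lam2 * pow_nl (2 * p - 2) z"
  by (simp add: nonlinearity_def pow_nl_def mult_ac)

lemma N_weight: "N z = - complex_of_real (weight (cmod z)) * z"
  by (simp add: nonlinearity_def weight_def algebra_simps)

lemma N_0 [simp]: "N 0 = 0"
  by (simp add: N_weight)

lemma potential_0 [simp]: "potential 0 = 0"
  by (simp add: potential_def)

lemma weight_nonneg: "weight s \<ge> 0"
proof -
  have "lam1 * s powr (p - 1) \<le> 0" "lam2 * s powr (2 * p - 2) \<le> 0"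
    using lam1 lam2 by (simp_all add: mult_nonpos_nonneg)
  then show ?thesis by (simp add: weight_def)
qed

lemma potential_nonneg: "potential s \<ge> 0"
proof -
  have "lam1 / (p + 1) * s powr (p + 1) \<le> 0" "lam2 / (2 * p) * s powr (2 * p) \<le> 0"
    using lam1 lam2 p by (intro mult_nonpos_nonneg; simp add: divide_nonpos_pos)+
  then show ?thesis by (simp add: potential_def)
qed

lemma lip_nonneg: "lip K \<ge> 0"
proof -
  have "lam1 * (p * K powr (p - 1)) \<le> 0" "lam2 * ((2 * p - 1) * K powr (2 * p - 2)) \<le> 0"
    using lam1 lam2 p by (intro mult_nonpos_nonneg; simp)+
  then show ?thesis by (simp add: lip_def)
qed

lemma N_measurable [measurable]: "N \<in> borel_measurable borel"
  unfolding nonlinearity_def[abs_def] by measurable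

lemma weight_measurable [measurable]: "weight \<in> borel_measurable borel"
  unfolding weight_def[abs_def] by measurable

lemma potential_measurable [measurable]: "potential \<in> borel_measurable borel"
  unfolding potential_def[abs_def] by measurable

lemma potential_tangent: "- Re (N x * cnj (y - x)) \<le> potential (cmod y) - potential (cmod x)"
proof -
  have "- Re (N x * cnj (y - x)) = - lam1 * Re (pow_nl (p - 1) x * cnj (y - x)) - lam2 * Re (pow_nl (2 * p - 2) x * cnj (y - x))"
    by (simp add: N_pow_nl algebra_simps)
  also have "\<dots> \<le> - lam1 * ((cmod y powr (p + 1) - cmod x powr (p + 1)) / (p + 1))
      - lam2 * ((cmod y powr (2 * p) - cmod x powr (2 * p)) / (2 * p))"
    using pow_nl_tangent[of "p - 1" x y] pow_nl_tangent[of "2 * p - 2" x y] p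
    by (intro lin_mono) (simp_all add: add.commute)
  also have "\<dots> = potential (cmod y) - potential (cmod x)"
    by (simp add: potential_def diff_divide_distrib algebra_simps)
  finally show ?thesis .
qed

lemma N_lipschitz:
  assumes "cmod x \<le> K" "cmod y \<le> K"
  shows "cmod (N x - N y) \<le> lip K * cmod (x - y)"
proof -
  have "N x - N y = of_real lam1 * (pow_nl (p - 1) x - pow_nl (p - 1) y)
      + of_real lam2 * (pow_nl (2 * p - 2) x - pow_nl (2 * p - 2) y)"
    by (simp add: N_pow_nl algebra_simps)
  also have "cmod \<dots> \<le> - lam1 * cmod (pow_nl (p - 1) x - pow_nl (p - 1) y)
      - lam2 * cmod (pow_nl (2 * p - 2) x - pow_nl (2 * p - 2) y)"
    by (rule order_trans[OF norm_triangle_ineq]) (use lam1 lam2 in \<open>simp add: norm_mult\<close>)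
  also have "\<dots> \<le> - lam1 * (p * K powr (p - 1) * cmod (x - y)) - lam2 * ((2 * p - 1) * K powr (2 * p - 2) * cmod (x - y))"
    using pow_nl_lipschitz[of "p - 1" x K y] pow_nl_lipschitz[of "2 * p - 2" x K y] p assms
    by (intro lin_mono) simp_all
  finally show ?thesis by (simp add: lip_def algebra_simps)
qed

lemma N_bound: "cmod x \<le> K \<Longrightarrow> cmod (N x) \<le> lip K * cmod x"
  using N_lipschitz[of x K 0] norm_ge_zero[of x] by (auto intro: order_trans)

lemma potential_bound:
  assumes "cmod x \<le> K"
  shows "potential (cmod x) \<le> lip K * (cmod x)\<^sup>2"
proof -
  have "potential (cmod x) \<le> - Re (N x * cnj x)"
    using potential_tangent[of x 0] by simp
  also have "\<dots> \<le> cmod (N x) * cmod x"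
    using abs_Re_le_cmod[of "N x * cnj x"] by (simp add: norm_mult)
  also have "\<dots> \<le> lip K * cmod x * cmod x"
    using N_bound[OF assms] by (intro mult_right_mono) auto
  finally show ?thesis by (simp add: power2_eq_square mult.assoc)
qed

text \<open>Convexity encloses the increment of the potential between its linearizations at the two
  ends. Their gap is the pairing of \<open>N y - N x\<close> with \<open>y - x\<close>, so Lipschitz
  continuity of \<open>N\<close> makes the error quadratic and no second derivative of the potential
  enters.\<close>

lemma potential_trapezoid:
  assumes "cmod x \<le> K" "cmod y \<le> K"
  shows "\<bar>2 * (potential (cmod y) - potential (cmod x)) + Re ((N x + N y) * cnj (y - x))\<bar> \<le> lip K * (cmod (y - x))\<^sup>2"
proof -
  have "\<bar>Re ((N y - N x) * cnj (y - x))\<bar> \<le> cmod (N y - N x) * cmod (y - x)"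
    using abs_Re_le_cmod[of "(N y - N x) * cnj (y - x)"] unfolding norm_mult complex_mod_cnj .
  also have "\<dots> \<le> lip K * cmod (y - x) * cmod (y - x)"
    using N_lipschitz assms by (intro mult_right_mono) auto
  finally have "\<bar>Re ((N y - N x) * cnj (y - x))\<bar> \<le> lip K * (cmod (y - x))\<^sup>2"
    by (simp add: power2_eq_square mult.assoc)
  moreover define a b where "a = Re (N x * cnj (y - x))" and "b = Re (N y * cnj (y - x))"
  then have "Re ((N y - N x) * cnj (y - x)) = b - a" "Re ((N x + N y) * cnj (y - x)) = a + b"
    "- Re (N y * cnj (x - y)) = b"
    by (simp_all add: algebra_simps)
  moreover have "- a \<le> potential (cmod y) - potential (cmod x)"
    unfolding a_def by (rule potential_tangent)
  moreover have "- Re (N y * cnj (x - y)) \<le> potential (cmod x) - potential (cmod y)"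
    by (rule potential_tangent)
  moreover have "\<bar>2 * d + (a + b)\<bar> \<le> L" if "\<bar>b - a\<bar> \<le> L" "- a \<le> d" "b \<le> - d" for d L
    using that by linarith
  ultimately show ?thesis by simp
qed

section \<open>The nonlinear functionals on the Sobolev space\<close>

definition G :: "h1 \<Rightarrow> real" where
  "G u = (\<integral>x. potential (cmod (h1_fun u x)) \<partial>lborel)"

definition nl :: "h1 \<Rightarrow> h1 \<Rightarrow> real" where
  "nl u v = Re (\<integral>x. N (h1_fun u x) * cnj (h1_fun v x) \<partial>lborel)"

lemma N_L2: "(\<lambda>x. N (h1_fun u x)) \<in> L2"
  by (rule L2_dominated[OF h1_fun_L2[of u], of _ "lip (2 * norm u)"])
    (auto intro!: N_bound h1_sup_le measurable_compose[OF h1_fun_measurable N_measurable])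

lemma potential_integrable: "integrable lborel (\<lambda>x. potential (cmod (h1_fun u x)))"
proof (rule Bochner_Integration.integrable_bound)
  show "integrable lborel (\<lambda>x. lip (2 * norm u) * (cmod (h1_fun u x))\<^sup>2)"
    using L2_sq_integrable[OF h1_fun_L2[of u]] by simp
  show "AE x in lborel. norm (potential (cmod (h1_fun u x))) \<le> norm (lip (2 * norm u) * (cmod (h1_fun u x))\<^sup>2)"
    using potential_bound[OF h1_sup_le[of u "norm u"]] potential_nonneg lip_nonneg by auto
qed measurable

lemma nl_integrable: "integrable lborel (\<lambda>x. N (h1_fun u x) * cnj (h1_fun v x))"
  by (intro L2_cnj_integrable N_L2 h1_fun_L2)

lemma nl_bound: 
  assumes "norm u \<le> B"
  shows "\<bar>nl u v\<bar> \<le> lip (2 * B) * (norm u * norm v)"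
proof -
  have "\<bar>nl u v\<bar> \<le> cmod (\<integral>x. N (h1_fun u x) * cnj (h1_fun v x) \<partial>lborel)"
    unfolding nl_def by (rule abs_Re_le_cmod)
  also have "\<dots> \<le> (\<integral>x. lip (2 * B) * (cmod (h1_fun u x) * cmod (h1_fun v x)) \<partial>lborel)"
  proof (rule Bochner_Integration.integral_norm_bound_integral[OF nl_integrable])
    show "integrable lborel (\<lambda>x. lip (2 * B) * (cmod (h1_fun u x) * cmod (h1_fun v x)))"
      using L2_norm_mult_integrable[OF h1_fun_L2 h1_fun_L2] by simp
    show "cmod (N (h1_fun u x) * cnj (h1_fun v x)) \<le> lip (2 * B) * (cmod (h1_fun u x) * cmod (h1_fun v x))" for x
      using mult_right_mono[OF N_bound[OF h1_sup_le[OF assms, of x]] norm_ge_zero[of "h1_fun v x"]]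
      by (simp add: norm_mult mult.assoc)
  qed
  also have "\<dots> = lip (2 * B) * (\<integral>x. cmod (h1_fun u x) * cmod (h1_fun v x) \<partial>lborel)"
    by simp
  also have "\<dots> \<le> lip (2 * B) * (sqrt (mass u) * sqrt (mass v))"
    unfolding mass_def by (intro mult_left_mono L2_Cauchy_Schwarz h1_fun_L2 lip_nonneg)
  also have "\<dots> \<le> lip (2 * B) * (norm u * norm v)"
    using mass_le_norm[of u] mass_le_norm[of v] mass_nonneg
    by (intro mult_left_mono mult_mono lip_nonneg) (auto intro: real_le_lsqrt)
  finally show ?thesis .
qed

text \<open>It matters that the error is measured by the mass and not by the full norm: along a
  solution the mass of an increment gains a factor from differentiability in the dual space, the
  norm does not.\<close>

lemma G_trapezoid:
  assumes "norm u \<le> B" "norm v \<le> B"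
  shows "\<bar>2 * (G v - G u) + (nl u (v - u) + nl v (v - u))\<bar> \<le> lip (2 * B) * mass (v - u)"
proof -
  let ?F = "\<lambda>x. 2 * (potential (cmod (h1_fun v x)) - potential (cmod (h1_fun u x)))
      + Re ((N (h1_fun u x) + N (h1_fun v x)) * cnj (h1_fun v x - h1_fun u x))"
  have s: "(N (h1_fun u x) + N (h1_fun v x)) * cnj (h1_fun v x - h1_fun u x)
     = N (h1_fun u x) * cnj (h1_fun (v - u) x) + N (h1_fun v x) * cnj (h1_fun (v - u) x)" for x
    by (simp add: h1_fun_simps algebra_simps)
  have i: "integrable lborel (\<lambda>x. (N (h1_fun u x) + N (h1_fun v x)) * cnj (h1_fun v x - h1_fun u x))"
    unfolding s by (intro Bochner_Integration.integrable_add nl_integrable)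
  have Fi: "integrable lborel ?F"
    by (intro Bochner_Integration.integrable_add integrable_mult_right Bochner_Integration.integrable_diff
        potential_integrable integrable_Re i)
  have "(\<integral>x. Re ((N (h1_fun u x) + N (h1_fun v x)) * cnj (h1_fun v x - h1_fun u x)) \<partial>lborel)
      = nl u (v - u) + nl v (v - u)"
    unfolding nl_def plus_complex.sel(1)[symmetric]
      Bochner_Integration.integral_add[OF nl_integrable nl_integrable, symmetric] s[symmetric]
    by (rule integral_Re[OF i])
  moreover have P: "integrable lborel (\<lambda>x. 2 * (potential (cmod (h1_fun v x)) - potential (cmod (h1_fun u x))))"
    "(\<integral>x. 2 * (potential (cmod (h1_fun v x)) - potential (cmod (h1_fun u x))) \<partial>lborel) = 2 * (G v - G u)"
    by (simp_all add: G_def potential_integrable)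
  ultimately have "2 * (G v - G u) + (nl u (v - u) + nl v (v - u)) = (\<integral>x. ?F x \<partial>lborel)"
    using Bochner_Integration.integral_add[OF P(1) integrable_Re[OF i]] by presburger
  moreover have "norm (\<integral>x. ?F x \<partial>lborel) \<le> (\<integral>x. lip (2 * B) * (cmod (h1_fun (v - u) x))\<^sup>2 \<partial>lborel)"
  proof (rule Bochner_Integration.integral_norm_bound_integral[OF Fi])
    show "integrable lborel (\<lambda>x. lip (2 * B) * (cmod (h1_fun (v - u) x))\<^sup>2)"
      by (intro integrable_mult_right L2_sq_integrable h1_fun_L2)
    fix x
    show "norm (?F x) \<le> lip (2 * B) * (cmod (h1_fun (v - u) x))\<^sup>2"
      unfolding h1_fun_simps real_norm_def
      by (rule potential_trapezoid[OF h1_sup_le[OF assms(1)] h1_sup_le[OF assms(2)]])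
  qed
  ultimately show ?thesis
    unfolding mass_def real_norm_def integral_mult_right_zero by presburger
qed

lemma G_lipschitz:
  assumes "norm u \<le> B" "norm v \<le> B"
  shows "\<bar>G v - G u\<bar> \<le> 2 * lip (2 * B) * B * norm (v - u)"
proof -
  have B: "B \<ge> 0" using assms(1) norm_ge_zero[of u] by linarith
  have n: "\<bar>nl w (v - u)\<bar> \<le> lip (2 * B) * (B * norm (v - u))" if "norm w \<le> B" for w
    by (rule order_trans[OF nl_bound[OF that]]) (use that lip_nonneg in \<open>intro mult_left_mono mult_right_mono; simp\<close>)
  have "norm (v - u) \<le> 2 * B" using norm_triangle_ineq4[of v u] assms by simp
  then have "mass (v - u) \<le> 2 * B * norm (v - u)"
    using mass_le_norm[of "v - u"] mult_right_mono[of "norm (v - u)" "2 * B" "norm (v - u)"]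
    by (simp add: power2_eq_square)
  then have "lip (2 * B) * mass (v - u) \<le> lip (2 * B) * (2 * B * norm (v - u))"
    by (intro mult_left_mono lip_nonneg)
  then have "2 * \<bar>G v - G u\<bar> \<le> 4 * (lip (2 * B) * (B * norm (v - u)))"
    using G_trapezoid[OF assms] n[OF assms(1)] n[OF assms(2)] unfolding abs_le_iff by linarith
  then show ?thesis by (simp add: mult_ac)
qed

end

subsection \<open>Conservation laws\<close>

lemma has_vector_derivative_quotient:
  fixes f :: "real \<Rightarrow> 'a::real_normed_vector"
  assumes "(f has_vector_derivative D) (at t)"
  shows "((\<lambda>s. (f s - f t) /\<^sub>R (s - t)) \<longlongrightarrow> D) (at t)"
proof -
  have "((\<lambda>s. norm ((f s - f t) - (s - t) *\<^sub>R D) / norm (s - t)) \<longlongrightarrow> 0) (at t)"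
    using assms unfolding has_vector_derivative_def has_derivative_iff_norm by simp
  moreover have "\<forall>\<^sub>F s in at t. norm ((f s - f t) - (s - t) *\<^sub>R D) / norm (s - t) = norm ((f s - f t) /\<^sub>R (s - t) - D)"
  proof (rule eventually_mono)
    show "\<forall>\<^sub>F s in at t. s \<noteq> t" by (simp add: eventually_at_filter)
    fix s assume "s \<noteq> t"
    then have "(f s - f t) /\<^sub>R (s - t) - D = ((f s - f t) - (s - t) *\<^sub>R D) /\<^sub>R (s - t)"
      by (simp add: scaleR_diff_right)
    then show "norm ((f s - f t) - (s - t) *\<^sub>R D) / norm (s - t) = norm ((f s - f t) /\<^sub>R (s - t) - D)"
      by (simp add: divide_inverse mult.commute)
  qed
  ultimately have "((\<lambda>s. norm ((f s - f t) /\<^sub>R (s - t) - D)) \<longlongrightarrow> 0) (at t)"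
    by (rule Lim_transform_eventually)
  then show ?thesis
    by (simp add: tendsto_norm_zero_iff LIM_zero_iff)
qed

lemma cscale_add: "cscale c (u + v) = cscale c u + cscale c v"
  and cscale_diff: "cscale c (u - v) = cscale c u - cscale c v"
  and cscale_cscale: "cscale c (cscale d u) = cscale (c * d) u"
  and cscale_1: "cscale 1 u = u"
  and cscale_minus: "cscale (- c) u = - cscale c u"
  and cscale_scaleR: "cscale c (r *\<^sub>R u) = r *\<^sub>R cscale c u"
  by (rule h1_eqI, simp add: h1_fun_simps algebra_simps scaleR_conv_of_real)+

lemma mass_cscale: "mass (cscale c u) = (cmod c)\<^sup>2 * mass u"
  by (simp add: mass_def h1_fun_simps norm_mult power_mult_distrib)

lemma norm_cscale: "norm (cscale c u) = cmod c * norm u"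
proof -
  have [measurable]: "h1_deriv v \<in> borel_measurable borel" for v
    by (rule L2_measurable[OF h1_deriv(1)])
  have "(\<integral>x. (cmod (h1_deriv (cscale c u) x))\<^sup>2 \<partial>lborel) = (\<integral>x. (cmod c)\<^sup>2 * (cmod (h1_deriv u x))\<^sup>2 \<partial>lborel)"
    by (rule integral_cong_AE)
      (use h1_deriv_cscale_AE[of c u] in \<open>auto simp: norm_mult power_mult_distrib elim: eventually_mono\<close>)
  then have "(norm (cscale c u))\<^sup>2 = (cmod c * norm u)\<^sup>2"
    by (simp add: h1_norm_sq mass_cscale power_mult_distrib distrib_left)
  then show ?thesis by simp
qed

lemma bounded_linear_cscale: "bounded_linear (cscale c)"
  by (rule bounded_linear_intro[where K="cmod c"])
    (simp_all add: cscale_add cscale_scaleR norm_cscale mult.commute)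

lemma embed_self_i: "h1_embed u (cscale \<i> u) = 0"
  using embed_cscale[of \<i> u u] embed_sym[of u "cscale \<i> u"]
  by (simp add: cscale_minus blinfun.minus_right)

text \<open>A product rule for factors that are differentiable only as functionals. In the
  difference quotient the increment of \<open>u\<close> is paired with the moving value
  \<open>v s\<close>, which converges in H1, and the increment of \<open>v\<close> with the fixed
  value \<open>u t\<close>, by symmetry of the pairing.\<close>

lemma embed_pairing_deriv:
  assumes u: "continuous (at t) v"
    and du: "((\<lambda>s. h1_embed (u s)) has_vector_derivative u') (at t)"
    and dv: "((\<lambda>s. h1_embed (v s)) has_vector_derivative v') (at t)"
  shows "((\<lambda>s. h1_embed (u s) (cscale c (v s))) has_real_derivative
           u' (cscale c (v t)) + v' (cscale (cnj c) (u t))) (at t)"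
proof -
  have "((\<lambda>s. cscale c (v s)) \<longlongrightarrow> cscale c (v t)) (at t)"
    using u unfolding continuous_at by (rule bounded_linear.tendsto[OF bounded_linear_cscale])
  then have "((\<lambda>s. blinfun_apply ((h1_embed (u s) - h1_embed (u t)) /\<^sub>R (s - t)) (cscale c (v s))
      + blinfun_apply ((h1_embed (v s) - h1_embed (v t)) /\<^sub>R (s - t)) (cscale (cnj c) (u t)))
      \<longlongrightarrow> u' (cscale c (v t)) + v' (cscale (cnj c) (u t))) (at t)"
    by (intro tendsto_add blinfun.tendsto has_vector_derivative_quotient[OF du]
        has_vector_derivative_quotient[OF dv] tendsto_const)
  moreover have "blinfun_apply ((h1_embed (u s) - h1_embed (u t)) /\<^sub>R (s - t)) (cscale c (v s))
      + blinfun_apply ((h1_embed (v s) - h1_embed (v t)) /\<^sub>R (s - t)) (cscale (cnj c) (u t))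
      = (h1_embed (u s) (cscale c (v s)) - h1_embed (u t) (cscale c (v t))) / (s - t)" for s
  proof -
    have "h1_embed (v x) (cscale (cnj c) (u t)) = h1_embed (u t) (cscale c (v x))" for x
      by (metis embed_sym embed_cscale)
    then show ?thesis
      by (simp add: blinfun.scaleR_left blinfun.diff_left divide_inverse algebra_simps)
  qed
  ultimately show ?thesis
    unfolding has_field_derivative_iff by simp
qed

section \<open>The quadratic form of the operator with point interaction\<close>

lemma delta_form_inner:
  "delta_form Z u v = u \<bullet> v - h1_embed u v - Z * Re (h1_fun u 0 * cnj (h1_fun v 0))"
  by (simp add: delta_form_def inner_h1_def h1_embed.rep_eq)

lemma delta_form_sym: "delta_form Z u v = delta_form Z v u"
  by (simp add: delta_form_inner inner_commute embed_sym mult.commute)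

lemma delta_form_add_left: "delta_form Z (u + v) w = delta_form Z u w + delta_form Z v w"
  by (simp add: delta_form_inner inner_add_left embed_add h1_fun_simps algebra_simps)

lemma delta_form_diff_left: "delta_form Z (u - v) w = delta_form Z u w - delta_form Z v w"
  by (simp add: delta_form_inner inner_diff_left embed_diff h1_fun_simps algebra_simps)

lemma delta_form_add_right: "delta_form Z w (u + v) = delta_form Z w u + delta_form Z w v"
  and delta_form_diff_right: "delta_form Z w (u - v) = delta_form Z w u - delta_form Z w v"
  by (metis delta_form_sym delta_form_add_left, metis delta_form_sym delta_form_diff_left)

lemma embed_bound: "\<bar>h1_embed u v\<bar> \<le> norm u * norm v"
proof -
  have "\<bar>h1_embed u v\<bar> \<le> cmod (\<integral>x. h1_fun u x * cnj (h1_fun v x) \<partial>lborel)"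
    unfolding h1_embed.rep_eq by (rule abs_Re_le_cmod)
  also have "\<dots> \<le> (\<integral>x. cmod (h1_fun u x) * cmod (h1_fun v x) \<partial>lborel)"
    by (rule order_trans[OF integral_norm_bound]) (simp add: norm_mult)
  also have "\<dots> \<le> sqrt (mass u) * sqrt (mass v)"
    unfolding mass_def by (intro L2_Cauchy_Schwarz h1_fun_L2)
  also have "\<dots> \<le> norm u * norm v"
    using mass_le_norm[of u] mass_le_norm[of v] mass_nonneg
    by (intro mult_mono) (auto intro: real_le_lsqrt)
  finally show ?thesis .
qed

lemma delta_form_bound: "\<bar>delta_form Z u v\<bar> \<le> (2 + 4 * \<bar>Z\<bar>) * (norm u * norm v)"
proof -
  have "\<bar>Re (h1_fun u 0 * cnj (h1_fun v 0))\<bar> \<le> cmod (h1_fun u 0) * cmod (h1_fun v 0)"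
    using abs_Re_le_cmod[of "h1_fun u 0 * cnj (h1_fun v 0)"] unfolding norm_mult complex_mod_cnj .
  also have "\<dots> \<le> (2 * norm u) * (2 * norm v)"
    by (intro mult_mono h1_sup_le) auto
  finally have "\<bar>Z * Re (h1_fun u 0 * cnj (h1_fun v 0))\<bar> \<le> \<bar>Z\<bar> * (4 * (norm u * norm v))"
    unfolding abs_mult by (intro mult_left_mono) auto
  then show ?thesis
    using Cauchy_Schwarz_ineq2[of u v] embed_bound[of u v]
    unfolding delta_form_inner by (simp add: algebra_simps del: times_complex.sel)
qed

lemma mass_parallelogram: "mass (u - v) + mass (u + v) = 2 * mass u + 2 * mass v"
  by (simp add: mass_embed[symmetric] embed_diff embed_add blinfun.diff_right blinfun.add_right)

lemma mass_diff_le: "mass u - mass v \<le> norm (u + v) * norm (u - v)"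
proof -
  have "mass u - mass v = h1_embed (u + v) (u - v)"
    by (simp add: mass_embed[symmetric] embed_add blinfun.diff_right embed_sym[of v u])
  then show ?thesis using embed_bound[of "u + v" "u - v"] by simp
qed

context double_power
begin

definition energy2 :: "real \<Rightarrow> h1 \<Rightarrow> real" where
  "energy2 Z u = delta_form Z u u + 2 * G u"

lemma energy2_lipschitz:
  assumes "norm u \<le> B" "norm v \<le> B"
  shows "\<bar>energy2 Z v - energy2 Z u\<bar> \<le> ((2 + 4 * \<bar>Z\<bar>) * (2 * B) + 4 * lip (2 * B) * B) * norm (v - u)"
proof -
  have "delta_form Z v v - delta_form Z u u = delta_form Z (v + u) (v - u)"
    by (simp add: delta_form_add_left delta_form_diff_right delta_form_sym[of Z u v])
  then have "\<bar>delta_form Z v v - delta_form Z u u\<bar> \<le> (2 + 4 * \<bar>Z\<bar>) * (norm (v + u) * norm (v - u))"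
    using delta_form_bound by metis
  also have "\<dots> \<le> (2 + 4 * \<bar>Z\<bar>) * ((2 * B) * norm (v - u))"
    using assms norm_triangle_ineq[of v u] by (intro mult_left_mono mult_right_mono) auto
  finally show ?thesis
    using G_lipschitz[OF assms] unfolding energy2_def by (simp add: algebra_simps)
qed

lemma energy2_continuous: "continuous_on UNIV (energy2 Z)"
proof (rule continuous_at_imp_continuous_on, rule ballI)
  fix u :: h1
  define C where "C = (2 + 4 * \<bar>Z\<bar>) * (2 * (norm u + 1)) + 4 * lip (2 * (norm u + 1)) * (norm u + 1)"
  have ev: "\<forall>\<^sub>F v in at u. norm (v - u) < 1"
    unfolding eventually_at by (intro exI[of _ 1]) (simp add: dist_norm)
  then have "\<forall>\<^sub>F v in at u. norm (energy2 Z v - energy2 Z u) \<le> C * norm (v - u)"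
  proof (rule eventually_mono)
    fix v assume "norm (v - u) < 1"
    then have "norm v \<le> norm u + 1" using norm_triangle_ineq2[of v u] by simp
    then show "norm (energy2 Z v - energy2 Z u) \<le> C * norm (v - u)"
      unfolding C_def real_norm_def by (intro energy2_lipschitz) auto
  qed
  moreover have "((\<lambda>v. C * norm (v - u)) \<longlongrightarrow> 0) (at u)"
    by (rule tendsto_mult_right_zero[OF tendsto_norm_zero[OF LIM_zero[OF tendsto_ident_at]]])
  ultimately have "((\<lambda>v. energy2 Z v - energy2 Z u) \<longlongrightarrow> 0) (at u)"
    by (rule Lim_null_comparison)
  then show "isCont (energy2 Z) u"
    unfolding isCont_def by (rule LIM_zero_cancel)
qed

lemma nls_solutionE:
  assumes "nls_solution p lam1 lam2 Z u"
  obtains u_t where "continuous_on UNIV u" "continuous_on UNIV u_t"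
    "\<And>t. ((\<lambda>s. h1_embed (u s)) has_vector_derivative u_t t) (at t)"
    "\<And>t v. blinfun_apply (u_t t) (cscale (- \<i>) v) = delta_form Z (u t) v - nl (u t) v"
proof -
  from assms obtain u_t where "continuous_on UNIV u" "continuous_on UNIV u_t"
    "\<And>t. ((\<lambda>s. h1_embed (u s)) has_vector_derivative u_t t) (at t)"
    and *: "\<And>t v. blinfun_apply (u_t t) (cscale (- \<i>) v) - delta_form Z (u t) v
           + Re (\<integral>x. nonlinearity p lam1 lam2 (h1_fun (u t) x) * cnj (h1_fun v x) \<partial>lborel) = 0"
    unfolding nls_solution_def by blast
  then show thesis
    using that[of u_t] unfolding nl_def by (simp only: algebra_simps)
qed

text \<open>The derivative of the mass is twice the pairing of \<open>u_t\<close> with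
  \<open>u\<close>. The equation tested with \<open>i u\<close> shows that this pairing vanishes,
  since the form is zero on the pair \<open>u\<close>, \<open>i u\<close> and
  \<open>N z * cnj z\<close> is real.\<close>

lemma mass_conserved:
  assumes "nls_solution p lam1 lam2 Z u"
  shows "mass (u t) = mass (u 0)"
proof -
  obtain u_t where c: "continuous_on UNIV u"
    and d: "\<And>t. ((\<lambda>s. h1_embed (u s)) has_vector_derivative u_t t) (at t)"
    and e: "\<And>t v. blinfun_apply (u_t t) (cscale (- \<i>) v) = delta_form Z (u t) v - nl (u t) v"
    using assms by (rule nls_solutionE) blast
  have zero: "blinfun_apply (u_t t) (u t) = 0" for t
  proof -
    have "blinfun_apply (u_t t) (cscale (- \<i>) (cscale \<i> (u t))) = 0"
    proof -
      have "w * cnj (\<i> * z) = - \<i> * (w * cnj z)" for w z :: complex by simp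
      then have "nl (u t) (cscale \<i> (u t)) = Im (\<integral>x. N (h1_fun (u t) x) * cnj (h1_fun (u t) x) \<partial>lborel)"
        unfolding nl_def h1_fun_simps by (simp only: integral_mult_right_zero) simp
      also have "(\<integral>x. N (h1_fun (u t) x) * cnj (h1_fun (u t) x) \<partial>lborel)
         = (\<integral>x. complex_of_real (- weight (cmod (h1_fun (u t) x)) * (cmod (h1_fun (u t) x))\<^sup>2) \<partial>lborel)"
        by (simp add: N_weight mult.assoc flip: complex_norm_square)
      also have "Im \<dots> = 0" by (simp only: integral_complex_of_real Im_complex_of_real)
      finally have n: "nl (u t) (cscale \<i> (u t)) = 0" .
      have "u t \<bullet> cscale \<i> (u t) = 0"
      proof -
        \<comment> \<open>Since \<open>|1 + i|^2 = 1 + |i|^2\<close>, comparison with the expanded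
          square shows that \<open>u t\<close> and \<open>i u t\<close> are orthogonal, without
          looking at derivatives.\<close>
        have "(norm (u t + cscale \<i> (u t)))\<^sup>2 = 2 * (norm (u t))\<^sup>2"
        proof -
          have "u t + cscale \<i> (u t) = cscale (1 + \<i>) (u t)"
            by (rule h1_eqI) (simp add: h1_fun_simps algebra_simps)
          moreover have "(cmod (1 + \<i>))\<^sup>2 = 2" by (simp add: cmod_power2)
          ultimately show ?thesis by (simp add: norm_cscale power_mult_distrib)
        qed
        moreover have "(norm (u t + cscale \<i> (u t)))\<^sup>2 = (norm (u t))\<^sup>2 + 2 * (u t \<bullet> cscale \<i> (u t)) + (norm (cscale \<i> (u t)))\<^sup>2"
          by (simp add: power2_norm_eq_inner inner_add_left inner_add_right inner_commute)
        ultimately show ?thesis by (simp add: norm_cscale)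
      qed
      then have "delta_form Z (u t) (cscale \<i> (u t)) = 0"
        using embed_self_i by (simp add: delta_form_inner h1_fun_simps algebra_simps)
      then show ?thesis using e n by simp
    qed
    then show ?thesis by (simp add: cscale_cscale cscale_1)
  qed
  have "((\<lambda>s. mass (u s)) has_real_derivative 0) (at t)" for t
    using embed_pairing_deriv[OF _ d d, where c=1 and t=t] c zero[of t]
    by (simp add: cscale_1 mass_embed continuous_on_eq_continuous_at)
  then show ?thesis
    using DERIV_isconst_all[of "\<lambda>s. mass (u s)"] by blast
qed

text \<open>
  The energy cannot be differentiated along a solution directly, since \<open>u\<^sub>t\<close> is only a functional on
  \<open>H\<^sup>1\<close>. The increment of the quadratic part over \<open>[t, t + h]\<close> is, by the equation, the pairing of
  \<open>i u\<^sub>t(t + h) + i u\<^sub>t(t)\<close> with \<open>u(t + h) - u(t)\<close>, which is the derivative in \<open>t\<close> of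
  \<open>g\<^sub>h(t) = \<langle>i u(t), u(t + h)\<rangle>\<close> plus the increment of \<open>F = \<langle>i u\<^sub>t, u\<rangle>\<close>. The remainder \<open>R\<close> is the
  trapezoidal error of the potential, and it is \<open>o(h)\<close> because the mass of \<open>u(t + h) - u(t)\<close> is at
  most its norm in \<open>H\<^sup>1\<close>, which is \<open>o(1)\<close>, times its norm in \<open>H\<^sup>-\<^sup>1\<close>, which is \<open>O(h)\<close>.
\<close>

lemma energy_conserved_aux:
  assumes sol: "nls_solution p lam1 lam2 Z u" and le: "t0 < t1"
  shows "energy2 Z (u t0) = energy2 Z (u t1)"
proof -
  obtain u_t where cu: "continuous_on UNIV u" and cut: "continuous_on UNIV u_t"
    and d: "\<And>t. ((\<lambda>s. h1_embed (u s)) has_vector_derivative u_t t) (at t)"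
    and e: "\<And>t v. blinfun_apply (u_t t) (cscale (- \<i>) v) = delta_form Z (u t) v - nl (u t) v"
    by (rule nls_solutionE[OF sol]) (rule that; assumption)
  have cu': "isCont u t" for t using cu by (simp add: continuous_on_eq_continuous_at)
  define E where "E t = energy2 Z (u t)" for t
  define F where "F t = blinfun_apply (u_t t) (cscale (- \<i>) (u t))" for t
  define g where "g h t = blinfun_apply (h1_embed (u (t + h))) (cscale \<i> (u t))" for h t
  define R where "R h t = nl (u t) (u (t + h) - u t) + nl (u (t + h)) (u (t + h) - u t)
      + 2 * (G (u (t + h)) - G (u t))" for h t
  have cE: "continuous_on UNIV E"
    unfolding E_def by (rule continuous_on_compose2[OF energy2_continuous cu]) auto
  have cF: "continuous_on UNIV F"
    unfolding F_def by (intro continuous_intros cut bounded_linear.continuous_on[OF bounded_linear_cscale] cu)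
  have dg: "(g h has_real_derivative
      blinfun_apply (u_t (t + h)) (cscale \<i> (u t)) + blinfun_apply (u_t t) (cscale (- \<i>) (u (t + h)))) (at t)" for h t
  proof -
    have "((\<lambda>s. s + h) has_vector_derivative 1) (at t)"
      by (auto intro!: derivative_eq_intros)
    from vector_diff_chain_at[OF this d[of "t + h"]]
    have "((\<lambda>s. h1_embed (u (s + h))) has_vector_derivative u_t (t + h)) (at t)"
      by (simp add: o_def)
    from embed_pairing_deriv[OF cu' this d, of \<i>] show ?thesis by (simp add: g_def[abs_def])
  qed
  have key: "E (t + h) - E t = F (t + h) - F t
      + (blinfun_apply (u_t (t + h)) (cscale \<i> (u t)) + blinfun_apply (u_t t) (cscale (- \<i>) (u (t + h)))) + R h t" for h t
  proof -
    let ?D = "u (t + h) - u t"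
    have "delta_form Z (u (t + h)) (u (t + h)) - delta_form Z (u t) (u t)
        = delta_form Z (u (t + h)) ?D + delta_form Z (u t) ?D"
      by (simp add: delta_form_diff_right delta_form_sym[of Z "u (t + h)" "u t"])
    also have "\<dots> = blinfun_apply (u_t (t + h)) (cscale (- \<i>) ?D) + blinfun_apply (u_t t) (cscale (- \<i>) ?D)
        + (nl (u t) ?D + nl (u (t + h)) ?D)"
      unfolding e by simp
    finally have "E (t + h) - E t = blinfun_apply (u_t (t + h)) (cscale (- \<i>) ?D) + blinfun_apply (u_t t) (cscale (- \<i>) ?D) + R h t"
      by (simp add: E_def energy2_def R_def)
    then show ?thesis
      by (simp add: F_def cscale_diff blinfun.diff_right cscale_minus blinfun.minus_right)
  qed
  let ?I = "{t0..t1+1}"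
  have comp: "bounded (u ` ?I)" "bounded (u_t ` ?I)" "uniformly_continuous_on ?I u"
    by (auto intro!: compact_imp_bounded compact_continuous_image compact_uniformly_continuous
        continuous_on_subset[OF cu] continuous_on_subset[OF cut])
  from comp(1) obtain B where B: "\<And>t. t \<in> ?I \<Longrightarrow> norm (u t) \<le> B" unfolding bounded_iff by blast
  from comp(2) obtain M where M: "M > 0" "\<And>t. t \<in> ?I \<Longrightarrow> norm (u_t t) \<le> M" unfolding bounded_pos by blast
  \<comment> \<open>The summand 1 keeps the divisor positive.\<close>
  define L where "L = lip (2 * B) * M + 1"
  have L: "L > 0" using M lip_nonneg[of "2 * B"] by (simp add: L_def add_nonneg_pos)
  have R_small: "\<exists>r>0. \<forall>h t. 0 < h \<longrightarrow> h < r \<longrightarrow> t \<in> {t0..t1} \<longrightarrow> \<bar>R h t\<bar> \<le> \<epsilon> * h" if "\<epsilon> > 0" for \<epsilon>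
  proof -
    obtain r where r: "r > 0" "\<And>s t. s \<in> ?I \<Longrightarrow> t \<in> ?I \<Longrightarrow> dist s t < r \<Longrightarrow> dist (u s) (u t) < \<epsilon> / L"
      using comp(3) L \<open>\<epsilon> > 0\<close> unfolding uniformly_continuous_on_def by (metis divide_pos_pos)
    show ?thesis
    proof (intro exI[of _ "min r 1"] conjI allI impI)
      show "0 < min r 1" using r by simp
      fix h t assume h: "0 < h" "h < min r 1" and t: "t \<in> {t0..t1}"
      then have I: "t \<in> ?I" "t + h \<in> ?I" by auto
      let ?D = "u (t + h) - u t"
      have small: "norm ?D \<le> \<epsilon> / L" using r(2)[OF I(2,1)] h by (simp add: dist_norm)
      have "norm (h1_embed (u (t + h)) - h1_embed (u t)) \<le> M * norm ((t + h) - t)"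
      proof (rule differentiable_bound[of ?I _ "\<lambda>x y. y *\<^sub>R u_t x"])
        fix x assume x: "x \<in> ?I"
        show "((\<lambda>s. h1_embed (u s)) has_derivative (\<lambda>y. y *\<^sub>R u_t x)) (at x within ?I)"
          using d[of x] unfolding has_vector_derivative_def by (rule has_derivative_at_withinI)
        show "onorm (\<lambda>y. y *\<^sub>R u_t x) \<le> M"
        proof (rule onorm_le)
          show "norm (y *\<^sub>R u_t x) \<le> M * norm y" for y
            using mult_right_mono[OF M(2)[OF x], of "norm y"] by (simp add: mult.commute)
        qed
      qed (use I in auto)
      then have H: "norm (h1_embed (u (t + h)) - h1_embed (u t)) \<le> M * h" using h by simp
      have "mass ?D = blinfun_apply (h1_embed (u (t + h)) - h1_embed (u t)) ?D"
        by (simp add: mass_embed[symmetric] embed_diff blinfun.diff_left)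
      also have "\<dots> \<le> norm (h1_embed (u (t + h)) - h1_embed (u t)) * norm ?D"
        using norm_blinfun[of "h1_embed (u (t + h)) - h1_embed (u t)" ?D] by simp
      also have "\<dots> \<le> (M * h) * (\<epsilon> / L)"
        using H small M h by (intro mult_mono) auto
      finally have "lip (2 * B) * mass ?D \<le> lip (2 * B) * ((M * h) * (\<epsilon> / L))"
        by (intro mult_left_mono lip_nonneg)
      also have "\<dots> = (L - 1) * (h * \<epsilon> / L)" by (simp add: L_def)
      also have "\<dots> \<le> L * (h * \<epsilon> / L)" using h \<open>\<epsilon> > 0\<close> L by (intro mult_right_mono) auto
      also have "\<dots> = \<epsilon> * h" using L by simp
      finally have "lip (2 * B) * mass ?D \<le> \<epsilon> * h" .
      then show "\<bar>R h t\<bar> \<le> \<epsilon> * h"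
        using G_trapezoid[OF B[OF I(1)] B[OF I(2)]] unfolding R_def by (simp add: algebra_simps)
    qed
  qed
  \<comment> \<open>The interval is enlarged on both sides so that the derivative is two-sided at
    every \<open>t\<close> and \<open>t + h\<close> in use.\<close>
  obtain A where A: "\<And>t. t \<in> {t0-1..t1+2} \<Longrightarrow> (A has_vector_derivative E t - F t) (at t within {t0-1..t1+2})"
    by (rule antiderivative_continuous[OF continuous_on_subset[OF continuous_on_diff[OF cE cF] subset_UNIV]])
      (rule that)
  have dA: "(A has_real_derivative E t - F t) (at t)" if "t \<in> ?I" for t
    using A[of t] that at_within_interior[of t "{t0-1..t1+2}"]
    by (simp add: has_real_derivative_iff_has_vector_derivative)
  \<comment> \<open>Integrating \<open>E - F\<close> over \<open>[t, t + h]\<close> turns the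
    increment identity \<open>key\<close> into a derivative in \<open>t\<close>: what is left is
    \<open>R h t = o(h)\<close>, so \<Psi> divided by \<open>h\<close> becomes constant in
    \<open>t\<close> as \<open>h\<close> tends to 0. At fixed \<open>t\<close> its limit is
    \<open>(E t - F t) + F t = E t\<close>, because \<open>g 0 t = 0\<close> and the derivative of
    \<open>g\<close> in \<open>h\<close> at 0 is \<open>- F t\<close>.\<close>
  define \<Psi> where "\<Psi> h t = A (t + h) - A t - g h t" for h t
  have d\<Psi>: "(\<Psi> h has_real_derivative R h t) (at t)" if "0 < h" "h < 1" "t \<in> {t0..t1}" for h t
  proof -
    have "((\<lambda>t. A (t + h)) has_real_derivative E (t + h) - F (t + h)) (at t)"
      using dA[of "t + h"] that by (simp add: DERIV_shift)
    from DERIV_diff[OF DERIV_diff[OF this dA] dg] that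
    have "(\<Psi> h has_real_derivative E (t + h) - F (t + h) - (E t - F t)
       - (blinfun_apply (u_t (t + h)) (cscale \<i> (u t)) + blinfun_apply (u_t t) (cscale (- \<i>) (u (t + h))))) (at t)"
      by (simp add: \<Psi>_def[abs_def])
    then show ?thesis using key[of t h] by (simp add: algebra_simps)
  qed
  have lim0: "((\<lambda>h. (\<Psi> h t1 - \<Psi> h t0) / h) \<longlongrightarrow> 0) (at_right 0)"
    unfolding tendsto_iff
  proof (intro allI impI)
    fix \<epsilon> :: real assume "\<epsilon> > 0"
    then have "\<epsilon> / (2 * (t1 - t0)) > 0" using le by simp
    from R_small[OF this] obtain r where r: "r > 0"
      "\<And>h t. 0 < h \<Longrightarrow> h < r \<Longrightarrow> t \<in> {t0..t1} \<Longrightarrow> \<bar>R h t\<bar> \<le> \<epsilon> / (2 * (t1 - t0)) * h" by blast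
    show "\<forall>\<^sub>F h in at_right 0. dist ((\<Psi> h t1 - \<Psi> h t0) / h) 0 < \<epsilon>"
      unfolding eventually_at_right_field
    proof (intro exI[of _ "min r 1"] conjI allI impI)
      show "0 < min r 1" using r by simp
      fix h assume h: "0 < h" "h < min r 1"
      have "norm (\<Psi> h t1 - \<Psi> h t0) \<le> \<epsilon> / (2 * (t1 - t0)) * h * norm (t1 - t0)"
      proof (rule field_differentiable_bound[of "{t0..t1}" _ "R h"])
        fix z assume z: "z \<in> {t0..t1}"
        have "(\<Psi> h has_real_derivative R h z) (at z)" using h z by (intro d\<Psi>) auto
        then show "(\<Psi> h has_real_derivative R h z) (at z within {t0..t1})"
          by (rule has_field_derivative_at_within)
        show "norm (R h z) \<le> \<epsilon> / (2 * (t1 - t0)) * h" using r(2)[of h z] h z by simp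
      qed (use le in auto)
      also have "\<dots> = \<epsilon> / 2 * h" using le by (simp add: divide_simps)
      finally have "\<bar>\<Psi> h t1 - \<Psi> h t0\<bar> / h \<le> \<epsilon> / 2" using h by (simp add: divide_le_eq)
      then have "\<bar>\<Psi> h t1 - \<Psi> h t0\<bar> / h < \<epsilon>" using \<open>\<epsilon> > 0\<close> by linarith
      then show "dist ((\<Psi> h t1 - \<Psi> h t0) / h) 0 < \<epsilon>" using h by simp
    qed
  qed
  have lim: "((\<lambda>h. \<Psi> h t / h) \<longlongrightarrow> E t) (at_right 0)" if "t \<in> {t0..t1}" for t
  proof -
    have 1: "((\<lambda>h. (A (t + h) - A t) / h) \<longlongrightarrow> E t - F t) (at 0)"
      using dA[of t] that by (simp add: DERIV_def)
    have "((\<lambda>s. blinfun_apply (h1_embed (u s)) (cscale \<i> (u t))) has_real_derivative blinfun_apply (u_t t) (cscale \<i> (u t))) (at t)"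
      using bounded_linear.has_vector_derivative[OF blinfun.bounded_linear_left d[of t], of "cscale \<i> (u t)"]
      by (simp add: has_real_derivative_iff_has_vector_derivative)
    then have 2: "((\<lambda>h. g h t / h) \<longlongrightarrow> - F t) (at 0)"
      by (simp add: DERIV_def g_def embed_self_i F_def cscale_minus blinfun.minus_right)
    have "((\<lambda>h. (A (t + h) - A t) / h - g h t / h) \<longlongrightarrow> (E t - F t) - (- F t)) (at 0)"
      by (intro tendsto_diff 1 2)
    then have "((\<lambda>h. \<Psi> h t / h) \<longlongrightarrow> E t) (at 0)"
      by (simp add: \<Psi>_def diff_divide_distrib)
    then show ?thesis by (rule tendsto_mono[OF at_le[OF subset_UNIV]])
  qed
  have "((\<lambda>h. \<Psi> h t1 / h - \<Psi> h t0 / h) \<longlongrightarrow> E t1 - E t0) (at_right 0)"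
    using le by (intro tendsto_diff lim) auto
  from tendsto_unique[OF trivial_limit_at_right_real this] lim0 have "E t1 - E t0 = 0"
    unfolding diff_divide_distrib by blast
  then show ?thesis by (simp add: E_def)
qed

lemma energy_conserved:
  assumes "nls_solution p lam1 lam2 Z u"
  shows "energy2 Z (u t) = energy2 Z (u 0)"
proof (cases t "0::real" rule: linorder_cases)
  case less
  from energy_conserved_aux[OF assms this] show ?thesis .
next
  case greater
  from energy_conserved_aux[OF assms this] show ?thesis by (rule sym)
qed simp

end

subsection \<open>Profiles and the ground state representation\<close>

lemma ac_on_spike:
  assumes "ac_on a b f g" "finite S" "\<And>x. x \<in> {a..b} - S \<Longrightarrow> h x = g x"
  shows "ac_on a b f h"
  unfolding ac_on_def
proof (intro conjI allI impI)
  show "h absolutely_integrable_on {a..b}"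
    by (rule absolutely_integrable_spike[OF ac_onD(1)[OF assms(1)] negligible_finite[OF assms(2)] assms(3)])
  fix x y assume "a \<le> x \<and> x \<le> y \<and> y \<le> b"
  then show "(h has_integral f y - f x) {x..y}"
    by (intro has_integral_spike_finite[OF assms(2) _ ac_onD(2)[OF assms(1)]]) (use assms(3) in auto)
qed

lemma DERIV_reflect_within:
  fixes g :: "real \<Rightarrow> real"
  assumes "(g has_real_derivative d) (at (- x) within {0..})"
  shows "((\<lambda>x. g (- x)) has_real_derivative - d) (at x within {- R..0})"
proof -
  have "(g has_real_derivative d) (at (- x) within uminus ` {- R..0})"
    using assms by (rule DERIV_subset) auto
  moreover have "(uminus has_real_derivative - 1) (at x within {- R..0})"
    by (auto intro!: derivative_eq_intros)
  ultimately show ?thesis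
    using DERIV_image_chain[of g d uminus x "{- R..0}" "- 1"] by (simp add: o_def)
qed

lemma ac_on_even_extension:
  fixes q q' :: "real \<Rightarrow> real"
  assumes q: "\<And>x. 0 \<le> x \<Longrightarrow> (q has_real_derivative q' x) (at x within {0..})"
    and q': "continuous_on {0..} q'" and R: "0 \<le> R"
  shows "ac_on (- R) R (\<lambda>x. complex_of_real (q \<bar>x\<bar>)) (\<lambda>x. complex_of_real (sgn x * q' \<bar>x\<bar>))"
proof (rule ac_on_combine[where c=0])
  have "ac_on 0 R (\<lambda>x. complex_of_real (q \<bar>x\<bar>)) (\<lambda>x. complex_of_real (q' x))"
  proof (rule ac_on_C1)
    fix x assume x: "x \<in> {0..R}"
    have "(q has_real_derivative q' x) (at x within {0..R})"
      using q[of x] x by (auto intro: DERIV_subset)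
    then have "((\<lambda>x. complex_of_real (q x)) has_vector_derivative complex_of_real (q' x)) (at x within {0..R})"
      by (intro has_vector_derivative_of_real) (simp add: has_real_derivative_iff_has_vector_derivative)
    then show "((\<lambda>x. complex_of_real (q \<bar>x\<bar>)) has_vector_derivative complex_of_real (q' x)) (at x within {0..R})"
      by (rule has_vector_derivative_transform[rotated 2]) (use x in auto)
  qed (auto intro!: continuous_intros continuous_on_subset[OF q'])
  then show "ac_on 0 R (\<lambda>x. complex_of_real (q \<bar>x\<bar>)) (\<lambda>x. complex_of_real (sgn x * q' \<bar>x\<bar>))"
    by (rule ac_on_spike[where S="{0}"]) auto
  have "ac_on (- R) 0 (\<lambda>x. complex_of_real (q \<bar>x\<bar>)) (\<lambda>x. complex_of_real (- q' (- x)))"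
  proof (rule ac_on_C1)
    fix x assume x: "x \<in> {- R..0}"
    have "((\<lambda>x. q (- x)) has_real_derivative - q' (- x)) (at x within {- R..0})"
      by (intro DERIV_reflect_within q) (use x in auto)
    then have "((\<lambda>x. complex_of_real (q (- x))) has_vector_derivative complex_of_real (- q' (- x))) (at x within {- R..0})"
      by (intro has_vector_derivative_of_real) (simp add: has_real_derivative_iff_has_vector_derivative)
    then show "((\<lambda>x. complex_of_real (q \<bar>x\<bar>)) has_vector_derivative complex_of_real (- q' (- x))) (at x within {- R..0})"
      by (rule has_vector_derivative_transform[rotated 2]) (use x in auto)
  qed (auto intro!: continuous_intros continuous_on_compose2[OF q'])
  then show "ac_on (- R) 0 (\<lambda>x. complex_of_real (q \<bar>x\<bar>)) (\<lambda>x. complex_of_real (sgn x * q' \<bar>x\<bar>))"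
    by (rule ac_on_spike[where S="{0}"]) auto
qed (use R in auto)

lemma bounded_mult_integrable:
  fixes g :: "real \<Rightarrow> 'a::{banach, second_countable_topology}"
  assumes "integrable lborel g" "h \<in> borel_measurable borel" "\<And>x. \<bar>h x\<bar> \<le> K"
  shows "integrable lborel (\<lambda>x. h x *\<^sub>R g x)"
proof (rule Bochner_Integration.integrable_bound)
  show "integrable lborel (\<lambda>x. K * norm (g x))" using assms(1) by simp
  show "(\<lambda>x. h x *\<^sub>R g x) \<in> borel_measurable lborel" using assms by measurable
  show "AE x in lborel. norm (h x *\<^sub>R g x) \<le> norm (K * norm (g x))"
  proof (intro always_eventually allI)
    fix x
    have "\<bar>h x\<bar> * norm (g x) \<le> K * norm (g x)" by (intro mult_right_mono assms) simp
    then show "norm (h x *\<^sub>R g x) \<le> norm (K * norm (g x))" by simp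
  qed
qed

text \<open>
  The profile is the even extension of a function \<open>f\<close> on the half line with logarithmic derivative
  \<open>k\<close>. The Riccati equation for \<open>k\<close> is the stationary equation away from the origin, and the value
  of \<open>k\<close> at the origin is the jump condition.
\<close>

locale ground_state = double_power +
  fixes Z B C :: real and f k :: "real \<Rightarrow> real"
  assumes f_pos: "\<And>x. 0 \<le> x \<Longrightarrow> 0 < f x"
    and f_le: "\<And>x. 0 \<le> x \<Longrightarrow> f x \<le> C"
    and f_deriv: "\<And>x. 0 \<le> x \<Longrightarrow> (f has_real_derivative k x * f x) (at x within {0..})"
    and k_deriv: "\<And>x. 0 \<le> x \<Longrightarrow> (k has_real_derivative weight (f x) - (k x)\<^sup>2) (at x within {0..})"
    and k_0: "k 0 = - Z / 2"
    and k_bound: "\<And>x. 0 \<le> x \<Longrightarrow> \<bar>k x\<bar> \<le> B"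
    and k_lim: "(k \<longlongrightarrow> 0) at_top"
    and f_L2: "integrable lborel (\<lambda>x. (f \<bar>x\<bar>)\<^sup>2)"
begin

definition phi :: "real \<Rightarrow> real" where "phi x = f \<bar>x\<bar>"

text \<open>The logarithmic derivative of \<open>phi\<close> off the origin. Its jump at 0 is
  \<open>2 * k 0 = - Z\<close>.\<close>

definition kap :: "real \<Rightarrow> real" where "kap x = sgn x * k \<bar>x\<bar>"

lemma phi_pos: "0 < phi x"
  by (simp add: phi_def f_pos)

lemma phi_le: "phi x \<le> C"
  by (simp add: phi_def f_le)

lemma kap_bound: "\<bar>kap x\<bar> \<le> B"
  using k_bound[of "\<bar>x\<bar>"] k_bound[of 0] by (auto simp: kap_def sgn_if)

lemma f_cont: "continuous_on {0..} f"
  by (rule DERIV_continuous_on) (use f_deriv in auto)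

lemma k_cont: "continuous_on {0..} k"
  by (rule DERIV_continuous_on) (use k_deriv in auto)

lemma phi_cont: "continuous_on UNIV phi"
  unfolding phi_def[abs_def] by (rule continuous_on_compose2[OF f_cont]) (auto intro: continuous_intros)

lemma phi_measurable [measurable]: "phi \<in> borel_measurable borel"
  by (intro borel_measurable_continuous_onI phi_cont)

lemma kap_measurable [measurable]: "kap \<in> borel_measurable borel"
proof -
  have "continuous_on UNIV (\<lambda>x. k \<bar>x\<bar>)"
    by (rule continuous_on_compose2[OF k_cont]) (auto intro: continuous_intros)
  then have [measurable]: "(\<lambda>x. k \<bar>x\<bar>) \<in> borel_measurable borel"
    by (rule borel_measurable_continuous_onI)
  show ?thesis unfolding kap_def[abs_def] by measurable
qed

lemma weight_f_cont: "continuous_on {0..} (\<lambda>x. weight (f x))"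
  unfolding weight_def
  by (intro continuous_intros f_cont) (use f_pos in \<open>auto simp: less_imp_neq[symmetric]\<close>)

lemma weight_mono: "0 \<le> s \<Longrightarrow> s \<le> t \<Longrightarrow> weight s \<le> weight t"
  unfolding weight_def by (intro lin_mono powr_mono2) (use p in auto)

lemma weight_phi: "weight (phi x) \<le> weight C"
  by (intro weight_mono phi_le less_imp_le phi_pos)

lemma phi_L2: "(\<lambda>x. complex_of_real (phi x)) \<in> L2"
  using f_L2 by (simp add: L2_def phi_def[symmetric])

lemma kap_mult_L2: "g \<in> L2 \<Longrightarrow> (\<lambda>x. complex_of_real (kap x) * g x) \<in> L2"
  by (rule L2_bounded_mult[where B=B]) (auto simp: kap_bound)

lemma phi_ac:
  assumes "0 \<le> R"
  shows "ac_on (- R) R (\<lambda>x. complex_of_real (phi x)) (\<lambda>x. complex_of_real (kap x * phi x))"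
  using ac_on_even_extension[OF f_deriv continuous_on_mult[OF k_cont f_cont] assms]
  by (simp add: phi_def kap_def mult.assoc)

text \<open>Makes the quotient \<open>u / phi\<close> accessible to
  \<open>ac_on_mult\<close>.\<close>

lemma inverse_phi_ac:
  assumes "0 \<le> R"
  shows "ac_on (- R) R (\<lambda>x. complex_of_real (inverse (phi x))) (\<lambda>x. complex_of_real (- kap x * inverse (phi x)))"
proof -
  have "((\<lambda>x. inverse (f x)) has_real_derivative - k x * inverse (f x)) (at x within {0..})" if "0 \<le> x" for x
    using DERIV_inverse'[OF f_deriv[OF that]] f_pos[OF that] by (simp add: field_simps)
  moreover have "continuous_on {0..} (\<lambda>x. - k x * inverse (f x))"
    by (intro continuous_intros k_cont f_cont) (use f_pos in \<open>auto simp: less_imp_neq[symmetric]\<close>)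
  ultimately show ?thesis
    using ac_on_even_extension[of "\<lambda>x. inverse (f x)" "\<lambda>x. - k x * inverse (f x)" R] assms
    by (simp add: phi_def kap_def mult.assoc)
qed

lemma phi_weak_deriv: "weak_deriv (\<lambda>x. complex_of_real (phi x)) (\<lambda>x. complex_of_real (kap x) * complex_of_real (phi x))"
  unfolding weak_deriv_def
proof (intro allI impI, elim conjE)
  fix t t' :: "real \<Rightarrow> real"
  assume t: "\<forall>x. (t has_real_derivative t' x) (at x)" "continuous_on UNIV t'" "bounded {x. t x \<noteq> 0}"
  note i = test_integrable[OF t]
  let ?f = "\<lambda>x. complex_of_real (phi x)" and ?g = "\<lambda>x. complex_of_real (kap x) * complex_of_real (phi x)"
  have "(\<integral>x. t' x *\<^sub>R ?f x + t x *\<^sub>R ?g x \<partial>lborel) = 0"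
  proof (rule integral_eq_limit)
    show "integrable lborel (\<lambda>x. t' x *\<^sub>R ?f x + t x *\<^sub>R ?g x)"
      by (intro Bochner_Integration.integrable_add i phi_L2 kap_mult_L2)
    show "\<forall>\<^sub>F n in sequentially. ((\<lambda>x. t' x *\<^sub>R ?f x + t x *\<^sub>R ?g x) has_integral
        (complex_of_real (t (real n)) * ?f (real n) - complex_of_real (t (- real n)) * ?f (- real n))) {- real n..real n}"
    proof (intro always_eventually allI)
      fix n
      have "ac_on (- real n) (real n) (\<lambda>x. complex_of_real (t x)) (\<lambda>x. complex_of_real (t' x))"
        using t(1) by (intro ac_on_C1 continuous_intros continuous_on_subset[OF t(2)] has_vector_derivative_of_real)
          (auto simp flip: has_real_derivative_iff_has_vector_derivative intro: has_field_derivative_at_within)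
      from ac_onD(2)[OF ac_on_mult[OF this phi_ac], of "- real n" "real n"]
      show "((\<lambda>x. t' x *\<^sub>R ?f x + t x *\<^sub>R ?g x) has_integral
        (complex_of_real (t (real n)) * ?f (real n) - complex_of_real (t (- real n)) * ?f (- real n))) {- real n..real n}"
        by (simp add: scaleR_conv_of_real algebra_simps)
    qed
    obtain r where r: "\<And>x. t x \<noteq> 0 \<Longrightarrow> \<bar>x\<bar> \<le> r" using t(3) unfolding bounded_iff by auto
    obtain M :: nat where M: "r < real M" using reals_Archimedean2 by blast
    have "t (real n) = 0 \<and> t (- real n) = 0" if "n \<ge> M" for n
      using r[of "real n"] r[of "- real n"] M that by force
    then show "(\<lambda>n. complex_of_real (t (real n)) * ?f (real n) - complex_of_real (t (- real n)) * ?f (- real n)) \<longlonglongrightarrow> 0"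
      by (intro tendsto_eventually eventually_sequentiallyI[of M]) simp
  qed
  then show "(\<integral>x. t' x *\<^sub>R ?f x \<partial>lborel) = - (\<integral>x. t x *\<^sub>R ?g x \<partial>lborel)"
    using i phi_L2 kap_mult_L2[OF phi_L2] by (simp add: eq_neg_iff_add_eq_0)
qed

definition Phi :: h1 where "Phi = Abs_h1 (\<lambda>x. complex_of_real (phi x))"

lemma Phi_fun: "h1_fun Phi = (\<lambda>x. complex_of_real (phi x))"
  unfolding Phi_def
  by (rule Abs_h1_inverse)
    (use phi_L2 phi_weak_deriv kap_mult_L2[OF phi_L2] in \<open>auto intro!: continuous_intros phi_cont\<close>)

lemma Phi_deriv_AE: "AE x in lborel. h1_deriv Phi x = complex_of_real (kap x) * complex_of_real (phi x)"
  by (rule h1_deriv_eq_AE) (use phi_weak_deriv kap_mult_L2[OF phi_L2] in \<open>auto simp: Phi_fun\<close>)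

text \<open>\<open>dev u\<close> is \<open>\<phi> (u / \<phi>)'\<close>.\<close>

definition dev :: "h1 \<Rightarrow> real \<Rightarrow> complex" where
  "dev u x = h1_deriv u x - complex_of_real (kap x) * h1_fun u x"

definition wmass :: "h1 \<Rightarrow> real" where
  "wmass u = (\<integral>x. weight (phi x) * (cmod (h1_fun u x))\<^sup>2 \<partial>lborel)"

lemma dev_L2: "dev u \<in> L2"
  unfolding dev_def[abs_def] by (intro L2_diff h1_deriv kap_mult_L2 h1_fun_L2)

lemma wmass_integrable: "integrable lborel (\<lambda>x. weight (phi x) * (cmod (h1_fun u x))\<^sup>2)"
  using bounded_mult_integrable[OF L2_sq_integrable[OF h1_fun_L2[of u]], of "\<lambda>x. weight (phi x)" "weight C"]
    weight_phi weight_nonneg by simp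

lemma delta_form_diag: "delta_form Z u u = (\<integral>x. (cmod (h1_deriv u x))\<^sup>2 \<partial>lborel) - Z * (cmod (h1_fun u 0))\<^sup>2"
  unfolding delta_form_def L2_sq_eq[OF h1_deriv(1)]
  by (simp add: complex_mult_cnj cmod_power2 flip: power2_eq_square)

text \<open>By the Riccati equation the integrand is the derivative of \<open>kap * |u|^2\<close> on
  each half line. The one-sided values at 0 add up to \<open>- 2 * k 0 = Z\<close> times
  \<open>|u(0)|^2\<close>. The terms at infinity vanish because \<open>u\<close> is bounded and
  \<open>k\<close> tends to 0.\<close>

lemma dev_cross_integral:
  "(\<integral>x. 2 * kap x * Re (h1_deriv u x * cnj (h1_fun u x)) + (weight (phi x) - (kap x)\<^sup>2) * (cmod (h1_fun u x))\<^sup>2 \<partial>lborel)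
    = Z * (cmod (h1_fun u 0))\<^sup>2"
  "integrable lborel (\<lambda>x. 2 * kap x * Re (h1_deriv u x * cnj (h1_fun u x)))"
  "integrable lborel (\<lambda>x. (kap x)\<^sup>2 * (cmod (h1_fun u x))\<^sup>2)"
proof -
  let ?F = "\<lambda>x. 2 * kap x * Re (h1_deriv u x * cnj (h1_fun u x)) + (weight (phi x) - (kap x)\<^sup>2) * (cmod (h1_fun u x))\<^sup>2"
  have "integrable lborel (\<lambda>x. (2 * kap x) *\<^sub>R Re (h1_deriv u x * cnj (h1_fun u x)))"
    by (rule bounded_mult_integrable[where K="2 * B"])
      (use kap_bound in \<open>auto intro!: integrable_Re L2_cnj_integrable h1_deriv h1_fun_L2 simp: abs_mult simp del: times_complex.sel\<close>)
  then show i1: "integrable lborel (\<lambda>x. 2 * kap x * Re (h1_deriv u x * cnj (h1_fun u x)))"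
    unfolding real_scaleR_def .
  have "\<bar>(kap x)\<^sup>2\<bar> \<le> B\<^sup>2" for x
    using power_mono[OF kap_bound abs_ge_zero, of x 2] by simp
  then show i2: "integrable lborel (\<lambda>x. (kap x)\<^sup>2 * (cmod (h1_fun u x))\<^sup>2)"
    using bounded_mult_integrable[OF L2_sq_integrable[OF h1_fun_L2[of u]], of "\<lambda>x. (kap x)\<^sup>2" "B\<^sup>2"] by simp
  have Fi: "integrable lborel ?F"
    unfolding left_diff_distrib
    by (intro Bochner_Integration.integrable_add Bochner_Integration.integrable_diff i1 i2 wmass_integrable)
  let ?m = "\<lambda>x. (cmod (h1_fun u x))\<^sup>2"
  have hi: "(?F has_integral (Z * ?m 0 + k R * (?m R + ?m (- R)))) {- R..R}" if R: "0 \<le> R" for R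
  proof -
    have "(?F has_integral (k R * ?m R - k 0 * ?m 0)) {0..R}"
    proof (rule has_integral_spike_finite[of "{0}"])
      show "((\<lambda>x. 2 * k x * Re (h1_deriv u x * cnj (h1_fun u x)) + (weight (f x) - (k x)\<^sup>2) * (cmod (h1_fun u x))\<^sup>2)
          has_integral (k R * ?m R - k 0 * ?m 0)) {0..R}"
      proof (rule h1_weighted_ftc)
        fix x assume "x \<in> {0..R}"
        then show "(k has_real_derivative weight (f x) - (k x)\<^sup>2) (at x within {0..R})"
          by (intro DERIV_subset[OF k_deriv]) auto
      qed (use R in \<open>auto intro!: continuous_intros continuous_on_subset[OF weight_f_cont]
            continuous_on_subset[OF k_cont]\<close>)
    qed (auto simp: kap_def phi_def)
    moreover have "(?F has_integral (- k (- 0) * ?m 0 - (- k (- (- R))) * ?m (- R))) {- R..0}"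
    proof (rule has_integral_spike_finite[of "{0}"])
      show "((\<lambda>x. 2 * - k (- x) * Re (h1_deriv u x * cnj (h1_fun u x)) + (weight (f (- x)) - (k (- x))\<^sup>2) * (cmod (h1_fun u x))\<^sup>2)
          has_integral (- k (- 0) * ?m 0 - (- k (- (- R))) * ?m (- R))) {- R..0}"
      proof (rule h1_weighted_ftc)
        fix x assume x: "x \<in> {- R..0}"
        have "((\<lambda>x. k (- x)) has_real_derivative - (weight (f (- x)) - (k (- x))\<^sup>2)) (at x within {- R..0})"
          by (intro DERIV_reflect_within k_deriv) (use x in auto)
        from DERIV_minus[OF this]
        show "((\<lambda>x. - k (- x)) has_real_derivative weight (f (- x)) - (k (- x))\<^sup>2) (at x within {- R..0})"
          by simp
      qed (use R in \<open>auto intro!: continuous_intros continuous_on_compose2[OF weight_f_cont] continuous_on_compose2[OF k_cont]\<close>)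
    qed (auto simp: kap_def phi_def)
    ultimately have "(?F has_integral ((- k (- 0) * ?m 0 - (- k (- (- R))) * ?m (- R)) + (k R * ?m R - k 0 * ?m 0))) {- R..R}"
      using R by (intro has_integral_combine[of "- R" 0 R]) auto
    then show ?thesis by (simp add: k_0 algebra_simps)
  qed
  have "(\<lambda>n. k (real n) * (?m (real n) + ?m (- real n))) \<longlonglongrightarrow> 0"
  proof (rule Lim_null_comparison)
    have "?m x \<le> 2 * (norm u)\<^sup>2" for x by (rule h1_sup_bound)
    then have "norm (k x * (?m x + ?m (- x))) \<le> \<bar>k x\<bar> * (4 * (norm u)\<^sup>2)" for x
      using add_mono[OF h1_sup_bound h1_sup_bound, of u x u "- x"]
      by (auto simp: abs_mult intro!: mult_left_mono)
    then show "\<forall>\<^sub>F n in sequentially. norm (k (real n) * (?m (real n) + ?m (- real n))) \<le> \<bar>k (real n)\<bar> * (4 * (norm u)\<^sup>2)"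
      by (intro always_eventually allI)
    have "(\<lambda>n. k (real n)) \<longlonglongrightarrow> 0"
      by (rule filterlim_compose[OF k_lim filterlim_real_sequentially])
    then show "(\<lambda>n. \<bar>k (real n)\<bar> * (4 * (norm u)\<^sup>2)) \<longlonglongrightarrow> 0"
      by (intro tendsto_mult_left_zero tendsto_rabs_zero)
  qed
  from tendsto_add[OF tendsto_const this]
  have lim: "(\<lambda>n. Z * ?m 0 + k (real n) * (?m (real n) + ?m (- real n))) \<longlonglongrightarrow> Z * ?m 0" by simp
  show "(\<integral>x. ?F x \<partial>lborel) = Z * (cmod (h1_fun u 0))\<^sup>2"
    by (rule integral_eq_limit[OF Fi _ lim]) (intro always_eventually allI hi, simp)
qed

lemma ground_state_representation:
  "delta_form Z u u + wmass u = (\<integral>x. (cmod (dev u x))\<^sup>2 \<partial>lborel)"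
proof -
  let ?D = "\<lambda>x. (cmod (h1_deriv u x))\<^sup>2" and ?W = "\<lambda>x. weight (phi x) * (cmod (h1_fun u x))\<^sup>2"
    and ?F = "\<lambda>x. 2 * kap x * Re (h1_deriv u x * cnj (h1_fun u x)) + (weight (phi x) - (kap x)\<^sup>2) * (cmod (h1_fun u x))\<^sup>2"
  note i = dev_cross_integral(2,3)[of u]
  have Fi: "integrable lborel ?F"
    unfolding left_diff_distrib
    by (intro Bochner_Integration.integrable_add Bochner_Integration.integrable_diff i wmass_integrable)
  \<comment> \<open>The identity holds for any \<open>w\<close>: the weight is added and subtracted
    so that the last bracket is the integrand evaluated in
    \<open>dev_cross_integral\<close>.\<close>
  have "(cmod (a - of_real r * b))\<^sup>2 = (cmod a)\<^sup>2 + w * (cmod b)\<^sup>2 - (2 * r * Re (a * cnj b) + (w - r\<^sup>2) * (cmod b)\<^sup>2)" for a b r w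
    by (simp add: cmod_power2) (simp add: power2_eq_square algebra_simps)
  then have "(\<lambda>x. (cmod (dev u x))\<^sup>2) = (\<lambda>x. ?D x + ?W x - ?F x)"
    unfolding dev_def by blast
  then have "(\<integral>x. (cmod (dev u x))\<^sup>2 \<partial>lborel) = (\<integral>x. ?D x + ?W x - ?F x \<partial>lborel)" by simp
  also have "\<dots> = (\<integral>x. ?D x + ?W x \<partial>lborel) - (\<integral>x. ?F x \<partial>lborel)"
    by (intro Bochner_Integration.integral_diff Bochner_Integration.integrable_add Fi
        L2_sq_integrable h1_deriv wmass_integrable)
  also have "(\<integral>x. ?D x + ?W x \<partial>lborel) = (\<integral>x. ?D x \<partial>lborel) + wmass u"
    unfolding wmass_def
    by (intro Bochner_Integration.integral_add L2_sq_integrable h1_deriv wmass_integrable)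
  finally show ?thesis
    unfolding delta_form_diag dev_cross_integral(1) by simp
qed

lemma dev_measurable [measurable]: "dev u \<in> borel_measurable borel"
  by (rule L2_measurable[OF dev_L2])

lemma Phi_form_zero: "delta_form Z Phi Phi + wmass Phi = 0"
proof -
  have "AE x in lborel. dev Phi x = 0"
    using Phi_deriv_AE by eventually_elim (simp add: dev_def Phi_fun)
  then have "(\<integral>x. (cmod (dev Phi x))\<^sup>2 \<partial>lborel) = 0"
    by (intro integral_eq_zero_AE) (auto elim: eventually_mono)
  then show ?thesis by (simp add: ground_state_representation)
qed

text \<open>Polarization: adding \<open>Phi\<close> does not change \<open>dev\<close>, hence not the quadratic form.\<close>

lemma weak_stationary: "delta_form Z Phi v = nl Phi v"
proof -
  have "AE x in lborel. dev (Phi + v) x = dev v x"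
    using h1_deriv_add_AE[of Phi v] Phi_deriv_AE
    by eventually_elim (simp add: dev_def h1_fun_simps Phi_fun algebra_simps)
  then have "(\<integral>x. (cmod (dev (Phi + v) x))\<^sup>2 \<partial>lborel) = (\<integral>x. (cmod (dev v x))\<^sup>2 \<partial>lborel)"
    by (intro integral_cong_AE) (auto elim: eventually_mono)
  then have 1: "delta_form Z (Phi + v) (Phi + v) + wmass (Phi + v) = delta_form Z v v + wmass v"
    by (simp add: ground_state_representation)
  note 2 = Phi_form_zero
  have pw: "weight (phi x) * (cmod (h1_fun (Phi + v) x))\<^sup>2
      = weight (phi x) * (cmod (h1_fun Phi x))\<^sup>2 + weight (phi x) * (cmod (h1_fun v x))\<^sup>2
        - 2 * Re (N (h1_fun Phi x) * cnj (h1_fun v x))" for x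
    using phi_pos[of x]
    by (simp add: h1_fun_simps Phi_fun N_weight cmod_power2) (simp add: power2_eq_square algebra_simps)
  have Ri: "integrable lborel (\<lambda>x. Re (N (h1_fun Phi x) * cnj (h1_fun v x)))"
    by (intro integrable_Re nl_integrable)
  have "wmass (Phi + v) = wmass Phi + wmass v - 2 * (\<integral>x. Re (N (h1_fun Phi x) * cnj (h1_fun v x)) \<partial>lborel)"
    unfolding wmass_def pw
    by (subst Bochner_Integration.integral_diff Bochner_Integration.integral_add,
        (intro Bochner_Integration.integrable_add wmass_integrable integrable_mult_right Ri)+)+
      (simp del: times_complex.sel)
  also have "(\<integral>x. Re (N (h1_fun Phi x) * cnj (h1_fun v x)) \<partial>lborel) = nl Phi v"
    unfolding nl_def by (rule integral_Re[OF nl_integrable])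
  finally have 3: "wmass (Phi + v) = wmass Phi + wmass v - 2 * nl Phi v" .
  have "delta_form Z (Phi + v) (Phi + v) = delta_form Z Phi Phi + delta_form Z v v + 2 * delta_form Z Phi v"
    by (simp add: delta_form_add_left delta_form_add_right delta_form_sym[of Z v Phi])
  with 1 2 3 show ?thesis by simp
qed

lemma Phi_stationary: "nls_solution p lam1 lam2 Z (\<lambda>t. Phi)"
  unfolding nls_solution_def
proof (intro conjI exI[of _ "\<lambda>_. 0"] allI)
  fix t :: real and v :: h1
  show "blinfun_apply 0 (cscale (- \<i>) v) - delta_form Z Phi v
      + Re (\<integral>x. N (h1_fun Phi x) * cnj (h1_fun v x) \<partial>lborel) = 0"
    using weak_stationary[of v] unfolding nl_def by simp
qed (auto intro: continuous_on_const)

text \<open>The first-order Taylor remainder, at \<open>phi^2\<close>, of the potential regarded as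
  a function of the squared modulus.\<close>

definition H :: "h1 \<Rightarrow> real \<Rightarrow> real" where
  "H u x = potential (cmod (h1_fun u x)) - potential (phi x)
     - weight (phi x) * ((cmod (h1_fun u x))\<^sup>2 - (phi x)\<^sup>2) / 2"

lemma H_eq:
  "H u = (\<lambda>x. (potential (cmod (h1_fun u x)) - potential (cmod (h1_fun Phi x)))
     - (weight (phi x) * (cmod (h1_fun u x))\<^sup>2 - weight (phi x) * (cmod (h1_fun Phi x))\<^sup>2) / 2)"
  using phi_pos by (simp add: H_def Phi_fun fun_eq_iff right_diff_distrib less_imp_le)

lemma H_integrable: "integrable lborel (H u)"
  unfolding H_eq
  by (rule Bochner_Integration.integrable_diff[OF
        Bochner_Integration.integrable_diff[OF potential_integrable potential_integrable]
        integrable_divide[OF Bochner_Integration.integrable_diff[OF wmass_integrable wmass_integrable]]])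

lemma energy_gap:
  "energy2 Z u - energy2 Z Phi = (\<integral>x. (cmod (dev u x))\<^sup>2 \<partial>lborel) + 2 * (\<integral>x. H u x \<partial>lborel)"
proof -
  note 1 = Phi_form_zero
  have "(\<integral>x. H u x \<partial>lborel) = (G u - G Phi) - (wmass u - wmass Phi) / 2"
    unfolding H_eq G_def wmass_def by (simp add: potential_integrable wmass_integrable)
  then show ?thesis
    using 1 ground_state_representation[of u] by (simp add: energy2_def field_simps)
qed

lemma H_split:
  "H u x = - lam1 / (p + 1) * ((cmod (h1_fun u x) powr (p + 1) - phi x powr (p + 1))
        - (p + 1) / 2 * phi x powr (p + 1 - 2) * ((cmod (h1_fun u x))\<^sup>2 - (phi x)\<^sup>2))
     - lam2 / (2 * p) * ((cmod (h1_fun u x) powr (2 * p) - phi x powr (2 * p))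
        - 2 * p / 2 * phi x powr (2 * p - 2) * ((cmod (h1_fun u x))\<^sup>2 - (phi x)\<^sup>2))"
proof -
  have *: "c / q * (a - q / 2 * w * d) = c / q * a - c * w * d / 2" if "0 < q" for a c d q w :: real
    using that by (simp add: field_simps)
  have "p + 1 > 0" "2 * p > 0" using p by auto
  then show ?thesis
    unfolding H_def potential_def weight_def by (simp only: *) (simp add: algebra_simps add_divide_distrib diff_divide_distrib)
qed

text \<open>The remainders of both powers are nonnegative; keeping the lower power alone already
  yields a quantitative bound.\<close>

lemma H_lower:
  "- lam1 / (p + 1) * ((cmod (h1_fun u x) powr (p + 1) - phi x powr (p + 1))
        - (p + 1) / 2 * phi x powr (p + 1 - 2) * ((cmod (h1_fun u x))\<^sup>2 - (phi x)\<^sup>2)) \<le> H u x"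
proof -
  have "0 \<le> (cmod (h1_fun u x) powr (2 * p) - phi x powr (2 * p))
        - 2 * p / 2 * phi x powr (2 * p - 2) * ((cmod (h1_fun u x))\<^sup>2 - (phi x)\<^sup>2)"
    using powr_sq_tangent[of "2 * p" "phi x" "cmod (h1_fun u x)"] p phi_pos[of x] by simp
  moreover have "lam2 / (2 * p) \<le> 0" using lam2 p by (simp add: divide_nonpos_pos)
  ultimately show ?thesis
    unfolding H_split using mult_nonpos_nonneg by fastforce
qed

lemma H_nonneg: "0 \<le> H u x"
proof -
  have "0 \<le> (cmod (h1_fun u x) powr (p + 1) - phi x powr (p + 1))
        - (p + 1) / 2 * phi x powr (p + 1 - 2) * ((cmod (h1_fun u x))\<^sup>2 - (phi x)\<^sup>2)"
    using powr_sq_tangent[of "p + 1" "phi x" "cmod (h1_fun u x)"] p phi_pos[of x] by simp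
  moreover have "0 \<le> - lam1 / (p + 1)" using lam1 p by (intro divide_nonneg_pos) auto
  ultimately show ?thesis using H_lower[of u x] mult_nonneg_nonneg order_trans by blast
qed

subsection \<open>Coercivity modulo phases and stability\<close>

lemma phi_lower_bound:
  obtains c where "0 < c" "\<And>x. \<bar>x\<bar> \<le> R \<Longrightarrow> c \<le> phi x"
proof (cases "R \<ge> 0")
  case True
  have "\<exists>z\<in>{- R..R}. \<forall>y\<in>{- R..R}. phi z \<le> phi y"
    by (rule continuous_attains_inf) (use True in \<open>auto intro: continuous_on_subset[OF phi_cont]\<close>)
  then obtain z where "\<And>y. y \<in> {- R..R} \<Longrightarrow> phi z \<le> phi y" by blast
  then show ?thesis using that[of "phi z"] phi_pos[of z] by (auto simp: abs_le_iff)
next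
  case False
  then show ?thesis using that[of 1] by force
qed

text \<open>The quotient \<open>u / phi\<close> has derivative \<open>dev u / phi\<close>, and
  \<open>phi\<close> is bounded below on bounded intervals. The admissible gap depends on
  \<open>R\<close>, since \<open>phi\<close> decays, but not on \<open>u\<close>.\<close>

lemma quotient_nearly_constant:
  assumes R: "0 \<le> R" and \<tau>: "0 < \<tau>"
  shows "\<exists>\<delta>>0. \<forall>u. (\<integral>x. (cmod (dev u x))\<^sup>2 \<partial>lborel) \<le> \<delta> \<longrightarrow>
    (\<forall>x. \<bar>x\<bar> \<le> R \<longrightarrow> cmod (h1_fun u x - h1_fun u 0 / phi 0 * phi x) \<le> \<tau> * phi x)"
proof -
  obtain c where c: "0 < c" "\<And>x. \<bar>x\<bar> \<le> R \<Longrightarrow> c \<le> phi x"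
    using phi_lower_bound by blast
  \<comment> \<open>The level in the estimate of \<open>|dev|\<close> by
    \<open>s + |dev|^2 / s\<close>. Integrated over a length of at most \<open>R\<close>, each
    summand contributes at most \<open>c * \<tau> / 2\<close>; \<open>R + 1\<close> avoids division
    by zero.\<close>
  define s where "s = c * \<tau> / (2 * (R + 1))"
  have s: "s > 0" using c \<tau> R by (simp add: s_def)
  have sR: "R * s \<le> c * \<tau> / 2"
  proof -
    have "R * s \<le> (R + 1) * s" using s by (intro mult_right_mono) auto
    also have "\<dots> = c * \<tau> / 2" using R by (simp add: s_def field_simps)
    finally show ?thesis .
  qed
  show ?thesis
  proof (intro exI[of _ "s * (c * \<tau> / 2)"] conjI allI impI)
    show "0 < s * (c * \<tau> / 2)" using s c \<tau> by simp
    fix u x assume d: "(\<integral>x. (cmod (dev u x))\<^sup>2 \<partial>lborel) \<le> s * (c * \<tau> / 2)" and x: "\<bar>x\<bar> \<le> R"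
    define w where "w y = complex_of_real (inverse (phi y)) * h1_fun u y" for y
    define g where "g y = complex_of_real (inverse (phi y)) * dev u y" for y
    have ac: "ac_on (- R) R w g"
    proof -
      have "g = (\<lambda>x. complex_of_real (inverse (phi x)) * h1_deriv u x + h1_fun u x * complex_of_real (- kap x * inverse (phi x)))"
        by (simp add: g_def dev_def fun_eq_iff algebra_simps)
      then show ?thesis
        using ac_on_mult[OF inverse_phi_ac[OF R] h1_ac[of "- R" R u]] by (simp add: w_def[abs_def])
    qed
    have dint: "(\<lambda>y. (cmod (dev u y))\<^sup>2) integrable_on {a..b}"
      "integral {a..b} (\<lambda>y. (cmod (dev u y))\<^sup>2) \<le> s * (c * \<tau> / 2)" for a b
      using integral_subinterval_le[OF L2_sq_integrable[OF dev_L2[of u]], of a b] d by auto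
    have step: "cmod (w b - w a) \<le> \<tau>" if ab: "- R \<le> a" "a \<le> b" "b \<le> R" "b - a \<le> R" for a b
    proof -
      have hi: "(g has_integral (w b - w a)) {a..b}"
        using ac_onD(2)[OF ac] ab by auto
      let ?B = "\<lambda>y. (s + (cmod (dev u y))\<^sup>2 / s) / c"
      have Bi: "(?B has_integral ((b - a) * s + integral {a..b} (\<lambda>y. (cmod (dev u y))\<^sup>2) / s) / c) {a..b}"
        using ab by (intro has_integral_divide has_integral_add integrable_integral[OF dint(1)])
          (metis content_real has_integral_const_real real_scaleR_def)
      have "cmod (w b - w a) \<le> integral {a..b} ?B"
        unfolding integral_unique[OF hi, symmetric]
      proof (rule integral_norm_bound_integral)
        show "g integrable_on {a..b}" using hi by auto
        show "?B integrable_on {a..b}" using Bi by auto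
        fix y assume y: "y \<in> {a..b}"
        have "cmod (g y) = cmod (dev u y) / phi y"
          using phi_pos[of y] by (simp add: g_def norm_mult divide_inverse mult.commute norm_inverse del: of_real_inverse)
        also have "\<dots> \<le> cmod (dev u y) / c"
          using c(1) c(2)[of y] y ab phi_pos[of y] by (intro divide_left_mono) auto
        also have "cmod (dev u y) \<le> s + (cmod (dev u y))\<^sup>2 / s"
        proof -
          have "0 \<le> (cmod (dev u y) - s)\<^sup>2 + s * cmod (dev u y)" using s by simp
          then have "cmod (dev u y) * s \<le> s * s + (cmod (dev u y))\<^sup>2"
            by (simp add: power2_eq_square algebra_simps)
          then show ?thesis using s by (simp add: field_simps power2_eq_square)
        qed
        then have "cmod (dev u y) / c \<le> ?B y" using c by (intro divide_right_mono) auto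
        finally show "cmod (g y) \<le> ?B y" .
      qed
      also have "\<dots> = ((b - a) * s + integral {a..b} (\<lambda>y. (cmod (dev u y))\<^sup>2) / s) / c"
        using Bi by (rule integral_unique)
      also have "\<dots> \<le> (c * \<tau> / 2 + c * \<tau> / 2) / c"
      proof (intro divide_right_mono add_mono)
        show "(b - a) * s \<le> c * \<tau> / 2" by (rule order_trans[OF mult_right_mono[OF ab(4) less_imp_le[OF s]] sR])
        show "integral {a..b} (\<lambda>y. (cmod (dev u y))\<^sup>2) / s \<le> c * \<tau> / 2"
          using dint(2)[of a b] s by (simp add: divide_le_eq mult.commute)
      qed (use c in simp)
      also have "\<dots> = \<tau>" using c by simp
      finally show ?thesis .
    qed
    have "cmod (w x - w 0) \<le> \<tau>"
    proof (cases "x \<ge> 0")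
      case True
      then show ?thesis using step[of 0 x] x R by simp
    next
      case False
      then show ?thesis using step[of x 0] x R by (simp add: norm_minus_commute)
    qed
    then have "cmod (w x - w 0) * phi x \<le> \<tau> * phi x"
      using phi_pos[of x] by (intro mult_right_mono) auto
    moreover have "h1_fun u x - h1_fun u 0 / phi 0 * phi x = (w x - w 0) * phi x"
      using phi_pos[of x] phi_pos[of 0] by (simp add: w_def field_simps)
    ultimately show "cmod (h1_fun u x - h1_fun u 0 / phi 0 * phi x) \<le> \<tau> * phi x"
      using phi_pos[of x] by (simp add: norm_mult)
  qed
qed

lemma gap_bounds:
  assumes "energy2 Z u - energy2 Z Phi \<le> \<delta>"
  shows "(\<integral>x. (cmod (dev u x))\<^sup>2 \<partial>lborel) \<le> \<delta>" "(\<integral>x. H u x \<partial>lborel) \<le> \<delta> / 2"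
proof -
  have "(\<integral>x. (cmod (dev u x))\<^sup>2 \<partial>lborel) \<ge> 0" "(\<integral>x. H u x \<partial>lborel) \<ge> 0"
    by (auto intro: Bochner_Integration.integral_nonneg H_nonneg)
  then show "(\<integral>x. (cmod (dev u x))\<^sup>2 \<partial>lborel) \<le> \<delta>" "(\<integral>x. H u x \<partial>lborel) \<le> \<delta> / 2"
    using assms[unfolded energy_gap] by linarith+
qed

text \<open>If the modulus of \<open>u / phi\<close> at 0 were off 1 by more than \<open>e\<close>,
  near constancy would keep \<open>|u|\<close> away from \<open>phi\<close> by
  \<open>e / 2 * phi\<close> on all of \<open>[0, 1]\<close>. Then \<open>H u\<close> would be at
  least \<open>h\<close> on an interval of length 1, while its integral is at most half of the
  gap.\<close>

lemma amplitude_nearly_one: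
  assumes e: "0 < e" "e < 1"
  shows "\<exists>\<delta>>0. \<forall>u. energy2 Z u - energy2 Z Phi \<le> \<delta> \<longrightarrow> \<bar>cmod (h1_fun u 0 / phi 0) - 1\<bar> \<le> e"
proof -
  obtain \<delta>1 where \<delta>1: "\<delta>1 > 0" "\<And>u x. (\<integral>x. (cmod (dev u x))\<^sup>2 \<partial>lborel) \<le> \<delta>1 \<Longrightarrow> \<bar>x\<bar> \<le> 1 \<Longrightarrow>
      cmod (h1_fun u x - h1_fun u 0 / phi 0 * phi x) \<le> e / 2 * phi x"
    using quotient_nearly_constant[of 1 "e / 2"] e by auto
  have p2: "p + 1 > 2" using p by simp
  obtain c where c: "c > 0" "\<And>s t. 0 < s \<Longrightarrow> 0 \<le> t \<Longrightarrow> e / 2 * s \<le> \<bar>t - s\<bar> \<Longrightarrow>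
    c * s powr (p + 1) \<le> (t powr (p + 1) - s powr (p + 1)) - (p + 1) / 2 * s powr (p + 1 - 2) * (t\<^sup>2 - s\<^sup>2)"
    using powr_sq_strict_tangent[OF p2, of "e / 2"] e by auto
  obtain m where m: "m > 0" "\<And>x. \<bar>x\<bar> \<le> 1 \<Longrightarrow> m \<le> phi x" using phi_lower_bound by blast
  define h where "h = - lam1 / (p + 1) * (c * m powr (p + 1))"
  have l: "- lam1 / (p + 1) > 0" using lam1 p by (intro divide_pos_pos) auto
  have h: "h > 0" unfolding h_def using l c m by (intro mult_pos_pos) auto
  show ?thesis
  proof (intro exI[of _ "min \<delta>1 h"] conjI allI impI)
    show "0 < min \<delta>1 h" using \<delta>1 h by simp
    fix u assume "energy2 Z u - energy2 Z Phi \<le> min \<delta>1 h"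
    note gap = gap_bounds[OF this]
    show "\<bar>cmod (h1_fun u 0 / phi 0) - 1\<bar> \<le> e"
    proof (rule ccontr)
      assume far: "\<not> \<bar>cmod (h1_fun u 0 / phi 0) - 1\<bar> \<le> e"
      have low: "h \<le> H u x" if x: "x \<in> {0..1}" for x
      proof -
        let ?r = "cmod (h1_fun u 0 / phi 0)"
        have "\<bar>cmod (h1_fun u x) - ?r * phi x\<bar> \<le> cmod (h1_fun u x - h1_fun u 0 / phi 0 * phi x)"
          using norm_triangle_ineq3[of "h1_fun u x" "h1_fun u 0 / phi 0 * phi x"] phi_pos[of x]
          unfolding norm_mult by simp
        also have "\<dots> \<le> e / 2 * phi x" using \<delta>1(2)[of u x] gap x by auto
        finally have "\<bar>cmod (h1_fun u x) - ?r * phi x\<bar> \<le> e / 2 * phi x" .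
        moreover have "e * phi x \<le> \<bar>?r * phi x - phi x\<bar>"
        proof -
          have "e * phi x \<le> \<bar>?r - 1\<bar> * phi x" using far phi_pos[of x] by (intro mult_right_mono) auto
          also have "\<dots> = \<bar>(?r - 1) * phi x\<bar>" using phi_pos[of x] by (simp add: abs_mult)
          finally show ?thesis by (simp add: left_diff_distrib)
        qed
        ultimately have "e / 2 * phi x \<le> \<bar>cmod (h1_fun u x) - phi x\<bar>" by linarith
        from c(2)[OF phi_pos _ this]
        have *: "c * phi x powr (p + 1) \<le> (cmod (h1_fun u x) powr (p + 1) - phi x powr (p + 1))
          - (p + 1) / 2 * phi x powr (p + 1 - 2) * ((cmod (h1_fun u x))\<^sup>2 - (phi x)\<^sup>2)" by simp
        have "h \<le> - lam1 / (p + 1) * (c * phi x powr (p + 1))"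
          unfolding h_def using l c(1) m m(2)[of x] x p by (intro mult_left_mono powr_mono2) auto
        also have "\<dots> \<le> H u x"
          by (rule order_trans[OF mult_left_mono[OF *] H_lower]) (use l in simp)
        finally show ?thesis .
      qed
      have "h = (\<integral>x. h * indicator {0..1::real} x \<partial>lborel)" by simp
      also have "\<dots> \<le> (\<integral>x. H u x \<partial>lborel)"
      proof (rule Bochner_Integration.integral_mono)
        show "integrable lborel (\<lambda>x. h * indicator {0..1::real} x)" by simp
        show "h * indicator {0..1::real} x \<le> H u x" for x
          using low[of x] H_nonneg[of u x] by (auto simp: indicator_def)
      qed (rule H_integrable)
      finally show False using gap(2) h by (simp add: min_def split: if_splits)
    qed
  qed
qed

lemma mass_Phi: "mass Phi = (\<integral>x. (phi x)\<^sup>2 \<partial>lborel)"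
  by (simp add: mass_def Phi_fun)

lemma phi_sq_integrable: "integrable lborel (\<lambda>x. (phi x)\<^sup>2)"
  using f_L2 by (simp add: phi_def)

text \<open>
  Where \<open>u\<close> is close to \<open>z \<phi>\<close> the sum \<open>u + z \<phi>\<close> is close to \<open>2 z \<phi>\<close>, so by the parallelogram law an upper
  bound on the mass of \<open>u\<close> alone controls the difference on the whole line.
\<close>

lemma mass_distance_small:
  assumes e: "0 < e" "e < 1"
  shows "\<exists>\<delta>0>0. \<forall>\<delta> u. \<delta> \<le> \<delta>0 \<longrightarrow> energy2 Z u - energy2 Z Phi \<le> \<delta> \<longrightarrow> mass u \<le> mass Phi + \<delta> \<longrightarrow>
    (\<exists>\<theta>. mass (u - cscale (cis \<theta>) Phi) \<le> 2 * \<delta> + 4 * e * (mass Phi + 1))"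
proof -
  \<comment> \<open>The interval must hold all but \<open>e\<close> of the mass of
    \<open>phi\<close>. It is fixed before the gap, because the gap that makes the quotient nearly
    constant depends on it.\<close>
  have "(\<lambda>n. \<integral>x. indicator {- real n..real n} x *\<^sub>R (phi x)\<^sup>2 \<partial>lborel) \<longlonglongrightarrow> mass Phi"
    unfolding mass_Phi by (rule integral_expanding_intervals[OF phi_sq_integrable])
  then have "\<forall>\<^sub>F n in sequentially. mass Phi - e < (\<integral>x. indicator {- real n..real n} x *\<^sub>R (phi x)\<^sup>2 \<partial>lborel)"
    by (rule order_tendstoD(1)) (use e in simp)
  then obtain n where n: "mass Phi - e < (\<integral>x. indicator {- real n..real n} x *\<^sub>R (phi x)\<^sup>2 \<partial>lborel)"
    by (auto simp: eventually_sequentially)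
  define I where "I = (\<integral>x. indicator {- real n..real n} x *\<^sub>R (phi x)\<^sup>2 \<partial>lborel)"
  have I: "I \<ge> 0" "I \<ge> mass Phi - e" using n unfolding I_def
    by (auto intro!: Bochner_Integration.integral_nonneg)
  obtain \<delta>1 where \<delta>1: "\<delta>1 > 0" "\<And>u x. (\<integral>x. (cmod (dev u x))\<^sup>2 \<partial>lborel) \<le> \<delta>1 \<Longrightarrow> \<bar>x\<bar> \<le> real n \<Longrightarrow>
      cmod (h1_fun u x - h1_fun u 0 / phi 0 * phi x) \<le> e / 2 * phi x"
    using quotient_nearly_constant[of "real n" "e / 2"] e by auto
  obtain \<delta>2 where \<delta>2: "\<delta>2 > 0" "\<And>u. energy2 Z u - energy2 Z Phi \<le> \<delta>2 \<Longrightarrow> \<bar>cmod (h1_fun u 0 / phi 0) - 1\<bar> \<le> e / 2"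
    using amplitude_nearly_one[of "e / 2"] e by auto
  show ?thesis
  proof (rule exI[of _ "min \<delta>1 \<delta>2"], intro conjI allI impI)
    show "0 < min \<delta>1 \<delta>2" using \<delta>1 \<delta>2 by simp
    fix \<delta> u assume \<delta>: "\<delta> \<le> min \<delta>1 \<delta>2"
      and gap: "energy2 Z u - energy2 Z Phi \<le> \<delta>" and mu: "mass u \<le> mass Phi + \<delta>"
    define w where "w = h1_fun u 0 / phi 0"
    \<comment> \<open>The phase is read off at the origin; on \<open>[- n, n]\<close> the quotient
      is close to \<open>w\<close>, and \<open>w\<close> is close to \<open>z\<close> since its
      modulus is close to 1.\<close>
    define z where "z = cis (Arg w)"
    have z: "cmod z = 1" "w = cmod w * z" by (auto simp: z_def rcis_cmod_Arg[unfolded rcis_def])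
    let ?y = "cscale z Phi"
    have wz: "cmod (w - z) \<le> e / 2"
    proof -
      have "w - z = (cmod w - 1) * z" by (subst (1) z(2)) (simp add: left_diff_distrib)
      then have "cmod (w - z) = cmod (complex_of_real (cmod w - 1))" using z(1) by (metis mult.right_neutral norm_mult of_real_1 of_real_diff)
      then show ?thesis using \<delta>2(2)[of u] gap \<delta> unfolding w_def[symmetric] norm_of_real by simp
    qed
    have pw: "(2 - e)\<^sup>2 * (indicator {- real n..real n} x *\<^sub>R (phi x)\<^sup>2) \<le> (cmod (h1_fun (u + ?y) x))\<^sup>2" for x
    proof (cases "x \<in> {- real n..real n}")
      case True
      have "cmod (h1_fun u x - w * phi x) \<le> e / 2 * phi x"
        unfolding w_def using \<delta>1(2)[of u x] gap_bounds(1)[OF gap] \<delta> True by (auto simp: abs_le_iff)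
      moreover have "cmod ((w - z) * phi x) \<le> e / 2 * phi x"
        using mult_right_mono[OF wz, of "phi x"] phi_pos[of x] by (simp add: norm_mult)
      ultimately have "cmod ((h1_fun u x - w * phi x) + (w - z) * phi x) \<le> e / 2 * phi x + e / 2 * phi x"
        by (rule norm_triangle_le[OF add_mono])
      moreover have "(h1_fun u x - w * phi x) + (w - z) * phi x = h1_fun (u + ?y) x - 2 * z * phi x"
        by (simp add: h1_fun_simps Phi_fun algebra_simps)
      ultimately have "cmod (h1_fun (u + ?y) x - 2 * z * phi x) \<le> e * phi x" by simp
      moreover have "cmod (2 * z * phi x) = 2 * phi x" using z phi_pos[of x] by (simp add: norm_mult)
      ultimately have "(2 - e) * phi x \<le> cmod (h1_fun (u + ?y) x)"
        using norm_triangle_ineq2[of "2 * z * phi x" "h1_fun (u + ?y) x"]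
        by (simp add: norm_minus_commute left_diff_distrib)
      then have "((2 - e) * phi x)\<^sup>2 \<le> (cmod (h1_fun (u + ?y) x))\<^sup>2"
        using e phi_pos[of x] by (intro power_mono mult_nonneg_nonneg) auto
      then show ?thesis using True by (simp add: power_mult_distrib)
    qed simp
    have "(2 - e)\<^sup>2 * I \<le> mass (u + ?y)"
      unfolding I_def mass_def integral_mult_right_zero[symmetric]
    proof (rule Bochner_Integration.integral_mono[OF _ L2_sq_integrable[OF h1_fun_L2] pw])
      show "integrable lborel (\<lambda>x. (2 - e)\<^sup>2 * (indicator {- real n..real n} x *\<^sub>R (phi x)\<^sup>2))"
        by (intro integrable_mult_right integrable_mult_indicator phi_sq_integrable) simp
    qed
    moreover have "(4 - 4 * e) * (mass Phi - e) \<le> (2 - e)\<^sup>2 * I"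
    proof -
      have "(4 - 4 * e) * (mass Phi - e) \<le> (4 - 4 * e) * I" using I e by (intro mult_left_mono) auto
      also have "\<dots> \<le> (2 - e)\<^sup>2 * I" using I by (intro mult_right_mono) (auto simp: power2_eq_square algebra_simps)
      finally show ?thesis .
    qed
    moreover have "mass ?y = mass Phi" using z by (simp add: mass_cscale)
    moreover have "(4 - 4 * e) * (mass Phi - e) \<ge> 4 * mass Phi - 4 * e * (mass Phi + 1)"
      using e by (simp add: algebra_simps)
    ultimately have "mass (u - ?y) \<le> 2 * \<delta> + 4 * e * (mass Phi + 1)"
      using mass_parallelogram[of u ?y] mu by linarith
    then show "\<exists>\<theta>. mass (u - cscale (cis \<theta>) Phi) \<le> 2 * \<delta> + 4 * e * (mass Phi + 1)"
      unfolding z_def by blast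
  qed
qed

text \<open>\<open>dev\<close> annihilates multiples of \<open>Phi\<close>, so the difference
  \<open>v = u - z * Phi\<close> satisfies \<open>v' = dev u + kap * v\<close> with
  \<open>kap\<close> bounded by \<open>B\<close>. Closeness in L2 together with a small gap thus
  gives closeness in H1.\<close>

lemma norm_distance_le:
  assumes "cmod z = 1"
  shows "(norm (u - cscale z Phi))\<^sup>2
    \<le> (1 + 2 * B\<^sup>2) * mass (u - cscale z Phi) + 2 * (\<integral>x. (cmod (dev u x))\<^sup>2 \<partial>lborel)"
proof -
  let ?v = "u - cscale z Phi"
  have "AE x in lborel. h1_deriv ?v x = dev u x + kap x * h1_fun ?v x"
    using h1_deriv_diff_AE[of u "cscale z Phi"] h1_deriv_cscale_AE[of z Phi] Phi_deriv_AE
    by eventually_elim (simp add: dev_def h1_fun_simps Phi_fun algebra_simps)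
  then have ae: "AE x in lborel. (cmod (h1_deriv ?v x))\<^sup>2 \<le> 2 * (cmod (dev u x))\<^sup>2 + 2 * B\<^sup>2 * (cmod (h1_fun ?v x))\<^sup>2"
  proof (rule eventually_mono)
    fix x assume *: "h1_deriv ?v x = dev u x + kap x * h1_fun ?v x"
    have "cmod (kap x * h1_fun ?v x) \<le> B * cmod (h1_fun ?v x)"
      using mult_right_mono[OF kap_bound[of x] norm_ge_zero[of "h1_fun ?v x"]] by (simp add: norm_mult)
    then have "cmod (h1_deriv ?v x) \<le> cmod (dev u x) + B * cmod (h1_fun ?v x)"
      unfolding * by (meson norm_triangle_le add_left_mono order_trans order_refl)
    then have "(cmod (h1_deriv ?v x))\<^sup>2 \<le> (cmod (dev u x) + B * cmod (h1_fun ?v x))\<^sup>2"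
      by (intro power_mono) auto
    also have "\<dots> \<le> 2 * (cmod (dev u x))\<^sup>2 + 2 * (B * cmod (h1_fun ?v x))\<^sup>2"
      using sum_squares_bound[of "cmod (dev u x)" "B * cmod (h1_fun ?v x)"] by (simp add: power2_sum)
    finally show "(cmod (h1_deriv ?v x))\<^sup>2 \<le> 2 * (cmod (dev u x))\<^sup>2 + 2 * B\<^sup>2 * (cmod (h1_fun ?v x))\<^sup>2"
      by (simp add: power_mult_distrib mult.assoc)
  qed
  have i: "integrable lborel (\<lambda>x. 2 * (cmod (dev u x))\<^sup>2)" "integrable lborel (\<lambda>x. 2 * B\<^sup>2 * (cmod (h1_fun ?v x))\<^sup>2)"
    by (intro integrable_mult_right L2_sq_integrable dev_L2 h1_fun_L2)+
  have "(\<integral>x. (cmod (h1_deriv ?v x))\<^sup>2 \<partial>lborel) \<le> (\<integral>x. 2 * (cmod (dev u x))\<^sup>2 + 2 * B\<^sup>2 * (cmod (h1_fun ?v x))\<^sup>2 \<partial>lborel)"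
    by (intro integral_mono_AE ae Bochner_Integration.integrable_add i L2_sq_integrable h1_deriv)
  also have "\<dots> = 2 * (\<integral>x. (cmod (dev u x))\<^sup>2 \<partial>lborel) + 2 * B\<^sup>2 * mass ?v"
    unfolding Bochner_Integration.integral_add[OF i] mass_def by simp
  finally show ?thesis unfolding h1_norm_sq by (simp add: algebra_simps)
qed

lemma energy_mass_coercive:
  assumes \<epsilon>: "0 < \<epsilon>"
  shows "\<exists>\<delta>>0. \<forall>u. energy2 Z u - energy2 Z Phi \<le> \<delta> \<longrightarrow> mass u \<le> mass Phi + \<delta> \<longrightarrow>
    (\<exists>\<theta>. norm (u - cscale (cis \<theta>) Phi) < \<epsilon>)"
proof -
  define K where "K = 1 + 2 * B\<^sup>2"
  have K: "K \<ge> 1" by (simp add: K_def)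
  have M: "mass Phi \<ge> 0" by (rule mass_nonneg)
  \<comment> \<open>The final bound is \<open>4 * K * \<delta> + 4 * K * e * (mass Phi + 1)\<close>.
    The choices of \<open>\<delta>\<close> and \<open>e\<close> make the summands at most one half
    and one quarter of \<open>\<epsilon>^2\<close>.\<close>
  define e where "e = min (1/2) (\<epsilon>\<^sup>2 / (16 * K * (mass Phi + 1)))"
  have "0 < \<epsilon>\<^sup>2 / (16 * K * (mass Phi + 1))"
    using \<epsilon> K M by (intro divide_pos_pos mult_pos_pos) auto
  then have e: "0 < e" "e < 1" by (auto simp: e_def)
  have eK: "K * (4 * e * (mass Phi + 1)) \<le> \<epsilon>\<^sup>2 / 4"
  proof -
    have "e \<le> \<epsilon>\<^sup>2 / (16 * K * (mass Phi + 1))" by (simp add: e_def)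
    moreover have "0 < 16 * K * (mass Phi + 1)" using K M by (intro mult_pos_pos) auto
    ultimately have "e * (16 * K * (mass Phi + 1)) \<le> \<epsilon>\<^sup>2" by (simp only: pos_le_divide_eq)
    then show ?thesis by (simp add: algebra_simps)
  qed
  obtain \<delta>0 where \<delta>0: "\<delta>0 > 0" "\<And>\<delta> u. \<delta> \<le> \<delta>0 \<Longrightarrow> energy2 Z u - energy2 Z Phi \<le> \<delta> \<Longrightarrow>
    mass u \<le> mass Phi + \<delta> \<Longrightarrow> \<exists>\<theta>. mass (u - cscale (cis \<theta>) Phi) \<le> 2 * \<delta> + 4 * e * (mass Phi + 1)"
    using mass_distance_small[OF e] by blast
  define \<delta> where "\<delta> = min \<delta>0 (\<epsilon>\<^sup>2 / (8 * K))"
  have \<delta>: "0 < \<delta>" "\<delta> \<le> \<delta>0" "K * \<delta> \<le> \<epsilon>\<^sup>2 / 8"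
  proof -
    show "0 < \<delta>" "\<delta> \<le> \<delta>0" using \<delta>0 \<epsilon> K by (auto simp: \<delta>_def)
    have "\<delta> \<le> \<epsilon>\<^sup>2 / (8 * K)" by (simp add: \<delta>_def)
    then show "K * \<delta> \<le> \<epsilon>\<^sup>2 / 8" using K by (simp add: field_simps)
  qed
  show ?thesis
  proof (rule exI[of _ \<delta>], intro conjI allI impI \<delta>(1))
    fix u assume gap: "energy2 Z u - energy2 Z Phi \<le> \<delta>" and mu: "mass u \<le> mass Phi + \<delta>"
    from \<delta>0(2)[OF \<delta>(2) gap mu] obtain \<theta>
      where \<theta>: "mass (u - cscale (cis \<theta>) Phi) \<le> 2 * \<delta> + 4 * e * (mass Phi + 1)" by blast
    have "(norm (u - cscale (cis \<theta>) Phi))\<^sup>2 \<le> K * mass (u - cscale (cis \<theta>) Phi) + 2 * (\<integral>x. (cmod (dev u x))\<^sup>2 \<partial>lborel)"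
      unfolding K_def by (rule norm_distance_le) simp
    also have "\<dots> \<le> K * (2 * \<delta> + 4 * e * (mass Phi + 1)) + 2 * \<delta>"
      using \<theta> gap_bounds(1)[OF gap] K by (intro add_mono mult_left_mono) auto
    also have "\<dots> \<le> 2 * (K * \<delta>) + K * (4 * e * (mass Phi + 1)) + 2 * (K * \<delta>)"
      using \<delta>(1) K mult_right_mono[of 1 K \<delta>] by (simp add: distrib_left)
    also have "\<dots> \<le> 2 * (\<epsilon>\<^sup>2 / 8) + \<epsilon>\<^sup>2 / 4 + 2 * (\<epsilon>\<^sup>2 / 8)"
      using \<delta>(3) eK by linarith
    also have "\<dots> < \<epsilon>\<^sup>2" using \<epsilon> by simp
    finally have "norm (u - cscale (cis \<theta>) Phi) < \<epsilon>"
      using \<epsilon> by (simp add: power2_less_imp_less)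
    then show "\<exists>\<theta>. norm (u - cscale (cis \<theta>) Phi) < \<epsilon>" by blast
  qed
qed

lemma Phi_orbitally_stable: "orbitally_stable p lam1 lam2 Z Phi"
  unfolding orbitally_stable_def
proof (intro allI impI)
  fix \<epsilon> :: real assume "0 < \<epsilon>"
  from energy_mass_coercive[OF this] obtain \<delta> where \<delta>: "\<delta> > 0"
    "\<And>u. energy2 Z u - energy2 Z Phi \<le> \<delta> \<Longrightarrow> mass u \<le> mass Phi + \<delta> \<Longrightarrow>
      \<exists>\<theta>. norm (u - cscale (cis \<theta>) Phi) < \<epsilon>" by blast
  define b where "b = norm Phi + 1"
  \<comment> \<open>One constant for both invariants: it dominates the Lipschitz constant of the
    energy on the ball of radius \<open>b\<close> and the factor \<open>norm (u0 + Phi)\<close>, at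
    most \<open>2 * b\<close>, in the bound for the mass.\<close>
  define L where "L = ((2 + 4 * \<bar>Z\<bar>) * (2 * b) + 4 * lip (2 * b) * b) + 2 * b + 1"
  have b: "b \<ge> 1" by (simp add: b_def)
  have E: "(2 + 4 * \<bar>Z\<bar>) * (2 * b) + 4 * lip (2 * b) * b \<ge> 0"
    using b lip_nonneg[of "2 * b"] by simp
  then have L: "L > 0" using b by (simp add: L_def)
  show "\<exists>\<eta>>0. \<forall>u0. norm (u0 - Phi) < \<eta> \<longrightarrow> (\<forall>u. nls_solution p lam1 lam2 Z u \<and> u 0 = u0 \<longrightarrow>
      (\<forall>t. (INF \<theta>. norm (u t - cscale (cis \<theta>) Phi)) < \<epsilon>))"
  proof (intro exI[of _ "min 1 (\<delta> / L)"] conjI allI impI)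
    show "0 < min 1 (\<delta> / L)" using \<delta> L by simp
    fix u0 u t
    assume u0: "norm (u0 - Phi) < min 1 (\<delta> / L)" and u: "nls_solution p lam1 lam2 Z u \<and> u 0 = u0"
    have nb: "norm u0 \<le> b" "norm Phi \<le> b"
      using norm_triangle_ineq2[of u0 Phi] u0 by (auto simp: b_def)
    have small: "norm (u0 - Phi) * L \<le> \<delta>" using u0 L by (simp add: less_divide_eq)
    have "energy2 Z (u t) - energy2 Z Phi = energy2 Z u0 - energy2 Z Phi"
      using energy_conserved[of Z u t] u by simp
    also have "\<dots> \<le> ((2 + 4 * \<bar>Z\<bar>) * (2 * b) + 4 * lip (2 * b) * b) * norm (u0 - Phi)"
      using energy2_lipschitz[OF nb(2,1), of Z] by linarith
    also have "\<dots> \<le> L * norm (u0 - Phi)"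
      using b by (intro mult_right_mono) (auto simp: L_def)
    finally have 1: "energy2 Z (u t) - energy2 Z Phi \<le> \<delta>" using small by (simp add: mult.commute)
    have "mass (u t) - mass Phi = mass u0 - mass Phi"
      using mass_conserved[of Z u t] u by simp
    also have "\<dots> \<le> norm (u0 + Phi) * norm (u0 - Phi)" by (rule mass_diff_le)
    also have "\<dots> \<le> L * norm (u0 - Phi)"
      using norm_triangle_ineq[of u0 Phi] nb E by (intro mult_right_mono) (auto simp: L_def)
    finally have 2: "mass (u t) \<le> mass Phi + \<delta>" using small by (simp add: mult.commute)
    from \<delta>(2)[OF 1 2] obtain \<theta> where "norm (u t - cscale (cis \<theta>) Phi) < \<epsilon>" by blast
    moreover have "(INF \<theta>. norm (u t - cscale (cis \<theta>) Phi)) \<le> norm (u t - cscale (cis \<theta>) Phi)"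
      by (rule cINF_lower) (auto intro: bdd_belowI[of _ 0])
    ultimately show "(INF \<theta>. norm (u t - cscale (cis \<theta>) Phi)) < \<epsilon>" by linarith
  qed
qed

end

subsection \<open>The explicit profile\<close>

locale explicit_profile = double_power +
  fixes d Z :: real
  assumes p5: "p < 5" and d_gt: "- l0 p lam1 lam2 < d" and R2_d: "R2 p lam1 lam2 d = Z / 4"
begin

text \<open>
  For \<open>\<phi> = v\<^bsup>-1/(p-1)\<^esup>\<close> the first integral of the stationary equation becomes
  \<open>(v')\<^sup>2 = 4 A (v + E)\<close>, which is solved by the parabolas below.
\<close>

definition A :: real where "A = (p - 1)\<^sup>2 * (- lam1) / (2 * (p + 1))"

definition E :: real where "E = (p + 1) * lam2 / (2 * p * lam1)"

definition v :: "real \<Rightarrow> real" where "v x = A * (x + d)\<^sup>2 - E"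

definition prof :: "real \<Rightarrow> real" where "prof x = v x powr (- 1 / (p - 1))"

definition slope :: "real \<Rightarrow> real" where "slope x = - 2 * A * (x + d) / ((p - 1) * v x)"

lemma A_pos: "A > 0" and E_pos: "E > 0"
proof -
  show "A > 0" unfolding A_def using p lam1 by (intro divide_pos_pos mult_pos_pos) auto
  have "lam2 / lam1 > 0" using lam1 lam2 by (rule divide_neg_neg[rotated])
  moreover have "(p + 1) / (2 * p) > 0" using p by (intro divide_pos_pos) auto
  ultimately have "(p + 1) / (2 * p) * (lam2 / lam1) > 0" by (rule mult_pos_pos[rotated])
  then show "E > 0" by (simp add: E_def)
qed

lemma l0_neg: "l0 p lam1 lam2 < 0"
  unfolding l0_def using p lam1 lam2 by (intro divide_pos_neg mult_pos_pos mult_pos_neg) auto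

text \<open>The parabola \<open>v\<close> vanishes exactly where \<open>x + d\<close> is
  \<open>l0\<close> or \<open>- l0\<close>, which explains the domain of \<open>R2\<close>: for
  \<open>d > - l0\<close> it is positive on the half line.\<close>

lemma l0_sq: "A * (l0 p lam1 lam2)\<^sup>2 = E"
proof -
  have "(l0 p lam1 lam2)\<^sup>2 = \<bar>lam2\<bar> * (p + 1)\<^sup>2 / (p * (p - 1)\<^sup>2 * lam1\<^sup>2)"
    unfolding l0_def using p by (simp add: power_divide power_mult_distrib)
  also have "\<bar>lam2\<bar> = - lam2" using lam2 by simp
  finally have *: "(l0 p lam1 lam2)\<^sup>2 = - lam2 * (p + 1)\<^sup>2 / (p * (p - 1)\<^sup>2 * lam1\<^sup>2)" .
  have "p \<noteq> 0" "p - 1 \<noteq> 0" "p + 1 \<noteq> 0" "lam1 \<noteq> 0" using p lam1 by auto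
  then show ?thesis unfolding * A_def E_def by (simp add: divide_simps power2_eq_square)
qed

lemma d_pos: "d > 0"
  using d_gt l0_neg by linarith

lemma Ad: "A * d\<^sup>2 > E"
proof -
  have "(l0 p lam1 lam2)\<^sup>2 < d\<^sup>2"
    using d_gt l0_neg by (metis power2_minus neg_0_less_iff_less less_imp_le power_strict_mono zero_less_numeral)
  then show ?thesis using A_pos l0_sq by (metis mult_strict_left_mono)
qed

text \<open>The largest constant for which \<open>c0 * (x + d)^2\<close> stays below
  \<open>v x\<close> on the half line, with equality at \<open>x = 0\<close>. This quadratic growth
  gives both the decay of \<open>slope\<close> and the integrability of the squared profile.\<close>

definition c0 :: real where "c0 = A - E / d\<^sup>2"

lemma c0_pos: "c0 > 0"
  using Ad d_pos by (simp add: c0_def field_simps)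

lemma v_lower: "0 \<le> x \<Longrightarrow> c0 * (x + d)\<^sup>2 \<le> v x"
proof -
  assume "0 \<le> x"
  then have "d\<^sup>2 \<le> (x + d)\<^sup>2" using d_pos by (intro power_mono) auto
  then have "E / d\<^sup>2 * d\<^sup>2 \<le> E / d\<^sup>2 * (x + d)\<^sup>2" using E_pos by (intro mult_left_mono) auto
  then show ?thesis using d_pos by (simp add: v_def c0_def left_diff_distrib)
qed

lemma v_pos: "0 \<le> x \<Longrightarrow> 0 < v x"
  using v_lower[of x] c0_pos d_pos by (smt (verit) mult_pos_pos zero_less_power)

lemma v_mono: "0 \<le> x \<Longrightarrow> v 0 \<le> v x"
  using A_pos d_pos unfolding v_def by (auto intro!: mult_left_mono power_mono)

lemma v_deriv: "(v has_real_derivative 2 * A * (x + d)) (at x within S)"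
  unfolding v_def[abs_def] by (auto intro!: derivative_eq_intros)

lemma weight_prof:
  assumes "0 \<le> x"
  shows "weight (prof x) = - lam1 / v x - lam2 / (v x)\<^sup>2"
proof -
  have "- 1 / (p - 1) * (p - 1) = - 1" "- 1 / (p - 1) * (2 * p - 2) = - 2"
    using p by (simp_all add: divide_simps)
  then have "prof x powr (p - 1) = v x powr (- 1)" "prof x powr (2 * p - 2) = v x powr (- 2)"
    unfolding prof_def powr_powr by (simp_all only:)
  then show ?thesis
    using v_pos[OF assms] by (simp add: weight_def powr_minus powr_numeral divide_inverse)
qed

lemma prof_deriv:
  assumes "0 \<le> x"
  shows "(prof has_real_derivative slope x * prof x) (at x within {0..})"
proof -
  have "((\<lambda>z. z powr (- 1 / (p - 1))) has_real_derivative - 1 / (p - 1) * v x powr (- 1 / (p - 1) - 1)) (at (v x))"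
    using v_pos[OF assms] by (rule has_real_derivative_powr)
  from DERIV_chain2[OF this v_deriv]
  have "(prof has_real_derivative - 1 / (p - 1) * v x powr (- 1 / (p - 1) - 1) * (2 * A * (x + d))) (at x within {0..})"
    by (simp add: prof_def[abs_def])
  moreover have "v x powr (- 1 / (p - 1) - 1) = prof x / v x"
    using v_pos[OF assms] by (simp add: prof_def powr_diff)
  ultimately show ?thesis by (simp add: slope_def mult_ac)
qed

text \<open>Substituting \<open>V + E\<close> for \<open>A * (x + d)^2\<close> turns the Riccati
  equation into an identity between multiples of \<open>1 / V\<close> and \<open>1 / V^2\<close>.
  Comparing the two coefficients is what determines \<open>A\<close> and \<open>E\<close>.\<close>

lemma slope_deriv:
  assumes "0 \<le> x"
  shows "(slope has_real_derivative weight (prof x) - (slope x)\<^sup>2) (at x within {0..})"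
proof -
  note vp = v_pos[OF assms]
  have "((\<lambda>x. - 2 * A * (x + d)) has_real_derivative - 2 * A) (at x within {0..})"
    by (auto intro!: derivative_eq_intros)
  moreover have "(p - 1) * v x \<noteq> 0" using vp p by simp
  ultimately have "(slope has_real_derivative (- 2 * A * ((p - 1) * v x) - (- 2 * A * (x + d)) * ((p - 1) * (2 * A * (x + d))))
      / (((p - 1) * v x) * ((p - 1) * v x))) (at x within {0..})"
    unfolding slope_def[abs_def] by (rule DERIV_divide[OF _ DERIV_cmult[OF v_deriv]])
  moreover have "(- 2 * A * ((p - 1) * v x) - (- 2 * A * (x + d)) * ((p - 1) * (2 * A * (x + d))))
      / (((p - 1) * v x) * ((p - 1) * v x)) = weight (prof x) - (slope x)\<^sup>2"
  proof -
    define y V where "y = A * (x + d)\<^sup>2" and "V = v x"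
    have y: "y = V + E" by (simp add: y_def V_def v_def)
    have V: "V \<noteq> 0" using vp by (simp add: V_def)
    have nz: "p \<noteq> 0" "p - 1 \<noteq> 0" "p + 1 \<noteq> 0" "lam1 \<noteq> 0" using p lam1 by auto
    have "(- 2 * A * ((p - 1) * v x) - (- 2 * A * (x + d)) * ((p - 1) * (2 * A * (x + d))))
      / (((p - 1) * v x) * ((p - 1) * v x)) = (- 2 * A * V + 4 * A * y) / ((p - 1) * V\<^sup>2)"
      using nz V by (simp add: y_def V_def[symmetric] divide_simps) (simp add: power2_eq_square algebra_simps)
    moreover have "(slope x)\<^sup>2 = 4 * A * y / ((p - 1)\<^sup>2 * V\<^sup>2)"
      by (simp add: slope_def y_def V_def power_divide power_mult_distrib) (simp add: power2_eq_square)
    moreover have "weight (prof x) = - lam1 / V - lam2 / V\<^sup>2"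
      using weight_prof[OF assms] by (simp add: V_def)
    moreover have "(- 2 * A * V + 4 * A * y) / ((p - 1) * V\<^sup>2) + 4 * A * y / ((p - 1)\<^sup>2 * V\<^sup>2) = - lam1 / V - lam2 / V\<^sup>2"
      unfolding y A_def E_def using nz V by (simp add: divide_simps) (simp add: power2_eq_square algebra_simps)
    ultimately show ?thesis by simp
  qed
  ultimately show ?thesis by simp
qed

text \<open>Since \<open>v 0 = A * (d^2 - l0^2)\<close>, the slope at 0 is
  \<open>- 2 * R2 d\<close>. The jump condition thus becomes \<open>R2 d = Z / 4\<close>.\<close>

lemma slope_0: "slope 0 = - Z / 2"
proof -
  have "slope 0 = - 2 * (A * d) / ((p - 1) * (A * (d\<^sup>2 - (l0 p lam1 lam2)\<^sup>2)))"
    unfolding slope_def v_def by (simp add: right_diff_distrib l0_sq mult.assoc)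
  also have "\<dots> = - 2 * (d / ((p - 1) * (d\<^sup>2 - (l0 p lam1 lam2)\<^sup>2)))"
    using A_pos by simp
  also have "\<dots> = - 2 * (Z / 4)" using R2_d unfolding R2_def by (simp only:)
  finally show ?thesis by simp
qed

lemma slope_le:
  assumes "0 \<le> x"
  shows "\<bar>slope x\<bar> \<le> 2 * A / ((p - 1) * c0) / (x + d)"
proof -
  have xd: "x + d > 0" using assms d_pos by simp
  have "\<bar>slope x\<bar> = 2 * A * (x + d) / ((p - 1) * v x)"
    using A_pos xd v_pos[OF assms] p by (simp add: slope_def abs_mult)
  also have "\<dots> \<le> 2 * A * (x + d) / ((p - 1) * (c0 * (x + d)\<^sup>2))"
    using A_pos xd p c0_pos v_lower[OF assms] v_pos[OF assms]
    by (intro divide_left_mono mult_left_mono mult_pos_pos) auto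
  also have "\<dots> = 2 * A / ((p - 1) * c0) / (x + d)"
    using xd by (simp add: power2_eq_square)
  finally show ?thesis .
qed

lemma shift_at_top: "LIM x at_top. x + d :> at_top"
  using filterlim_tendsto_add_at_top[OF tendsto_const[of d] filterlim_ident] by (simp add: add.commute)

lemma slope_lim: "(slope \<longlongrightarrow> 0) at_top"
proof (rule Lim_null_comparison)
  show "\<forall>\<^sub>F x in at_top. norm (slope x) \<le> 2 * A / ((p - 1) * c0) / (x + d)"
    using eventually_ge_at_top[of 0] by eventually_elim (use slope_le in simp)
  show "((\<lambda>x. 2 * A / ((p - 1) * c0) / (x + d)) \<longlongrightarrow> 0) at_top"
    by (intro tendsto_divide_0[OF tendsto_const] filterlim_at_top_imp_at_infinity shift_at_top)
qed

lemma prof_integrable: "integrable lborel (\<lambda>x. (prof \<bar>x\<bar>)\<^sup>2)"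
proof -
  define s where "s = 4 / (p - 1)"
  \<comment> \<open>The squared profile is dominated by a multiple of
    \<open>(x + d) powr (- s)\<close>, and \<open>4 / (p - 1) > 1\<close> is the condition
    \<open>p < 5\<close>.\<close>
  have s: "s > 1" using p p5 by (simp add: s_def)
  define g where "g x = (x + d) powr (- s) * indicator {0..} x" for x
  have "(\<integral>\<^sup>+x. ennreal ((x + d) powr (- s)) * indicator {0..} x \<partial>lborel) = ennreal (0 - (0 + d) powr (1 - s) / (1 - s))"
  proof (rule nn_integral_FTC_atLeast)
    fix x :: real assume x: "0 \<le> x"
    have "((\<lambda>z. z powr (1 - s)) has_real_derivative (1 - s) * (x + d) powr (1 - s - 1)) (at (x + d))"
      using x d_pos by (intro has_real_derivative_powr) auto
    moreover have "((\<lambda>x. x + d) has_real_derivative 1) (at x)" by (auto intro!: derivative_eq_intros)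
    ultimately have "((\<lambda>x. (x + d) powr (1 - s)) has_real_derivative (1 - s) * (x + d) powr (1 - s - 1) * 1) (at x)"
      by (rule DERIV_chain2)
    from DERIV_cdivide[OF this, of "1 - s"]
    show "((\<lambda>x. (x + d) powr (1 - s) / (1 - s)) has_real_derivative (x + d) powr (- s)) (at x)"
      using s by simp
  next
    have "((\<lambda>x. (x + d) powr (1 - s)) \<longlongrightarrow> 0) at_top"
      using s by (intro tendsto_neg_powr shift_at_top) auto
    then show "((\<lambda>x. (x + d) powr (1 - s) / (1 - s)) \<longlongrightarrow> 0) at_top"
      by (rule tendsto_divide_zero)
  qed simp_all
  then have "(\<integral>\<^sup>+x. ennreal (g x) \<partial>lborel) < \<infinity>"
    by (simp add: g_def ennreal_mult' ennreal_indicator)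
  moreover have "g \<in> borel_measurable borel" unfolding g_def[abs_def] by measurable
  ultimately have gi: "integrable lborel g"
    by (intro integrableI_nonneg) (auto simp: g_def)
  then have gi': "integrable lborel (\<lambda>x. g (- x))"
    using lborel_integrable_real_affine[OF gi, of "-1" 0] by simp
  show ?thesis
  proof (rule Bochner_Integration.integrable_bound)
    show "integrable lborel (\<lambda>x. c0 powr (- 2 / (p - 1)) * (g x + g (- x)))"
      using gi gi' by simp
    show "(\<lambda>x. (prof \<bar>x\<bar>)\<^sup>2) \<in> borel_measurable lborel"
      unfolding prof_def v_def by measurable
    have "(prof \<bar>x\<bar>)\<^sup>2 \<le> c0 powr (- 2 / (p - 1)) * (g x + g (- x))" for x
    proof -
      have xd: "\<bar>x\<bar> + d > 0" using d_pos by simp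
      have "(prof \<bar>x\<bar>)\<^sup>2 = v \<bar>x\<bar> powr (- 2 / (p - 1))"
        by (simp add: prof_def power2_eq_square flip: powr_add)
      also have "\<dots> \<le> (c0 * (\<bar>x\<bar> + d)\<^sup>2) powr (- 2 / (p - 1))"
        using v_lower[of "\<bar>x\<bar>"] c0_pos xd p by (intro powr_mono2') (auto intro: mult_pos_pos divide_nonpos_pos)
      also have "\<dots> = c0 powr (- 2 / (p - 1)) * (\<bar>x\<bar> + d) powr (- s)"
        using xd c0_pos powr_powr[of "\<bar>x\<bar> + d" 2 "- 2 / (p - 1)"] by (simp add: powr_mult s_def)
      also have "\<dots> \<le> c0 powr (- 2 / (p - 1)) * (g x + g (- x))"
        by (intro mult_left_mono) (auto simp: g_def indicator_def abs_if)
      finally show ?thesis .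
    qed
    moreover have "0 \<le> c0 powr (- 2 / (p - 1)) * (g x + g (- x))" for x by (simp add: g_def)
    ultimately show "AE x in lborel. norm ((prof \<bar>x\<bar>)\<^sup>2) \<le> norm (c0 powr (- 2 / (p - 1)) * (g x + g (- x)))"
      by simp
  qed
qed

sublocale ground_state p lam1 lam2 Z "2 * A / ((p - 1) * c0) / d" "prof 0" prof slope
proof
  show "0 < prof x" if "0 \<le> x" for x using v_pos[OF that] by (simp add: prof_def)
  show "prof x \<le> prof 0" if "0 \<le> x" for x
    unfolding prof_def using v_pos[of 0] v_mono[OF that] p by (intro powr_mono2') (auto intro: divide_nonpos_pos)
  show "\<bar>slope x\<bar> \<le> 2 * A / ((p - 1) * c0) / d" if "0 \<le> x" for x
    by (rule order_trans[OF slope_le[OF that]])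
      (use that A_pos p c0_pos d_pos in \<open>intro divide_left_mono mult_pos_pos divide_nonneg_pos; simp\<close>)
qed (rule prof_deriv slope_deriv slope_0 slope_lim prof_integrable; assumption?)+

lemma phi0_eq:
  assumes "R2_inv p lam1 lam2 (Z / 4) = d"
  shows "phi0 p lam1 lam2 Z x = prof \<bar>x\<bar>"
proof -
  have v: "v \<bar>x\<bar> > 0" by (rule v_pos) simp
  have nz: "p \<noteq> 0" "p + 1 \<noteq> 0" "lam1 \<noteq> 0" using p lam1 by auto
  have "p * (p - 1)\<^sup>2 * lam1\<^sup>2 * (\<bar>x\<bar> + d)\<^sup>2 + (p + 1)\<^sup>2 * lam2 = - 2 * p * (p + 1) * lam1 * v \<bar>x\<bar>"
    unfolding v_def A_def E_def using nz by (simp add: divide_simps) (simp add: power2_eq_square algebra_simps)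
  then have "phi0 p lam1 lam2 Z x = (1 / v \<bar>x\<bar>) powr (1 / (p - 1))"
    unfolding phi0_def assms using nz by simp
  also have "\<dots> = prof \<bar>x\<bar>"
    using v by (simp add: prof_def powr_minus powr_divide inverse_eq_divide)
  finally show ?thesis .
qed

end

text \<open>The equation \<open>R2 d = Z / 4\<close> is the quadratic
  \<open>d^2 - 2 * m * d - l^2 = 0\<close>. Its positive root exceeds \<open>- l\<close>, so
  \<open>Z / 4\<close> lies in the image and \<open>inv_into\<close> returns a genuine
  preimage.\<close>

lemma R2_inv_solves:
  assumes "1 < p" "lam1 < 0" "lam2 < 0" "0 < Z"
  shows "- l0 p lam1 lam2 < R2_inv p lam1 lam2 (Z / 4)" "R2 p lam1 lam2 (R2_inv p lam1 lam2 (Z / 4)) = Z / 4"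
proof -
  define l m d where "l = l0 p lam1 lam2" and "m = 2 / ((p - 1) * Z)" and "d = m + sqrt (m\<^sup>2 + l\<^sup>2)"
  have m: "m > 0" using assms by (simp add: m_def)
  have "\<bar>l\<bar> \<le> sqrt (m\<^sup>2 + l\<^sup>2)" by (rule real_le_rsqrt) simp
  then have d: "- l < d" "d > 0" using m abs_ge_minus_self[of l] abs_ge_zero[of l] unfolding d_def by linarith+
  have "(d - m)\<^sup>2 = m\<^sup>2 + l\<^sup>2" by (simp add: d_def)
  then have "d\<^sup>2 - l\<^sup>2 = 2 * m * d" by (simp add: power2_eq_square algebra_simps)
  then have "R2 p lam1 lam2 d = Z / 4"
    using d m assms by (simp add: R2_def l_def[symmetric]) (simp add: m_def field_simps)
  then have "Z / 4 \<in> R2 p lam1 lam2 ` {- l0 p lam1 lam2 <..}" using d by (force simp: l_def)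
  then show "- l0 p lam1 lam2 < R2_inv p lam1 lam2 (Z / 4)" "R2 p lam1 lam2 (R2_inv p lam1 lam2 (Z / 4)) = Z / 4"
    using inv_into_into[of "Z / 4" "R2 p lam1 lam2" "{- l0 p lam1 lam2 <..}"] f_inv_into_f[of "Z / 4" "R2 p lam1 lam2"]
    by (auto simp: R2_inv_def)
qed

theorem theorem1p4:
  fixes p lam1 lam2 Z :: real
  assumes "1 < p" and "p < 5" and "lam1 < 0" and "lam2 < 0" and "Z > 0"
  shows "\<exists>\<Phi> :: h1. (\<forall>x. h1_fun \<Phi> x = complex_of_real (phi0 p lam1 lam2 Z x)) \<and>
           nls_solution p lam1 lam2 Z (\<lambda>t. \<Phi>) \<and>
           orbitally_stable p lam1 lam2 Z \<Phi>"
proof -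
  interpret explicit_profile p lam1 lam2 "R2_inv p lam1 lam2 (Z / 4)" Z
    by unfold_locales (use assms R2_inv_solves[of p lam1 lam2 Z] in auto)
  have "h1_fun Phi x = complex_of_real (phi0 p lam1 lam2 Z x)" for x
    by (simp add: Phi_fun phi_def phi0_eq)
  then show ?thesis
    using Phi_stationary Phi_orbitally_stable by blast
qed

end
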